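(* Let $p$ be a prime and $A$ a commutative ring with $\mathbb{Q}\subseteq A$. The following are equivalent: (a) $\mathrm{Spec}\,D_p(A)$ is non-empty; (b) there exists a $p$-divisibility on $A$; (c) there is a ring homomorphism $\delta$ with $\delta(1)=1$ from $A$ into some field carrying a $p$-valuation. Moreover, $\mathrm{Spec}\,D_p(A)$ contains a $p$-archimedean element if and only if there is a ring homomorphism $\delta:A\to\mathbb{Q}_p$ with $\delta(1)=1$.
   Context: A divisibility on $A$ is a binary relation $|\subseteq A\times A$ such that for all $a,b,c$: (1) $a|a$; (2) $a|b,\ b|c\Rightarrow a|c$; (3) $a|b,\ a|c\Rightarrow a|b-c$; (4) $a|b\Rightarrow ac|bc$; (5) $0\nmid1$. A $p$-divisibility additionally satisfies for all $a,b$: (6) $0\nmid a\Rightarrow pa\nmid a$; (7) $p[(a^pb-b^pa)^2-(b^{p+1})^2]\ \big|\ (a^pb-b^pa)b^{p+1}$. It is $p$-archimedean if for all $a$ there is $m\in\mathbb{Z}$ with $p^m|a$. $\mathrm{Spec}\,D_p(A)$ is the set of $p$-divisibilities $|$ that are total ($a|b$ or $b|a$ for all $a,b$) and have cancellation ($0\nmid c,\ ac|bc\Rightarrow a|b$). A $p$-valuation on a field of characteristic $0$ is a valuation whose value group is discretely ordered with $v(p)$ minimal positive and whose residue field is $\mathbb{F}_p$. *)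

theory Defs
  imports "HOL-Algebra.Algebra" "HOL-Computational_Algebra.Factorial_Ring"
begin

definition divisibility :: "('a::comm_ring_1 \<Rightarrow> 'a \<Rightarrow> bool) \<Rightarrow> bool" where
  "divisibility dv \<longleftrightarrow>
     (\<forall>a. dv a a) \<and>
     (\<forall>a b c. dv a b \<longrightarrow> dv b c \<longrightarrow> dv a c) \<and>
     (\<forall>a b c. dv a b \<longrightarrow> dv a c \<longrightarrow> dv a (b - c)) \<and>
     (\<forall>a b c. dv a b \<longrightarrow> dv (a * c) (b * c)) \<and>
     \<not> dv 0 1"

definition p_divisibility :: "nat \<Rightarrow> ('a::comm_ring_1 \<Rightarrow> 'a \<Rightarrow> bool) \<Rightarrow> bool" where
  "p_divisibility p dv \<longleftrightarrow>
     divisibility dv \<and>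
     (\<forall>a. \<not> dv 0 a \<longrightarrow> \<not> dv (of_nat p * a) a) \<and>
     (\<forall>a b. dv (of_nat p * ((a ^ p * b - b ^ p * a)\<^sup>2 - (b ^ (p + 1))\<^sup>2))
               ((a ^ p * b - b ^ p * a) * b ^ (p + 1)))"

text \<open>Integer powers of p in A (p is a unit in A since Q is contained in A).\<close>
definition int_pow_p :: "nat \<Rightarrow> int \<Rightarrow> 'a::comm_ring_1" where
  "int_pow_p p m = (if 0 \<le> m then of_nat p ^ nat m
                    else (THE u. u * of_nat p ^ nat (- m) = 1))"

definition p_archimedean :: "nat \<Rightarrow> ('a::comm_ring_1 \<Rightarrow> 'a \<Rightarrow> bool) \<Rightarrow> bool" where
  "p_archimedean p dv \<longleftrightarrow> (\<forall>a. \<exists>m::int. dv (int_pow_p p m) a)"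

definition SpecDp :: "nat \<Rightarrow> ('a::comm_ring_1 \<Rightarrow> 'a \<Rightarrow> bool) set" where
  "SpecDp p = {dv. p_divisibility p dv \<and>
                   (\<forall>a b. dv a b \<or> dv b a) \<and>
                   (\<forall>a b c. \<not> dv 0 c \<longrightarrow> dv (a * c) (b * c) \<longrightarrow> dv a b)}"

definition ring_hom_into :: "('b, 'm) ring_scheme \<Rightarrow> ('a::comm_ring_1 \<Rightarrow> 'b) \<Rightarrow> bool" where
  "ring_hom_into K \<delta> \<longleftrightarrow>
     (\<forall>a. \<delta> a \<in> carrier K) \<and>
     (\<forall>a b. \<delta> (a + b) = \<delta> a \<oplus>\<^bsub>K\<^esub> \<delta> b) \<and>
     (\<forall>a b. \<delta> (a * b) = \<delta> a \<otimes>\<^bsub>K\<^esub> \<delta> b) \<and>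
     \<delta> 1 = \<one>\<^bsub>K\<^esub>"

definition char_zero_ring :: "('b, 'm) ring_scheme \<Rightarrow> bool" where
  "char_zero_ring K \<longleftrightarrow> (\<forall>n::nat. n > 0 \<longrightarrow> [n] \<cdot>\<^bsub>K\<^esub> \<one>\<^bsub>K\<^esub> \<noteq> \<zero>\<^bsub>K\<^esub>)"

definition ordered_abelian_group ::
  "'g set \<Rightarrow> ('g \<Rightarrow> 'g \<Rightarrow> 'g) \<Rightarrow> 'g \<Rightarrow> ('g \<Rightarrow> 'g \<Rightarrow> bool) \<Rightarrow> bool" where
  "ordered_abelian_group G pl z leq \<longleftrightarrow>
     comm_group \<lparr>carrier = G, monoid.mult = pl, one = z\<rparr> \<and>
     (\<forall>x\<in>G. leq x x) \<and>
     (\<forall>x\<in>G. \<forall>y\<in>G. leq x y \<longrightarrow> leq y x \<longrightarrow> x = y) \<and>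
     (\<forall>x\<in>G. \<forall>y\<in>G. \<forall>w\<in>G. leq x y \<longrightarrow> leq y w \<longrightarrow> leq x w) \<and>
     (\<forall>x\<in>G. \<forall>y\<in>G. leq x y \<or> leq y x) \<and>
     (\<forall>x\<in>G. \<forall>y\<in>G. \<forall>w\<in>G. leq x y \<longrightarrow> leq (pl x w) (pl y w))"

definition discretely_ordered ::
  "'g set \<Rightarrow> 'g \<Rightarrow> ('g \<Rightarrow> 'g \<Rightarrow> bool) \<Rightarrow> bool" where
  "discretely_ordered G z leq \<longleftrightarrow>
     (\<exists>e\<in>G. leq z e \<and> e \<noteq> z \<and> (\<forall>g\<in>G. leq z g \<and> g \<noteq> z \<longrightarrow> leq e g))"

text \<open>A Krull valuation v on the field K with value group G (v is given on the
  nonzero elements; v(0) = \<infinity> implicitly).  G is exactly the value group v(K^*).\<close>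
definition valuation ::
  "('b, 'm) ring_scheme \<Rightarrow> 'g set \<Rightarrow> ('g \<Rightarrow> 'g \<Rightarrow> 'g) \<Rightarrow> 'g \<Rightarrow> ('g \<Rightarrow> 'g \<Rightarrow> bool)
   \<Rightarrow> ('b \<Rightarrow> 'g) \<Rightarrow> bool" where
  "valuation K G pl z leq v \<longleftrightarrow>
     ordered_abelian_group G pl z leq \<and>
     v ` (carrier K - {\<zero>\<^bsub>K\<^esub>}) = G \<and>
     (\<forall>x\<in>carrier K - {\<zero>\<^bsub>K\<^esub>}. \<forall>y\<in>carrier K - {\<zero>\<^bsub>K\<^esub>}.
        v (x \<otimes>\<^bsub>K\<^esub> y) = pl (v x) (v y)) \<and>
     (\<forall>x\<in>carrier K - {\<zero>\<^bsub>K\<^esub>}. \<forall>y\<in>carrier K - {\<zero>\<^bsub>K\<^esub>}.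
        x \<oplus>\<^bsub>K\<^esub> y \<noteq> \<zero>\<^bsub>K\<^esub> \<longrightarrow>
          leq (v x) (v (x \<oplus>\<^bsub>K\<^esub> y)) \<or> leq (v y) (v (x \<oplus>\<^bsub>K\<^esub> y)))"

definition val_ring :: "('b, 'm) ring_scheme \<Rightarrow> 'g \<Rightarrow> ('g \<Rightarrow> 'g \<Rightarrow> bool) \<Rightarrow> ('b \<Rightarrow> 'g) \<Rightarrow> 'b set" where
  "val_ring K z leq v = {x \<in> carrier K. x = \<zero>\<^bsub>K\<^esub> \<or> leq z (v x)}"

definition val_ideal :: "('b, 'm) ring_scheme \<Rightarrow> 'g \<Rightarrow> ('g \<Rightarrow> 'g \<Rightarrow> bool) \<Rightarrow> ('b \<Rightarrow> 'g) \<Rightarrow> 'b set" where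
  "val_ideal K z leq v = {x \<in> carrier K. x = \<zero>\<^bsub>K\<^esub> \<or> (leq z (v x) \<and> v x \<noteq> z)}"

definition residue_field ::
  "('b, 'm) ring_scheme \<Rightarrow> 'g \<Rightarrow> ('g \<Rightarrow> 'g \<Rightarrow> bool) \<Rightarrow> ('b \<Rightarrow> 'g) \<Rightarrow> 'b set ring" where
  "residue_field K z leq v =
     (K\<lparr>carrier := val_ring K z leq v\<rparr>) Quot (val_ideal K z leq v)"

definition p_valuation ::
  "nat \<Rightarrow> ('b, 'm) ring_scheme \<Rightarrow> 'g set \<Rightarrow> ('g \<Rightarrow> 'g \<Rightarrow> 'g) \<Rightarrow> 'g \<Rightarrow> ('g \<Rightarrow> 'g \<Rightarrow> bool)
   \<Rightarrow> ('b \<Rightarrow> 'g) \<Rightarrow> bool" where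
  "p_valuation p K G pl z leq v \<longleftrightarrow>
     valuation K G pl z leq v \<and>
     discretely_ordered G z leq \<and>
     (let vp = v ([p] \<cdot>\<^bsub>K\<^esub> \<one>\<^bsub>K\<^esub>) in
        leq z vp \<and> vp \<noteq> z \<and> (\<forall>g\<in>G. leq z g \<and> g \<noteq> z \<longrightarrow> leq vp g)) \<and>
     residue_field K z leq v \<simeq> ZFact (int p)"

definition padic_val_rat :: "nat \<Rightarrow> rat \<Rightarrow> int" where
  "padic_val_rat p q = (let (a, b) = quotient_of q in
      int (multiplicity (int p) a) - int (multiplicity (int p) b))"

definition padic_abs :: "nat \<Rightarrow> rat \<Rightarrow> rat" where
  "padic_abs p q = (if q = 0 then 0 else (of_nat p) powi (- padic_val_rat p q))"

definition padic_cauchy :: "nat \<Rightarrow> (nat \<Rightarrow> rat) \<Rightarrow> bool" where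
  "padic_cauchy p xs \<longleftrightarrow>
     (\<forall>e>0. \<exists>N. \<forall>m\<ge>N. \<forall>n\<ge>N. padic_abs p (xs m - xs n) < e)"

definition padic_null :: "nat \<Rightarrow> (nat \<Rightarrow> rat) \<Rightarrow> bool" where
  "padic_null p xs \<longleftrightarrow> (\<forall>e>0. \<exists>N. \<forall>n\<ge>N. padic_abs p (xs n) < e)"

definition padic_class :: "nat \<Rightarrow> (nat \<Rightarrow> rat) \<Rightarrow> (nat \<Rightarrow> rat) set" where
  "padic_class p xs = {ys. padic_cauchy p ys \<and> padic_null p (\<lambda>n. xs n - ys n)}"

definition padic_rep :: "(nat \<Rightarrow> rat) set \<Rightarrow> (nat \<Rightarrow> rat)" where
  "padic_rep A = (SOME xs. xs \<in> A)"

definition Qp :: "nat \<Rightarrow> (nat \<Rightarrow> rat) set ring" where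
  "Qp p = \<lparr> carrier = {padic_class p xs | xs. padic_cauchy p xs},
            monoid.mult = (\<lambda>A B. padic_class p (\<lambda>n. padic_rep A n * padic_rep B n)),
            one = padic_class p (\<lambda>n. 1),
            ring.zero = padic_class p (\<lambda>n. 0),
            ring.add = (\<lambda>A B. padic_class p (\<lambda>n. padic_rep A n + padic_rep B n)) \<rparr>"

end

theory Submission
  imports Defs "HOL-Computational_Algebra.Polynomial" "HOL-Combinatorics.Stirling"
    "HOL-Number_Theory.Residues"
begin

text \<open>
  A \<open>p\<close>-divisibility yields a total one with cancellation as follows. For a minimal prime \<open>P\<close> over
  \<open>{a. 0 | a}\<close>, the fractions \<open>y / x\<close> with \<open>x | y\<close> form a subring of the field of fractions of
  \<open>A / P\<close> that does not contain \<open>1 / p\<close>, by axiom (6). By Chevalley's argument a maximal such subring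
  is a valuation ring. Axiom (7), stating that the values of the Kochen operator are integral, persists
  under enlargement of the relation.

  For a total divisibility with cancellation, axiom (7) forces \<open>p | b\<^sup>p - b\<close> for integral \<open>b\<close>. Hence
  \<open>p\<close> has the least positive value, and since \<open>X\<^sup>p - X \<equiv> X (X - 1) \<dots> (X - p + 1)\<close> modulo \<open>p\<close> the residue
  field is the prime field: the divisibility is a \<open>p\<close>-valuation on the field of fractions of \<open>A / P\<close>.
  Conversely, \<open>p\<close>-valuations satisfy (7) and can be pulled back along homomorphisms.

  In the archimedean case, iterating residues approximates every element of \<open>A\<close> by rationals to arbitrary
  \<open>p\<close>-adic precision, and the limits of these approximations define the homomorphism to \<open>\<rat>\<^sub>p\<close>.
\<close>

subsection \<open>Divisibilities with cancellation and adjoining a fraction\<close>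

text \<open>The extensions are carried out as relations on \<open>'a\<close> itself; the field of
  fractions is built only for (c). Axiom (6) is a negative condition on all \<open>a\<close>, but
  under cancellation it collapses to the single condition that p does not divide 1. For this reason
  cancellation is arranged before totality: only the first step needs (6) in full, and the
  maximality argument has one non-divisibility by p to protect. In (7) put x = a / b. The quotient
  of \<open>a ^ p * b - b ^ p * a\<close> by \<open>b ^ (p + 1)\<close> is u = x^p - x, and (7) says
  that u / (p (u^2 - 1)) is integral, which is the Kochen operator at x. As the ring has no
  division, statements about x are kept in homogeneous form in a and b. The congruence for X^p - X
  enters as the expansion of X^p in falling factorials, whose coefficients are Stirling numbers. For
  the p-adic numbers, the absolute value of a nonzero limit is attained by all late terms of a
  representing sequence. Inequalities between rationals can thus be carried over term by
  term.\<close>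

locale divisibility_rel =
  fixes dv :: "'a::comm_ring_1 \<Rightarrow> 'a \<Rightarrow> bool" (infix "\<preceq>" 50)
  assumes divisibility: "divisibility dv"
begin

lemma refl [simp]: "a \<preceq> a"
  using divisibility by (simp add: divisibility_def)

lemma trans [trans]: "a \<preceq> b \<Longrightarrow> b \<preceq> c \<Longrightarrow> a \<preceq> c"
  using divisibility unfolding divisibility_def by blast

lemma diff: "a \<preceq> b \<Longrightarrow> a \<preceq> c \<Longrightarrow> a \<preceq> b - c"
  using divisibility unfolding divisibility_def by blast

lemma mult_right: "a \<preceq> b \<Longrightarrow> a * c \<preceq> b * c"
  using divisibility unfolding divisibility_def by blast

lemma mult_left: "a \<preceq> b \<Longrightarrow> c * a \<preceq> c * b"
  using mult_right[of a b c] by (simp add: mult.commute)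

lemma not_zero_one [simp]: "\<not> 0 \<preceq> 1"
  using divisibility by (simp add: divisibility_def)

lemma zero [simp]: "a \<preceq> 0"
  using diff[of a a a] by simp

lemma minus: "a \<preceq> b \<Longrightarrow> a \<preceq> - b"
  using diff[of a 0 b] by simp

lemma add: "a \<preceq> b \<Longrightarrow> a \<preceq> c \<Longrightarrow> a \<preceq> b + c"
  using diff[of a b "- c"] by (simp add: minus)

lemma minus_iff [simp]: "a \<preceq> - b \<longleftrightarrow> a \<preceq> b"
  using minus[of a b] minus[of a "- b"] by auto

lemma minus_left_iff [simp]: "- a \<preceq> b \<longleftrightarrow> a \<preceq> b"
  using trans[of a "- a" b] trans[of "- a" a b] minus[of "- a" "- a"] by (auto simp: minus)

lemma sum: "(\<And>i. i \<in> I \<Longrightarrow> a \<preceq> f i) \<Longrightarrow> a \<preceq> sum f I"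
  by (induction I rule: infinite_finite_induct) (auto intro: add)

lemma mult: "a \<preceq> b \<Longrightarrow> c \<preceq> d \<Longrightarrow> a * c \<preceq> b * d"
  by (meson mult_right mult_left trans)

lemma power: "a \<preceq> b \<Longrightarrow> a ^ n \<preceq> b ^ n"
  by (induction n) (auto intro: mult)

lemma of_nat [simp]: "1 \<preceq> of_nat n"
  by (induction n) (auto intro: add)

lemma of_int [simp]: "1 \<preceq> of_int k"
  by (cases k) (simp_all only: of_int_of_nat_eq of_nat of_int_minus minus_iff)

lemma integral_mult: "a \<preceq> b \<Longrightarrow> 1 \<preceq> c \<Longrightarrow> a \<preceq> b * c"
  using mult[of a b 1 c] by simp

lemma integral_mult': "a \<preceq> b \<Longrightarrow> 1 \<preceq> c \<Longrightarrow> a \<preceq> c * b"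
  using mult[of 1 c a b] by simp

lemma null_all: "0 \<preceq> a \<Longrightarrow> b \<preceq> a"
  using trans zero by blast

lemma null_mult: "0 \<preceq> a \<Longrightarrow> 0 \<preceq> a * b"
  using mult_right[of 0 a b] by simp

lemma null_mult': "0 \<preceq> a \<Longrightarrow> 0 \<preceq> b * a"
  using mult_left[of 0 a b] by simp

lemma null_trans: "0 \<preceq> a \<Longrightarrow> a \<preceq> b \<Longrightarrow> 0 \<preceq> b"
  by (rule trans)

lemma null_diff: "0 \<preceq> b - c \<Longrightarrow> a \<preceq> b \<longleftrightarrow> a \<preceq> c"
  using diff[of a b "b - c"] add[of a "b - c" c] null_all[of "b - c" a] by auto

lemma null_diff_left: "0 \<preceq> b - c \<Longrightarrow> b \<preceq> a \<longleftrightarrow> c \<preceq> a"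
  using null_diff[of b c b] null_diff[of b c c] trans[of b c a] trans[of c b a] by auto

end

text \<open>Cancellation makes the support \<open>{a. 0 \<preceq> a}\<close> a prime P, and for
  \<open>a\<close> outside P the relation \<open>a \<preceq> b\<close> expresses that b / a lies in
  a fixed subring of the field of fractions of A / P.\<close>

locale cancel_divisibility = divisibility_rel +
  assumes cancel: "\<not> 0 \<preceq> c \<Longrightarrow> a * c \<preceq> b * c \<Longrightarrow> a \<preceq> b"
begin

lemma cancel_left: "\<not> 0 \<preceq> c \<Longrightarrow> c * a \<preceq> c * b \<Longrightarrow> a \<preceq> b"
  using cancel[of c a b] by (simp add: mult.commute)

lemma null_mult_iff [simp]: "0 \<preceq> a * b \<longleftrightarrow> 0 \<preceq> a \<or> 0 \<preceq> b"
  using null_mult[of a b] null_mult'[of b a] cancel[of b 0 a] by auto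

lemma null_power_iff [simp]: "0 \<preceq> a ^ n \<longleftrightarrow> 0 \<preceq> a \<and> n \<noteq> 0"
  by (induction n) auto

text \<open>\<open>adjoin x y\<close> is the divisibility of the ring generated by \<open>y / x\<close> over the integral
  fractions: \<open>b / a = (\<Sum>i. (e\<^sub>i x\<^sup>i / (s a)) (y / x)\<^sup>i)\<close>. Absorbing the powers of \<open>x\<close> into the
  coefficients \<open>e\<^sub>i\<close> avoids homogenisation.\<close>

definition adjoin :: "'a \<Rightarrow> 'a \<Rightarrow> 'a \<Rightarrow> 'a \<Rightarrow> bool" where
  "adjoin x y a b \<longleftrightarrow>
     (\<exists>s e. \<not> 0 \<preceq> s \<and> s * b = poly e y \<and> (\<forall>i. s * a \<preceq> coeff e i * x ^ i))"

lemma adjoin_extends: "a \<preceq> b \<Longrightarrow> adjoin x y a b"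
  unfolding adjoin_def
  by (rule exI[of _ 1], rule exI[of _ "[:b:]"]) (auto simp: coeff_pCons split: nat.splits)

lemma adjoin_generator: "adjoin x y x y"
  unfolding adjoin_def
  by (rule exI[of _ 1], rule exI[of _ "[:0, 1:]"]) (auto simp: coeff_pCons split: nat.splits)

text \<open>A null \<open>a\<close> makes every coefficient null, since powers of \<open>x\<close>
  can be cancelled. The support does not grow, so the enlarged ring lives in the same field of
  fractions and 1 stays non-null.\<close>

lemma adjoin_null:
  assumes "\<not> 0 \<preceq> x" "0 \<preceq> a" "adjoin x y a b"
  shows "0 \<preceq> b"
proof -
  obtain s e where s: "\<not> 0 \<preceq> s" "s * b = poly e y" "\<And>i. s * a \<preceq> coeff e i * x ^ i"
    using assms(3) unfolding adjoin_def by blast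
  have "0 \<preceq> coeff e i" for i
    using s(3)[of i] assms null_trans[of "s * a" "coeff e i * x ^ i"] by auto
  then have "0 \<preceq> poly e y"
    by (auto simp: poly_altdef intro!: sum)
  with s show ?thesis
    by (metis null_mult_iff)
qed

lemma adjoin_trans:
  assumes x: "\<not> 0 \<preceq> x" and ab: "adjoin x y a b" and bc: "adjoin x y b c"
  shows "adjoin x y a c"
proof (cases "0 \<preceq> b")
  case True
  then show ?thesis
    using adjoin_null[OF x True bc] adjoin_extends null_all by blast
next
  case False
  obtain s e where s: "\<not> 0 \<preceq> s" "s * b = poly e y" "\<And>i. s * a \<preceq> coeff e i * x ^ i"
    using ab unfolding adjoin_def by blast
  obtain s' e' where s': "\<not> 0 \<preceq> s'" "s' * c = poly e' y" "\<And>i. s' * b \<preceq> coeff e' i * x ^ i"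
    using bc unfolding adjoin_def by blast
  \<comment> \<open>The product of the expansions of b / a and c / b expands c / a over the common
    denominator \<open>s * s' * b\<close>; this is where \<open>b\<close> must not be null.\<close>
  have "s * s' * b * a \<preceq> coeff (e * e') n * x ^ n" for n
  proof -
    have "s * s' * b * a \<preceq> coeff e i * x ^ i * (coeff e' (n - i) * x ^ (n - i))" for i
      using mult[OF s(3)[of i] s'(3)[of "n - i"]] by (simp add: ac_simps)
    moreover have "coeff (e * e') n * x ^ n =
        (\<Sum>i\<le>n. coeff e i * x ^ i * (coeff e' (n - i) * x ^ (n - i)))"
      unfolding coeff_mult sum_distrib_right
    proof (rule sum.cong)
      fix i assume "i \<in> {..n}"
      then have "x ^ n = x ^ i * x ^ (n - i)" by (simp flip: power_add)
      then show "coeff e i * coeff e' (n - i) * x ^ n =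
          coeff e i * x ^ i * (coeff e' (n - i) * x ^ (n - i))"
        by (simp only: ac_simps)
    qed simp
    ultimately show ?thesis by (simp only: sum)
  qed
  moreover have "s * s' * b * c = poly (e * e') y"
    by (simp add: ac_simps flip: s(2) s'(2))
  ultimately show ?thesis
    unfolding adjoin_def using False s(1) s'(1)
    by (intro exI[of _ "s * s' * b"] exI[of _ "e * e'"]) simp
qed

lemma adjoin_diff:
  assumes ab: "adjoin x y a b" and ac: "adjoin x y a c"
  shows "adjoin x y a (b - c)"
proof -
  obtain s e where s: "\<not> 0 \<preceq> s" "s * b = poly e y" "\<And>i. s * a \<preceq> coeff e i * x ^ i"
    using ab unfolding adjoin_def by blast
  obtain s' e' where s': "\<not> 0 \<preceq> s'" "s' * c = poly e' y" "\<And>i. s' * a \<preceq> coeff e' i * x ^ i"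
    using ac unfolding adjoin_def by blast
  have "s * s' * (b - c) = poly (smult s' e - smult s e') y"
    by (simp add: algebra_simps flip: s(2) s'(2))
  moreover have "s * s' * a \<preceq> coeff (smult s' e - smult s e') i * x ^ i" for i
  proof -
    have "s * s' * a \<preceq> s' * (coeff e i * x ^ i)" "s * s' * a \<preceq> s * (coeff e' i * x ^ i)"
      using mult_left[OF s(3)[of i], of s'] mult_left[OF s'(3)[of i], of s] by (simp_all add: ac_simps)
    from diff[OF this] show ?thesis by (simp add: algebra_simps)
  qed
  ultimately show ?thesis
    unfolding adjoin_def using s(1) s'(1)
    by (intro exI[of _ "s * s'"] exI[of _ "smult s' e - smult s e'"]) simp
qed

lemma adjoin_mult:
  assumes "adjoin x y a b"
  shows "adjoin x y (a * c) (b * c)"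
proof -
  obtain s e where s: "\<not> 0 \<preceq> s" "s * b = poly e y" "\<And>i. s * a \<preceq> coeff e i * x ^ i"
    using assms unfolding adjoin_def by blast
  have "s * (b * c) = poly (smult c e) y"
    by (simp add: mult.commute mult.left_commute flip: s(2))
  moreover have "s * (a * c) \<preceq> coeff (smult c e) i * x ^ i" for i
    using mult_left[OF s(3)[of i], of c] by (simp add: algebra_simps)
  ultimately show ?thesis
    unfolding adjoin_def using s(1) by blast
qed

lemma adjoin_cancel:
  assumes "\<not> 0 \<preceq> c" "adjoin x y (a * c) (b * c)"
  shows "adjoin x y a b"
proof -
  obtain s e where "\<not> 0 \<preceq> s" "s * (b * c) = poly e y" "\<And>i. s * (a * c) \<preceq> coeff e i * x ^ i"
    using assms(2) unfolding adjoin_def by blast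
  then show ?thesis
    unfolding adjoin_def using assms(1)
    by (intro exI[of _ "s * c"] exI[of _ e]) (auto simp: ac_simps)
qed

lemma cancel_divisibility_adjoin:
  assumes "\<not> 0 \<preceq> x"
  shows "cancel_divisibility (adjoin x y)"
proof
  show "divisibility (adjoin x y)"
    unfolding divisibility_def
    using adjoin_extends adjoin_trans adjoin_diff adjoin_mult adjoin_null[OF assms, of 0 y 1] assms
    by (metis refl not_zero_one)
qed (use adjoin_cancel adjoin_extends in blast)

text \<open>Write t = y / x. The hypotheses read 1 = \<Sum> c_i t^i and 1 = \<Sum> d_j t^(-j) with
  all c_i and d_j divisible by \<open>q\<close>. Multiplying the first by 1 - d_0, which is the sum
  of the d_j t^(-j) with j \<ge> 1, trades the leading term c_n t^n for terms of lower degree.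
  Adding d_0 back, instead of dividing by 1 - d_0, restores the left side 1 without
  localising.\<close>

lemma fraction_descent:
  assumes q: "1 \<preceq> q"
    and s: "s = poly e y" "\<And>i. s * q \<preceq> coeff e i * x ^ i" "\<not> 0 \<preceq> s"
    and s': "s' = poly e' x" "\<And>i. s' * q \<preceq> coeff e' i * y ^ i" "\<not> 0 \<preceq> s'"
    and deg: "degree e' \<le> degree e" "degree e > 0"
  obtains r f where "r = poly f y" "\<And>i. r * q \<preceq> coeff f i * x ^ i" "\<not> 0 \<preceq> r"
    "degree f < degree e"
proof
  define n m where "n = degree e" and "m = degree e'"
  define c where "c = coeff e n"
  \<comment> \<open>The summands are d_0, then 1 - d_0 times the first expansion without its leading
    term, then c_n t^n times the sum of the d_j t^(-j), all over the denominator
    \<open>s * s'\<close>.\<close>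
  define f where "f = [:s * coeff e' 0:] + smult (s' - coeff e' 0) (e - monom c n) +
     (\<Sum>j=1..m. monom (c * coeff e' j * x ^ j * y ^ j) (n - j))"
  have nm: "m \<le> n" "n > 0" using deg by (auto simp: n_def m_def)
  have s'_eq: "s' = coeff e' 0 + (\<Sum>j=1..m. coeff e' j * x ^ j)"
    unfolding s'(1) poly_altdef m_def by (simp add: sum.atLeast_Suc_atMost atMost_atLeast0)
  have "(\<Sum>j=1..m. poly (monom (c * coeff e' j * x ^ j * y ^ j) (n - j)) y) =
        c * y ^ n * (\<Sum>j=1..m. coeff e' j * x ^ j)"
    unfolding sum_distrib_left
  proof (rule sum.cong)
    fix j assume "j \<in> {1..m}"
    then have "y ^ n = y ^ j * y ^ (n - j)"
      using nm by (simp flip: power_add)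
    then show "poly (monom (c * coeff e' j * x ^ j * y ^ j) (n - j)) y =
        c * y ^ n * (coeff e' j * x ^ j)"
      by (simp add: poly_monom ac_simps)
  qed simp
  then show "s * s' = poly f y"
    unfolding f_def by (simp add: poly_sum poly_monom s'_eq flip: s(1)) (simp add: algebra_simps)
  show "\<not> 0 \<preceq> s * s'" using s s' by simp
  show "s * s' * q \<preceq> coeff f i * x ^ i" for i
  proof -
    have 1: "s * s' * q \<preceq> coeff [:s * coeff e' 0:] i * x ^ i"
      using mult_left[OF s'(2)[of 0], of s] by (auto simp: coeff_pCons ac_simps split: nat.splits)
    have "s' \<preceq> coeff e' 0"
      using s'(2)[of 0] mult_left[OF q, of s'] by (auto intro: trans)
    then have "s' \<preceq> s' - coeff e' 0" by (simp add: diff)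
    then have 2: "s' * (s * q) \<preceq> (s' - coeff e' 0) * (coeff e k * x ^ k)" for k
      by (rule mult) (rule s)
    have 2: "s * s' * q \<preceq> coeff (smult (s' - coeff e' 0) (e - monom c n)) i * x ^ i"
      using 2[of i] by (cases "i = n") (auto simp: c_def ac_simps)
    have 3: "s * s' * q \<preceq> coeff (monom (c * coeff e' j * x ^ j * y ^ j) (n - j)) i * x ^ i"
      if "j \<in> {1..m}" for j
    proof (cases "i = n - j")
      case True
      have "x ^ n = x ^ j * x ^ (n - j)"
        using that nm by (simp flip: power_add)
      \<comment> \<open>The product c_n d_j is divisible by q^2, hence by \<open>q\<close> because
        \<open>q\<close> is integral.\<close>
      moreover have "s * s' * q \<preceq> s * q * (s' * q)"
        using mult_left[OF q, of "s * s' * q"] by (simp add: ac_simps)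
      moreover have "s * q * (s' * q) \<preceq> c * x ^ n * (coeff e' j * y ^ j)"
        unfolding c_def using s(2) s'(2) by (rule mult)
      ultimately show ?thesis
        using True by (auto simp: ac_simps intro: trans)
    qed simp
    have 3: "s * s' * q \<preceq>
        coeff (\<Sum>j=1..m. monom (c * coeff e' j * x ^ j * y ^ j) (n - j)) i * x ^ i"
      unfolding coeff_sum sum_distrib_right using 3 by (rule sum)
    show ?thesis
      unfolding f_def coeff_add distrib_right using 1 2 3 by (intro add)
  qed
  have "coeff f i = 0" if "i \<ge> n" for i
    using that nm
    by (auto simp: f_def coeff_sum coeff_pCons c_def n_def coeff_eq_0 le_less
             split: nat.splits intro!: sum.neutral)
  then show "degree f < degree e"
    using nm by (metis coeff_0 degree_0 le_less_linear leading_coeff_0_iff n_def)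
qed

text \<open>Chevalley's argument: of two equations expressing \<open>1\<close> as a polynomial in \<open>y / x\<close> and in
  \<open>x / y\<close> with coefficients in the ideal generated by \<open>q\<close>, the one of larger degree can be
  shortened.\<close>

lemma adjoin_fraction_or_inverse:
  assumes q: "1 \<preceq> q" "\<not> q \<preceq> 1"
  shows "\<not> adjoin x y q 1 \<or> \<not> adjoin y x q 1"
proof (rule ccontr)
  assume "\<not> ?thesis"
  then obtain s e s' e' where "s = poly e y" "\<And>i. s * q \<preceq> coeff e i * x ^ i" "\<not> 0 \<preceq> s"
     "s' = poly e' x" "\<And>i. s' * q \<preceq> coeff e' i * y ^ i" "\<not> 0 \<preceq> s'"
    unfolding adjoin_def by auto
  then show False
  proof (induction "degree e + degree e'" arbitrary: x y s e s' e' rule: less_induct)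
    case less
    have pos: "degree g > 0" if "r = poly g v" "\<And>i. r * q \<preceq> coeff g i * u ^ i" "\<not> 0 \<preceq> r"
      for r g u v
    proof (rule ccontr)
      assume "\<not> degree g > 0"
      then have "r * q \<preceq> r * 1"
        using that(1) that(2)[of 0] by (auto elim!: degree_eq_zeroE)
      then show False using that(3) q(2) cancel_left by blast
    qed
    show False
    proof (cases "degree e' \<le> degree e")
      case True
      obtain r f where "r = poly f y" "\<And>i. r * q \<preceq> coeff f i * x ^ i" "\<not> 0 \<preceq> r"
          "degree f < degree e"
        using fraction_descent[OF q(1) less.prems True pos[OF less.prems(1-3)]] by blast
      then show False using less.hyps[of f e' r y x s'] less.prems by simp
    next
      case False
      then have le: "degree e \<le> degree e'" by simp
      obtain r f where "r = poly f x" "\<And>i. r * q \<preceq> coeff f i * y ^ i" "\<not> 0 \<preceq> r"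
          "degree f < degree e'"
        using fraction_descent[OF q(1) less.prems(4-6) less.prems(1-3) le pos[OF less.prems(4-6)]]
        by blast
      then show False using less.hyps[of e f s y x r] less.prems by simp
    qed
  qed
qed

end

subsection \<open>Existence of total divisibilities\<close>

context divisibility_rel
begin

text \<open>\<open>S\<close> is the complement of a minimal prime, obtained as a maximal
  multiplicative set avoiding the support. The last property is maximality: otherwise the products
  \<open>s * a ^ n\<close> would form a larger such set. It makes every element of the prime
  nilpotent modulo the support, up to a factor from \<open>S\<close>.\<close>

lemma exists_minimal_prime:
  obtains S where "1 \<in> S" "\<And>s t. s \<in> S \<Longrightarrow> t \<in> S \<Longrightarrow> s * t \<in> S" "\<And>s. s \<in> S \<Longrightarrow> \<not> 0 \<preceq> s"
    "\<And>a. a \<notin> S \<Longrightarrow> \<exists>s\<in>S. \<exists>n. 0 \<preceq> s * a ^ n"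
proof -
  define F where "F = {S. 1 \<in> S \<and> (\<forall>s\<in>S. \<forall>t\<in>S. s * t \<in> S) \<and> (\<forall>s\<in>S. \<not> 0 \<preceq> s)}"
  have "\<exists>M\<in>F. \<forall>T\<in>F. M \<subseteq> T \<longrightarrow> T = M"
  proof (rule subset_Zorn_nonempty)
    have "{1} \<in> F" by (auto simp: F_def)
    then show "F \<noteq> {}" by blast
    fix C assume C: "C \<noteq> {}" "subset.chain F C"
    then have sub: "T \<in> F" if "T \<in> C" for T
      using that by (auto simp: subset_chain_def)
    have "s * t \<in> \<Union>C" if st: "s \<in> \<Union>C" "t \<in> \<Union>C" for s t
    proof -
      obtain T U where XU: "T \<in> C" "s \<in> T" "U \<in> C" "t \<in> U" using st by blast
      then have "T \<subseteq> U \<or> U \<subseteq> T" using C by (auto simp: subset_chain_def)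
      then obtain Z where "Z \<in> C" "s \<in> Z" "t \<in> Z" using XU by blast
      then show ?thesis using sub[of Z] by (auto simp: F_def)
    qed
    then show "\<Union>C \<in> F"
      using C(1) sub by (auto simp: F_def)
  qed
  then obtain S where S: "S \<in> F" and max: "\<And>T. T \<in> F \<Longrightarrow> S \<subseteq> T \<Longrightarrow> T = S" by blast
  show thesis
  proof
    show "1 \<in> S" "\<And>s t. s \<in> S \<Longrightarrow> t \<in> S \<Longrightarrow> s * t \<in> S" "\<And>s. s \<in> S \<Longrightarrow> \<not> 0 \<preceq> s"
      using S by (auto simp: F_def)
    show "\<exists>s\<in>S. \<exists>n. 0 \<preceq> s * a ^ n" if "a \<notin> S" for a
    proof (rule ccontr)
      assume neg: "\<not> ?thesis"
      define T where "T = {s * a ^ n | s n. s \<in> S}"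
      have "1 \<in> T" using S unfolding T_def F_def
        by (intro CollectI exI[of _ 1] exI[of _ 0]) auto
      moreover have "s * t \<in> T" if st: "s \<in> T" "t \<in> T" for s t
      proof -
        obtain s' m t' n where "s = s' * a ^ m" "t = t' * a ^ n" "s' \<in> S" "t' \<in> S"
          using st unfolding T_def by blast
        then have "s * t = (s' * t') * a ^ (m + n)" "s' * t' \<in> S"
          using S by (auto simp: power_add F_def ac_simps)
        then show ?thesis unfolding T_def by blast
      qed
      moreover have "\<not> 0 \<preceq> s" if "s \<in> T" for s
        using that neg by (auto simp: T_def)
      moreover have "S \<subseteq> T"
      proof
        fix s assume "s \<in> S"
        then show "s \<in> T" unfolding T_def by (intro CollectI exI[of _ s] exI[of _ 0]) simp
      qed
      ultimately have "T = S" using max by (auto simp: F_def)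
      moreover have "a \<in> T" using S unfolding T_def F_def
        by (intro CollectI exI[of _ 1]) (auto intro: exI[of _ 1])
      ultimately show False using that by blast
    qed
  qed
qed

text \<open>In each term of the binomial expansion the exponent of \<open>a\<close> is at least
  \<open>m\<close> or that of \<open>b\<close> exceeds \<open>n\<close>. The lemma serves to show
  that the complement of \<open>S\<close> is closed under addition.\<close>

lemma null_binomial:
  assumes "0 \<preceq> s * a ^ m" "0 \<preceq> t * b ^ n"
  shows "0 \<preceq> (s * t) * (a + b) ^ (m + n)"
proof -
  have "0 \<preceq> (s * t) * (of_nat (m + n choose k) * a ^ k * b ^ (m + n - k))" for k
  proof (cases "k \<ge> m")
    case True
    then have "a ^ k = a ^ m * a ^ (k - m)" by (simp flip: power_add)
    then show ?thesis
      using null_mult[OF assms(1), of "t * (of_nat (m + n choose k) * a ^ (k - m) * b ^ (m + n - k))"]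
      by (simp add: ac_simps)
  next
    case False
    then have "b ^ (m + n - k) = b ^ n * b ^ (m - k)" by (simp add: add.commute flip: power_add)
    then show ?thesis
      using null_mult[OF assms(2), of "s * (of_nat (m + n choose k) * a ^ k * b ^ (m - k))"]
      by (simp add: ac_simps)
  qed
  then show ?thesis
    unfolding binomial_ring sum_distrib_left by (rule sum)
qed

text \<open>Minimality of the prime keeps \<open>q\<close> a non-unit: if 1 / q became integral for
  the new relation, clearing the nilpotents would produce an element c that is not null and
  satisfies \<open>q * c \<preceq> c\<close>.\<close>

lemma cancel_extension:
  assumes q: "1 \<preceq> q" "\<And>a. q * a \<preceq> a \<Longrightarrow> 0 \<preceq> a"
  obtains D where "cancel_divisibility D" "\<And>a b. a \<preceq> b \<Longrightarrow> D a b" "\<not> D q 1"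
proof -
  obtain S where one: "1 \<in> S" and times: "\<And>s t. s \<in> S \<Longrightarrow> t \<in> S \<Longrightarrow> s * t \<in> S"
    and S: "\<And>s. s \<in> S \<Longrightarrow> \<not> 0 \<preceq> s" and min: "\<And>a. a \<notin> S \<Longrightarrow> \<exists>s\<in>S. \<exists>n. 0 \<preceq> s * a ^ n"
    using exists_minimal_prime by metis
  have pow: "s ^ n \<in> S" if "s \<in> S" for s n
    by (induction n) (auto simp: one times that)
  have ideal_mult: "a * b \<notin> S" if a: "a \<notin> S" for a b
  proof
    assume ab: "a * b \<in> S"
    obtain s n where s: "s \<in> S" "0 \<preceq> s * a ^ n" using min[OF a] by blast
    then have "0 \<preceq> s * (a * b) ^ n"
      using null_mult[of "s * a ^ n" "b ^ n"] by (simp add: power_mult_distrib ac_simps)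
    then show False using S[OF times[OF s(1) pow[OF ab]]] by blast
  qed
  have ideal_add: "a + b \<notin> S" if ab: "a \<notin> S" "b \<notin> S" for a b
  proof
    assume sum: "a + b \<in> S"
    obtain s n t m where "s \<in> S" "0 \<preceq> s * a ^ n" "t \<in> S" "0 \<preceq> t * b ^ m"
      using min[OF ab(1)] min[OF ab(2)] by blast
    then show False
      using null_binomial[of s a n t b m] S times pow[OF sum] by blast
  qed
  have ideal_diff: "a - b \<notin> S" if "a \<notin> S" "b \<notin> S" for a b
    using ideal_add[of a "b * (-1)"] ideal_mult[of b "-1"] that by simp
  have ideal: "a \<notin> S" if "0 \<preceq> a" for a
    using S that by blast
  have ideal_dv: "b \<notin> S" if ab: "a \<preceq> b" "a \<notin> S" for a b
  proof
    assume "b \<in> S"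
    obtain s n where s: "s \<in> S" "0 \<preceq> s * a ^ n" using min[OF ab(2)] by blast
    then have "0 \<preceq> s * b ^ n"
      using null_trans mult_left[OF power[OF ab(1)]] by blast
    then show False
      using S times[OF s(1) pow[OF \<open>b \<in> S\<close>]] by blast
  qed
  \<comment> \<open>In the field of fractions modulo the prime, b / a = y / x with
    \<open>x \<preceq> y\<close>; for \<open>a\<close> in the prime the condition forces
    \<open>b\<close> into it.\<close>
  define D where "D a b \<longleftrightarrow> (\<exists>x y. x \<in> S \<and> x \<preceq> y \<and> b * x - a * y \<notin> S)" for a b
  have D_null: "D 0 a \<longleftrightarrow> a \<notin> S" for a
  proof
    assume "D 0 a"
    then show "a \<notin> S" unfolding D_def using times by auto
  next
    assume "a \<notin> S"
    then show "D 0 a" unfolding D_def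
      by (intro exI[of _ 1] exI[of _ 0]) (use one in auto)
  qed
  have D_extends: "D a b" if "a \<preceq> b" for a b
  proof (cases "a \<in> S")
    case True
    then show ?thesis unfolding D_def using that S[of 0]
      by (intro exI[of _ a] exI[of _ b]) (auto simp: ac_simps)
  next
    case False
    then have "b \<notin> S" using ideal_dv that by blast
    then show ?thesis unfolding D_def
      by (intro exI[of _ 1] exI[of _ 0]) (use one in auto)
  qed
  have "cancel_divisibility D"
  proof
    have "D a c" if ab: "D a b" and bc: "D b c" for a b c
    proof -
      obtain x y x' y' where 1: "x \<in> S" "x \<preceq> y" "b * x - a * y \<notin> S"
        and 2: "x' \<in> S" "x' \<preceq> y'" "c * x' - b * y' \<notin> S"
        using ab bc unfolding D_def by blast
      have "c * (x * x') - a * (y * y') = (c * x' - b * y') * x + (b * x - a * y) * y'"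
        by (simp add: algebra_simps)
      then have "c * (x * x') - a * (y * y') \<notin> S"
        using 1(3) 2(3) ideal_add ideal_mult by simp
      then show ?thesis
        unfolding D_def using mult[OF 1(2) 2(2)] times[OF 1(1) 2(1)] by blast
    qed
    moreover have "D a (b - c)" if ab: "D a b" and ac: "D a c" for a b c
    proof -
      obtain x y x' y' where 1: "x \<in> S" "x \<preceq> y" "b * x - a * y \<notin> S"
        and 2: "x' \<in> S" "x' \<preceq> y'" "c * x' - a * y' \<notin> S"
        using ab ac unfolding D_def by blast
      have "(b - c) * (x * x') - a * (y * x' - y' * x) =
          (b * x - a * y) * x' - (c * x' - a * y') * x"
        by (simp add: algebra_simps)
      then have "(b - c) * (x * x') - a * (y * x' - y' * x) \<notin> S"
        using 1(3) 2(3) ideal_diff ideal_mult by simp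
      moreover have "x * x' \<preceq> y * x' - y' * x"
        using diff[OF mult_right[OF 1(2), of x'], of "y' * x"] mult_right[OF 2(2), of x]
        by (simp add: ac_simps)
      ultimately show ?thesis
        unfolding D_def using times[OF 1(1) 2(1)] by blast
    qed
    moreover have "D (a * c) (b * c)" if ab: "D a b" for a b c
    proof -
      obtain x y where 1: "x \<in> S" "x \<preceq> y" "b * x - a * y \<notin> S"
        using ab unfolding D_def by blast
      have "b * c * x - a * c * y = (b * x - a * y) * c" by (simp add: algebra_simps)
      then show ?thesis unfolding D_def using 1 ideal_mult by metis
    qed
    ultimately show "divisibility D"
      unfolding divisibility_def using D_null one D_extends[OF refl] by blast
    show "D a b" if c: "\<not> D 0 c" and D: "D (a * c) (b * c)" for a b c
    proof -
      obtain x y where 1: "x \<in> S" "x \<preceq> y" "b * c * x - a * c * y \<notin> S"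
        using D unfolding D_def by blast
      have "b * c * x - a * c * y = c * (b * x - a * y)" by (simp add: algebra_simps)
      then have "b * x - a * y \<notin> S"
        using c D_null times 1 by metis
      then show ?thesis unfolding D_def using 1 by blast
    qed
  qed
  moreover have "\<not> D q 1"
  proof
    assume "D q 1"
    then obtain x y where x: "x \<in> S" "x \<preceq> y" "x - q * y \<notin> S"
      unfolding D_def by auto
    obtain s n where s: "s \<in> S" "0 \<preceq> s * (x - q * y) ^ n"
      using min[OF x(3)] by blast
    \<comment> \<open>With t = y / x integral, 1 - (1 - q t)^k is \<open>q\<close> times an integral
      element; \<open>v\<close> is that element multiplied by x^k.\<close>
    have "\<exists>v. x ^ k \<preceq> v \<and> x ^ k - (x - q * y) ^ k = q * v" for k
    proof (induction k)
      case 0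
      then show ?case by (intro exI[of _ 0]) simp
    next
      case (Suc k)
      then obtain v where v: "x ^ k \<preceq> v" "x ^ k - (x - q * y) ^ k = q * v" by blast
      have "x ^ Suc k - (x - q * y) ^ Suc k =
          x ^ k * (q * y) + (x - q * y) * (x ^ k - (x - q * y) ^ k)"
        by (simp add: algebra_simps)
      also have "\<dots> = q * (x ^ k * y + x * v - q * (y * v))"
        by (simp add: v(2) algebra_simps)
      finally have "x ^ Suc k - (x - q * y) ^ Suc k = q * (x ^ k * y + x * v - q * (y * v))" .
      moreover have "x ^ Suc k \<preceq> x ^ k * y + x * v - q * (y * v)"
      proof (intro diff add)
        show "x ^ Suc k \<preceq> x ^ k * y" using mult_left[OF x(2), of "x ^ k"] by (simp add: ac_simps)
        show "x ^ Suc k \<preceq> x * v" using mult_left[OF v(1), of x] by simp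
        show "x ^ Suc k \<preceq> q * (y * v)"
          using integral_mult'[OF mult[OF x(2) v(1)] q(1)] by simp
      qed
      ultimately show ?case by blast
    qed
    then obtain v where v: "x ^ n \<preceq> v" "x ^ n - (x - q * y) ^ n = q * v" by blast
    have "s * (x - q * y) ^ n = s * x ^ n - q * (s * v)"
      unfolding mult.left_commute[of q] v(2)[symmetric] by (simp add: algebra_simps)
    then have eq: "0 \<preceq> s * x ^ n - q * (s * v)" using s(2) by simp
    then have "q * (s * v) \<preceq> s * x ^ n"
      using null_diff_left[OF eq, of "s * x ^ n"] by simp
    then have "q * (s * v) \<preceq> s * v"
      using mult_left[OF v(1)] by (rule trans)
    then have "0 \<preceq> q * (s * v)" using q(2) null_mult' by blast
    then have "0 \<preceq> s * x ^ n" using null_diff[OF eq] by blast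
    then show False using S times[OF s(1) pow[OF x(1)]] by blast
  qed
  ultimately show thesis using that D_extends by blast
qed

end

section \<open>Maximal relations are total\<close>

context cancel_divisibility
begin

text \<open>A relation that is maximal among those in which \<open>q\<close> stays a non-unit is
  total: if neither of x, y divided the other, adjoining y / x and adjoining x / y would both make
  \<open>q\<close> a unit, against \<open>adjoin_fraction_or_inverse\<close>.\<close>

lemma total_extension:
  assumes q: "1 \<preceq> q" "\<not> q \<preceq> 1"
  obtains D where "cancel_divisibility D" "\<And>a b. a \<preceq> b \<Longrightarrow> D a b" "\<not> D q 1"
    "\<And>a b. D a b \<or> D b a"
proof -
  \<comment> \<open>Relations are coded as sets of pairs so that Zorn's lemma for inclusion
    applies.\<close>
  define rel where "rel R = (\<lambda>a b. (a, b) \<in> R)" for R :: "('a \<times> 'a) set"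
  define F where "F = {R. cancel_divisibility (rel R) \<and> (\<forall>a b. a \<preceq> b \<longrightarrow> rel R a b) \<and> \<not> rel R q 1}"
  have "\<exists>M\<in>F. \<forall>R\<in>F. M \<subseteq> R \<longrightarrow> R = M"
  proof (rule subset_Zorn_nonempty)
    have "{(a, b). a \<preceq> b} \<in> F"
      using q cancel_divisibility_axioms by (auto simp: F_def rel_def)
    then show "F \<noteq> {}" by blast
    fix C assume C: "C \<noteq> {}" "subset.chain F C"
    then have F: "R \<in> F" if "R \<in> C" for R
      using that by (auto simp: subset_chain_def)
    \<comment> \<open>Each closure axiom has at most two positive premises, and in a chain both hold
      in one member.\<close>
    have two: "\<exists>R\<in>C. rel R a b \<and> rel R c d" if "rel (\<Union>C) a b" "rel (\<Union>C) c d" for a b c d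
    proof -
      obtain R R' where R: "R \<in> C" "(a, b) \<in> R" "R' \<in> C" "(c, d) \<in> R'"
        using \<open>rel (\<Union>C) a b\<close> \<open>rel (\<Union>C) c d\<close> by (auto simp: rel_def)
      then have "R \<subseteq> R' \<or> R' \<subseteq> R" using C by (auto simp: subset_chain_def)
      then show ?thesis using R by (auto simp: rel_def)
    qed
    have up: "rel (\<Union>C) a b" if "R \<in> C" "rel R a b" for R a b
      using that by (auto simp: rel_def)
    have cd: "cancel_divisibility (rel R)" if "R \<in> C" for R
      using F[OF that] by (simp add: F_def)
    then have d: "divisibility_rel (rel R)" if "R \<in> C" for R
      using that by (simp add: cancel_divisibility_def)
    obtain R0 where R0: "R0 \<in> C" using C(1) by blast
    have "cancel_divisibility (rel (\<Union>C))"
    proof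
      have "rel (\<Union>C) a c" if "rel (\<Union>C) a b" "rel (\<Union>C) b c" for a b c
        using two[OF that] up divisibility_rel.trans[OF d] by blast
      moreover have "rel (\<Union>C) a (b - c)" if "rel (\<Union>C) a b" "rel (\<Union>C) a c" for a b c
        using two[OF that] up divisibility_rel.diff[OF d] by blast
      moreover have "rel (\<Union>C) (a * c) (b * c)" if "rel (\<Union>C) a b" for a b c
        using two[OF that that] up divisibility_rel.mult_right[OF d] by blast
      moreover have "rel (\<Union>C) a a" for a
        using up[OF R0] divisibility_rel.refl[OF d[OF R0]] by blast
      moreover have "\<not> rel (\<Union>C) 0 1"
        using two[of 0 1 0 1] divisibility_rel.not_zero_one[OF d] by blast
      ultimately show "divisibility (rel (\<Union>C))"
        unfolding divisibility_def by blast
      show "rel (\<Union>C) a b" if "\<not> rel (\<Union>C) 0 c" "rel (\<Union>C) (a * c) (b * c)" for a b c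
        using two[OF that(2) that(2)] that(1) up cancel_divisibility.cancel[OF cd] by metis
    qed
    moreover have "rel (\<Union>C) a b" if "a \<preceq> b" for a b
      using up[OF R0] F[OF R0] that by (auto simp: F_def)
    moreover have "\<not> rel (\<Union>C) q 1"
      using two[of q 1 q 1] F by (auto simp: F_def)
    ultimately show "\<Union>C \<in> F" by (simp add: F_def)
  qed
  then obtain M where M: "M \<in> F" and max: "\<And>R. R \<in> F \<Longrightarrow> M \<subseteq> R \<Longrightarrow> R = M" by blast
  define D where "D = rel M"
  interpret D: cancel_divisibility D using M by (simp add: F_def D_def)
  have ext: "D a b" if "a \<preceq> b" for a b using M that by (simp add: F_def D_def)
  have Dq: "D 1 q" "\<not> D q 1" using M q ext by (simp_all add: F_def D_def)
  have adj: "D x y \<or> D.adjoin x y q 1" if "\<not> D 0 x" for x y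
  proof (rule ccontr)
    assume neg: "\<not> ?thesis"
    let ?R = "{(a, b). D.adjoin x y a b}"
    have "rel ?R = D.adjoin x y" by (auto simp: rel_def fun_eq_iff)
    then have "?R \<in> F"
      using neg D.cancel_divisibility_adjoin[OF that] D.adjoin_extends ext by (simp add: F_def)
    moreover have "M \<subseteq> ?R" using D.adjoin_extends by (auto simp: D_def rel_def)
    ultimately have "?R = M" by (rule max)
    then have "D x y" using D.adjoin_generator[of x y] by (auto simp: D_def rel_def)
    with neg show False by blast
  qed
  have "D x y \<or> D y x" for x y
    using adj[of x y] adj[of y x] D.adjoin_fraction_or_inverse[OF Dq, of x y]
      D.null_all by blast
  then show thesis using that D.cancel_divisibility_axioms ext Dq(2) by blast
qed

end

text \<open>Both extensions are applied with q = p. The first consumes (6) in full; what survives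
  the second, that p does not divide 1, gives (6) back by cancellation.\<close>

lemma p_divisibility_imp_SpecDp_nonempty:
  fixes dv :: "'a::comm_ring_1 \<Rightarrow> 'a \<Rightarrow> bool"
  assumes "p_divisibility p dv"
  shows "SpecDp p \<noteq> ({} :: ('a \<Rightarrow> 'a \<Rightarrow> bool) set)"
proof -
  interpret divisibility_rel dv
    using assms by unfold_locales (simp add: p_divisibility_def)
  have "\<And>a. dv (of_nat p * a) a \<Longrightarrow> dv 0 a"
    using assms by (auto simp: p_divisibility_def)
  then obtain D' where D': "cancel_divisibility D'" "\<And>a b. dv a b \<Longrightarrow> D' a b" "\<not> D' (of_nat p) 1"
    using cancel_extension[of "of_nat p"] of_nat by metis
  then obtain D where D: "cancel_divisibility D" "\<And>a b. D' a b \<Longrightarrow> D a b" "\<not> D (of_nat p) 1"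
      "\<And>a b. D a b \<or> D b a"
    using cancel_divisibility.total_extension[OF D'(1), of "of_nat p"] of_nat by metis
  interpret D: cancel_divisibility D by (rule D)
  have "\<not> D (of_nat p * a) a" if "\<not> D 0 a" for a
    using D.cancel[OF that, of "of_nat p" 1] D(3) by auto
  moreover have "D a b" if "dv a b" for a b using that D(2) D'(2) by blast
  ultimately have "p_divisibility p D"
    using assms D.divisibility unfolding p_divisibility_def by blast
  then have "D \<in> SpecDp p"
    using D(4) D.cancel unfolding SpecDp_def by blast
  then show ?thesis by blast
qed

subsection \<open>The least positive value and the residue field\<close>

text \<open>For x = a / b this is x^n = \<Sum> S(n, j) x (x - 1) ... (x - j + 1), cleared of
  denominators. Multiplication by a = (a - j b) + j b mirrors the recursion of the Stirling
  numbers.\<close>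

lemma power_Stirling:
  fixes a b :: "'a::comm_ring_1"
  shows "a ^ n = (\<Sum>j\<le>n. of_nat (Stirling n j) * (\<Prod>k<j. a - of_nat k * b) * b ^ (n - j))"
proof (induction n)
  case (Suc n)
  define F where "F j = (\<Prod>k<j. a - of_nat k * b)" for j
  have "(\<Sum>j\<le>Suc n. of_nat (Stirling (Suc n) j) * F j * b ^ (Suc n - j)) =
      (\<Sum>j\<le>n. of_nat (Suc j * Stirling n (Suc j)) * F (Suc j) * b ^ (n - j)) +
      (\<Sum>j\<le>n. of_nat (Stirling n j) * F (Suc j) * b ^ (n - j))"
    by (subst sum.atMost_Suc_shift) (simp add: algebra_simps flip: sum.distrib)
  also have "(\<Sum>j\<le>n. of_nat (Suc j * Stirling n (Suc j)) * F (Suc j) * b ^ (n - j)) =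
      (\<Sum>j<n. of_nat (Suc j * Stirling n (Suc j)) * F (Suc j) * b ^ (n - j))"
    by (simp flip: lessThan_Suc_atMost)
  \<comment> \<open>The index shifts by one; the additional term at j = 0 vanishes because of its
    factor j.\<close>
  also have "\<dots> = (\<Sum>j\<le>n. of_nat (j * Stirling n j) * F j * b ^ (Suc n - j))"
    by (subst lessThan_Suc_atMost[symmetric], subst sum.lessThan_Suc_shift) simp
  also have "\<dots> + (\<Sum>j\<le>n. of_nat (Stirling n j) * F (Suc j) * b ^ (n - j)) =
      (\<Sum>j\<le>n. a * (of_nat (Stirling n j) * F j * b ^ (n - j)))"
    unfolding sum.distrib[symmetric]
  proof (rule sum.cong)
    fix j assume "j \<in> {..n}"
    then have "b ^ (Suc n - j) = b * b ^ (n - j)" by (simp add: Suc_diff_le)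
    moreover have "F (Suc j) = F j * (a - of_nat j * b)" by (simp add: F_def)
    ultimately show "of_nat (j * Stirling n j) * F j * b ^ (Suc n - j) +
        of_nat (Stirling n j) * F (Suc j) * b ^ (n - j) =
        a * (of_nat (Stirling n j) * F j * b ^ (n - j))"
      by (simp only: of_nat_mult) (simp add: algebra_simps)
  qed simp
  also have "\<dots> = a ^ Suc n"
    by (simp add: Suc.IH F_def sum_distrib_left)
  finally show ?case by (simp add: F_def)
qed simp

lemma prime_dvd_power_minus_self:
  fixes p j :: nat
  assumes "Factorial_Ring.prime p"
  shows "int p dvd int j ^ p - int j"
proof (cases "p dvd j")
  case True
  then have "int p dvd int j" by simp
  then show ?thesis
    using assms prime_gt_0_nat[of p] by (intro dvd_diff) (auto intro: dvd_trans[OF _ dvd_power])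
next
  case False
  then have "int p dvd int j ^ (p - 1) - 1"
    using fermat_theorem[OF assms False]
    by (metis cong_iff_dvd_diff cong_int_iff of_nat_1 of_nat_power)
  moreover have "int j ^ p - int j = (int j ^ (p - 1) - 1) * int j"
    using prime_gt_0_nat[OF assms] by (cases p) (auto simp: algebra_simps)
  ultimately show ?thesis by simp
qed

text \<open>Evaluate X^p = \<Sum> S(p, i) X (X - 1) ... (X - i + 1) at X = j. Terms with i > j
  vanish, i = 1 gives j, and those with 2 \<le> i < j are divisible by p by induction. Fermat's
  congruence leaves p | S(p, j) j!, and p does not divide j!.\<close>

lemma prime_dvd_Stirling:
  assumes p: "Factorial_Ring.prime p" and "2 \<le> j" "j < p"
  shows "p dvd Stirling p j"
  using assms(2,3)
proof (induction j rule: less_induct)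
  case (less j)
  define F where "F i = (\<Prod>k<i. int j - int k)" for i
  have F0: "F i = 0" if "i > j" for i
    unfolding F_def by (rule prod_zero) (use that in auto)
  have Fj: "F j = fact j"
    unfolding F_def by (simp add: fact_prod_rev of_nat_diff atLeast0LessThan)
  have "int j ^ p = (\<Sum>i\<le>p. int (Stirling p i) * F i)"
    unfolding F_def using power_Stirling[of "int j" p 1] by simp
  also have "\<dots> = (\<Sum>i\<in>{1, j} \<union> {2..<j}. int (Stirling p i) * F i)"
  proof (rule sum.mono_neutral_right)
    show "\<forall>i\<in>{..p} - ({1, j} \<union> {2..<j}). int (Stirling p i) * F i = 0"
    proof
      fix i assume i: "i \<in> {..p} - ({1, j} \<union> {2..<j})"
      then have "i = 0 \<or> i > j" by auto
      moreover have "Stirling p 0 = 0" using less.prems by (cases p) auto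
      ultimately show "int (Stirling p i) * F i = 0" using F0 by auto
    qed
  qed (use less.prems in auto)
  also have "\<dots> = int j + int (Stirling p j) * fact j + (\<Sum>i\<in>{2..<j}. int (Stirling p i) * F i)"
  proof -
    have "Stirling p 1 = 1" using less.prems Stirling_1[of "p - 1"] by simp
    moreover have "F 1 = int j" by (simp add: F_def)
    ultimately show ?thesis using less.prems Fj by (subst sum.union_disjoint) auto
  qed
  finally have "int (Stirling p j) * fact j =
      (int j ^ p - int j) - (\<Sum>i\<in>{2..<j}. int (Stirling p i) * F i)" by simp
  moreover have "int p dvd (\<Sum>i\<in>{2..<j}. int (Stirling p i) * F i)"
    using less by (intro dvd_sum dvd_mult2) auto
  ultimately have "int p dvd int (Stirling p j) * fact j"
    using prime_dvd_power_minus_self[OF p, of j] by (simp only: dvd_diff)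
  then have "p dvd Stirling p j * fact j"
    by (metis of_nat_dvd_iff of_nat_fact of_nat_mult)
  then show ?case
    using p less.prems by (simp add: prime_dvd_mult_iff prime_dvd_fact_iff)
qed

section \<open>Total divisibilities and the Kochen operator\<close>

locale total_divisibility = cancel_divisibility +
  assumes total: "a \<preceq> b \<or> b \<preceq> a"
begin

text \<open>The value of \<open>w\<close> exceeds that of a non-null \<open>u\<close>, so by the
  ultrametric inequality subtracting \<open>w\<close> does not raise the value of
  \<open>u\<close>.\<close>

lemma diff_dominant:
  assumes q: "1 \<preceq> q" "\<not> q \<preceq> 1" and "q * u \<preceq> w"
  shows "u - w \<preceq> u"
proof (cases "u - w \<preceq> w")
  case True
  from add[OF refl True] show ?thesis by simp
next
  case False
  then have "w \<preceq> u - w" using total by blast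
  from add[OF this refl] have "w \<preceq> u" by simp
  with assms(3) have "q * u \<preceq> 1 * u" by (auto intro: trans)
  then have "0 \<preceq> u" using q(2) cancel by blast
  then show ?thesis by (rule null_all)
qed

text \<open>With u = t / T the claim is that u / (q (u^2 - 1)) is integral. If q divides u, then u^2
  - 1 is a unit. If q divides 1 / u, exchanging t and T reduces to this case and only changes a
  sign.\<close>

lemma kochen_integral:
  assumes q: "1 \<preceq> q" "\<not> q \<preceq> 1" and tT: "q * T \<preceq> t \<or> q * t \<preceq> T"
  shows "q * (t\<^sup>2 - T\<^sup>2) \<preceq> t * T"
proof -
  have *: "q * (x\<^sup>2 - y\<^sup>2) \<preceq> x * y" if "q * x \<preceq> y" for x y
  proof -
    have "q * x\<^sup>2 \<preceq> q * (q * x\<^sup>2)"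
      using integral_mult'[OF refl q(1)] by simp
    also have "\<dots> \<preceq> y\<^sup>2"
      using power[OF that, of 2] by (simp add: power2_eq_square ac_simps)
    finally have "q * (x\<^sup>2 - y\<^sup>2) \<preceq> q * x\<^sup>2"
      using diff_dominant[OF q] mult_left by blast
    also have "\<dots> \<preceq> x * y"
      using mult_left[OF that, of x] by (simp add: power2_eq_square ac_simps)
    finally show ?thesis .
  qed
  from tT show ?thesis
  proof
    assume "q * T \<preceq> t"
    from *[OF this] have "- (q * (T\<^sup>2 - t\<^sup>2)) \<preceq> T * t" by simp
    then show ?thesis by (simp add: algebra_simps)
  qed (rule *)
qed

text \<open>Put x = a / b. If p divides 1 / x, then x^p dominates x, so the inverse of x^p - x is
  divisible by p without any information on residues. The remaining x are covered by
  \<open>fermat\<close>, which says that p divides x^p - x.\<close>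

lemma SpecDpI:
  assumes p: "Factorial_Ring.prime p" "\<not> of_nat p \<preceq> 1"
    and fermat: "\<And>a b. \<not> of_nat p * a \<preceq> b \<Longrightarrow> of_nat p * b ^ (p + 1) \<preceq> a ^ p * b - b ^ p * a"
  shows "dv \<in> SpecDp p"
proof -
  have "of_nat p * ((a ^ p * b - b ^ p * a)\<^sup>2 - (b ^ (p + 1))\<^sup>2) \<preceq>
      (a ^ p * b - b ^ p * a) * b ^ (p + 1)" for a b
  proof (rule kochen_integral[OF of_nat p(2)])
    show "of_nat p * b ^ (p + 1) \<preceq> a ^ p * b - b ^ p * a \<or>
        of_nat p * (a ^ p * b - b ^ p * a) \<preceq> b ^ (p + 1)"
    proof (cases "of_nat p * a \<preceq> b")
      case True
      obtain m where m: "p = Suc (Suc m)"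
        using prime_ge_2_nat[OF p(1)] by (metis add_2_eq_Suc le_Suc_ex)
      have "a \<preceq> of_nat p * a" by (rule integral_mult') simp_all
      then have ab: "a \<preceq> b" using True by (rule trans)
      \<comment> \<open>Here p \<ge> 2 matters: the quotient of x by x^p is (b / a)^(p - 1), and p
        divides one of its factors b / a.\<close>
      have "of_nat p * (a ^ p * b) \<preceq> b ^ p * a"
        using mult[OF True mult_right[OF power[OF ab, of m], of "a * b"]]
        by (simp add: m ac_simps)
      then have "a ^ p * b - b ^ p * a \<preceq> a ^ p * b"
        by (rule diff_dominant[OF of_nat p(2)])
      then have "of_nat p * (a ^ p * b - b ^ p * a) \<preceq> of_nat p * (a ^ p * b)"
        by (rule mult_left)
      also have "\<dots> \<preceq> b ^ (p + 1)"
        using mult[OF True mult_right[OF power[OF ab, of "Suc m"], of b]]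
        by (simp add: m ac_simps)
      finally show ?thesis ..
    qed (use fermat in blast)
  qed
  moreover have "\<not> of_nat p * a \<preceq> a" if "\<not> 0 \<preceq> a" for a
    using cancel[OF that, of "of_nat p" 1] p(2) by auto
  ultimately show ?thesis
    unfolding SpecDp_def p_divisibility_def using divisibility total cancel by blast
qed

end

section \<open>Consequences of axiom (7) for values and residues\<close>

locale p_divisibility_spectrum = total_divisibility +
  fixes p :: nat
  assumes p: "Factorial_Ring.prime p" and kochen:
    "of_nat p * ((a ^ p * b - b ^ p * a)\<^sup>2 - (b ^ (p + 1))\<^sup>2) \<preceq> (a ^ p * b - b ^ p * a) * b ^ (p + 1)"
    and p_nonunit: "\<not> of_nat p \<preceq> 1"
begin

text \<open>For integral x = a / b and u = x^p - x, the factor u^2 - 1 is integral, so (7) gives the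
  chain p | p (u^2 - 1) | u.\<close>

lemma power_frobenius:
  assumes "b \<preceq> a"
  shows "of_nat p * b ^ p \<preceq> a ^ p - b ^ (p - 1) * a"
proof (cases "0 \<preceq> b")
  case True
  then have "0 \<preceq> a" using assms by (rule null_trans)
  then have "0 \<preceq> a ^ p - b ^ (p - 1) * a"
    using prime_gt_0_nat[OF p] by (intro diff) auto
  then show ?thesis by (rule null_all)
next
  case False
  define t T where "t = a ^ p * b - b ^ p * a" and "T = b ^ (p + 1)"
  have "T \<preceq> t"
    unfolding t_def T_def
    using mult_right[OF power[OF assms, of p], of b] mult_left[OF assms, of "b ^ p"]
    by (intro diff) (simp_all add: ac_simps)
  then have "T\<^sup>2 \<preceq> t\<^sup>2 - T\<^sup>2"
    using power[of T t 2] by (simp add: diff)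
  then have "of_nat p * T\<^sup>2 \<preceq> t * T"
    using kochen[of a b] mult_left trans unfolding t_def T_def by blast
  then have "of_nat p * T * T \<preceq> t * T"
    by (simp add: power2_eq_square ac_simps)
  moreover have "\<not> 0 \<preceq> T" using False by (simp add: T_def)
  ultimately have "of_nat p * T \<preceq> t"
    using cancel by blast
  moreover have "t = (a ^ p - b ^ (p - 1) * a) * b"
    using prime_gt_0_nat[OF p] by (cases p) (auto simp: t_def algebra_simps)
  ultimately have "of_nat p * b ^ p * b \<preceq> (a ^ p - b ^ (p - 1) * a) * b"
    by (simp add: T_def ac_simps)
  then show ?thesis using cancel False by blast
qed

lemma power_reflect:
  assumes "d \<preceq> c" "c ^ Suc n \<preceq> d ^ Suc n"
  shows "c \<preceq> d"
proof (cases "0 \<preceq> d")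
  case True
  then show ?thesis by (rule null_all)
next
  case False
  have "c * d ^ n \<preceq> c ^ Suc n"
    using mult_left[OF power[OF assms(1), of n], of c] by simp
  also have "\<dots> \<preceq> d * d ^ n" using assms(2) by simp
  finally show ?thesis using cancel False null_power_iff by blast
qed

text \<open>Let x = c / d have positive value. Then x^(p - 1) - 1 is a unit, and p divides x^p - x =
  x (x^(p - 1) - 1), hence x.\<close>

lemma p_minimal:
  assumes dc: "d \<preceq> c" "\<not> c \<preceq> d"
  shows "of_nat p * d \<preceq> c"
proof -
  obtain m where m: "p = Suc (Suc m)"
    using prime_ge_2_nat[OF p] by (metis add_2_eq_Suc le_Suc_ex)
  have d: "\<not> 0 \<preceq> d" using null_all dc(2) by blast
  define u where "u = c ^ Suc m - d ^ Suc m"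
  have "u \<preceq> d ^ Suc m"
  proof (cases "u \<preceq> c ^ Suc m")
    case True
    from diff[OF True refl] show ?thesis by (simp add: u_def)
  next
    case False
    then have "c ^ Suc m \<preceq> u" using total by blast
    \<comment> \<open>If x^(p - 1) divided x^(p - 1) - 1, it would divide 1 and x would be a
      unit.\<close>
    from diff[OF refl this] have "c ^ Suc m \<preceq> d ^ Suc m" by (simp add: u_def)
    then show ?thesis using power_reflect dc by blast
  qed
  then have "c * u \<preceq> c * d ^ Suc m" by (rule mult_left)
  moreover have "of_nat p * d ^ p \<preceq> c * u"
    using power_frobenius[OF dc(1)] by (simp add: u_def m algebra_simps)
  ultimately have "of_nat p * d ^ p \<preceq> c * d ^ Suc m" by (blast intro: trans)
  then have "of_nat p * d * d ^ Suc m \<preceq> c * d ^ Suc m"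
    by (simp add: m ac_simps)
  then show ?thesis using cancel d null_power_iff by blast
qed

lemma prod_mono_dv: "(\<And>i. i \<in> I \<Longrightarrow> f i \<preceq> g i) \<Longrightarrow> prod f I \<preceq> prod g I"
  by (induction I rule: infinite_finite_induct) (auto intro: mult)

text \<open>In the Stirling expansion of x^p for x = a / b, the terms with 1 < j < p are divisible
  by p, so p divides the product x (x - 1) ... (x - p + 1) along with x^p - x. If p divided none of
  the factors, they would all be units by \<open>p_minimal\<close>, and so would p.\<close>

lemma residue_exists:
  assumes ba: "b \<preceq> a"
  shows "\<exists>k. of_nat p * b \<preceq> a - of_nat k * b"
proof (cases "0 \<preceq> b")
  case True
  then have "0 \<preceq> a" using assms by (rule null_trans)
  then show ?thesis using null_all by (intro exI[of _ 0]) auto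
next
  case False
  define F where "F j = (\<Prod>k<j. a - of_nat k * b)" for j
  have int: "b \<preceq> a - of_nat k * b" for k
    using ba by (intro diff integral_mult') auto
  obtain m where m: "p = Suc (Suc m)"
    using prime_ge_2_nat[OF p] by (metis add_2_eq_Suc le_Suc_ex)
  have "of_nat p * b ^ p \<preceq> of_nat (Stirling p j) * F j * b ^ (p - j)" if j: "j \<in> {2..<p}" for j
  proof -
    obtain r where r: "Stirling p j = p * r"
      using prime_dvd_Stirling[OF p] j by (auto elim: dvdE)
    have "b ^ j \<preceq> F j"
      unfolding F_def using prod_mono_dv[of "{..<j}" "\<lambda>_. b" "\<lambda>k. a - of_nat k * b"] int by simp
    then have "of_nat p * (b ^ j * b ^ (p - j)) \<preceq> of_nat p * (of_nat r * F j * b ^ (p - j))"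
      using integral_mult'[of "b ^ j" "F j" "of_nat r"] by (intro mult_left mult_right) simp
    then show ?thesis
      using j by (simp add: r ac_simps flip: power_add)
  qed
  then have "of_nat p * b ^ p \<preceq> (\<Sum>j=2..<p. of_nat (Stirling p j) * F j * b ^ (p - j))"
    by (rule sum)
  moreover have "a ^ p = b ^ (p - 1) * a + F p +
      (\<Sum>j=2..<p. of_nat (Stirling p j) * F j * b ^ (p - j))"
  proof -
    have "{..p} = {0, 1, p} \<union> {2..<p}" by (auto simp: m)
    then have "a ^ p = (\<Sum>j\<in>{0, 1, p} \<union> {2..<p}. of_nat (Stirling p j) * F j * b ^ (p - j))"
      using power_Stirling[of a p b] by (simp add: F_def)
    also have "\<dots> = (\<Sum>j\<in>{0, 1, p}. of_nat (Stirling p j) * F j * b ^ (p - j)) +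
        (\<Sum>j=2..<p. of_nat (Stirling p j) * F j * b ^ (p - j))"
      by (rule sum.union_disjoint) auto
    also have "(\<Sum>j\<in>{0, 1, p}. of_nat (Stirling p j) * F j * b ^ (p - j)) =
        of_nat (Stirling p 0) * F 0 * b ^ p + of_nat (Stirling p 1) * F 1 * b ^ (p - 1) +
        of_nat (Stirling p p) * F p"
      by (simp add: m del: Stirling.simps)
    also have "\<dots> = b ^ (p - 1) * a + F p"
    proof -
      have "Stirling p 0 = 0" "Stirling p 1 = 1"
        using Stirling_1[of "p - 1"] by (simp_all add: m del: Stirling.simps(4))
      then show ?thesis by (simp add: F_def ac_simps del: Stirling.simps)
    qed
    finally show ?thesis .
  qed
  ultimately have p_F: "of_nat p * b ^ p \<preceq> F p"
    using diff[OF power_frobenius[OF ba], of "\<Sum>j=2..<p. of_nat (Stirling p j) * F j * b ^ (p - j)"]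
    by (simp add: algebra_simps)
  show ?thesis
  proof (rule ccontr)
    assume "\<not> ?thesis"
    then have "a - of_nat k * b \<preceq> b" for k
      using p_minimal int by blast
    then have "F p \<preceq> b ^ p"
      unfolding F_def using prod_mono_dv[of "{..<p}" "\<lambda>k. a - of_nat k * b" "\<lambda>_. b"] by simp
    with p_F have "of_nat p * b ^ p \<preceq> 1 * b ^ p" by (auto intro: trans)
    then show False using cancel False p_nonunit null_power_iff by blast
  qed
qed

end

lemma SpecDp_imp_spectrum:
  assumes "Factorial_Ring.prime p" "dv \<in> SpecDp p"
  shows "p_divisibility_spectrum dv p"
proof -
  note spec = assms(2)[unfolded SpecDp_def mem_Collect_eq]
  note total = spec[THEN conjunct2, THEN conjunct1, rule_format]
    and cancel = spec[THEN conjunct2, THEN conjunct2, rule_format]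
    and pd = spec[THEN conjunct1, unfolded p_divisibility_def]
  note div = pd[THEN conjunct1] and p = pd[THEN conjunct2, THEN conjunct1, rule_format]
    and kochen = pd[THEN conjunct2, THEN conjunct2, rule_format]
  interpret divisibility_rel dv by unfold_locales (rule div)
  show ?thesis
  proof
    show "\<not> dv (of_nat p) 1" using p[OF not_zero_one] by simp
  qed (fact total cancel kochen assms)+
qed

subsection \<open>Valued fields\<close>

locale valued_field = field K for K :: "('b, 'm) ring_scheme" (structure) +
  fixes G :: "'g set" and pl z leq and v :: "'b \<Rightarrow> 'g"
  assumes valuation: "valuation K G pl z leq v"
begin

text \<open>\<open>v\<close> carries information only on nonzero elements; this comparison builds in
  v(0) = \<infinity>, so that zero is treated uniformly.\<close>

definition vle :: "'b \<Rightarrow> 'b \<Rightarrow> bool" where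
  "vle x y \<longleftrightarrow> y = \<zero> \<or> x \<noteq> \<zero> \<and> leq (v x) (v y)"

abbreviation V where "V \<equiv> val_ring K z leq v"
abbreviation M where "M \<equiv> val_ideal K z leq v"
abbreviation VR where "VR \<equiv> K\<lparr>carrier := V\<rparr>"

lemma v_image: "v ` (carrier K - {\<zero>}) = G"
  using valuation by (simp add: valuation_def)

lemma v_closed: "x \<in> carrier K \<Longrightarrow> x \<noteq> \<zero> \<Longrightarrow> v x \<in> G"
  using v_image by blast

lemma v_mult: "x \<in> carrier K \<Longrightarrow> x \<noteq> \<zero> \<Longrightarrow> y \<in> carrier K \<Longrightarrow> y \<noteq> \<zero> \<Longrightarrow> v (x \<otimes> y) = pl (v x) (v y)"
  using valuation by (simp add: valuation_def)

lemma value_group: "comm_group \<lparr>carrier = G, monoid.mult = pl, one = z\<rparr>"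
  using valuation by (simp add: valuation_def ordered_abelian_group_def)

lemma v_one: "v \<one> = z"
proof -
  interpret comm_group "\<lparr>carrier = G, monoid.mult = pl, one = z\<rparr>" by (rule value_group)
  have "v \<one> \<in> G" by (rule v_closed) auto
  moreover have "pl (v \<one>) (v \<one>) = v \<one>" using v_mult[of \<one> \<one>] by simp
  ultimately show ?thesis using l_cancel_one[of "v \<one>" "v \<one>"] by simp
qed

lemma vle_refl [simp]: "x \<in> carrier K \<Longrightarrow> vle x x"
  using valuation v_closed by (auto simp: vle_def valuation_def ordered_abelian_group_def)

lemma vle_zero [simp]: "vle x \<zero>"
  by (simp add: vle_def)

lemma vle_zero_left [simp]: "vle \<zero> x \<longleftrightarrow> x = \<zero>"
  by (simp add: vle_def)

lemma
  shows leq_trans: "a \<in> G \<Longrightarrow> b \<in> G \<Longrightarrow> c \<in> G \<Longrightarrow> leq a b \<Longrightarrow> leq b c \<Longrightarrow> leq a c"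
    and leq_total: "a \<in> G \<Longrightarrow> b \<in> G \<Longrightarrow> leq a b \<or> leq b a"
    and leq_antisym: "a \<in> G \<Longrightarrow> b \<in> G \<Longrightarrow> leq a b \<Longrightarrow> leq b a \<Longrightarrow> a = b"
    and leq_mult: "a \<in> G \<Longrightarrow> b \<in> G \<Longrightarrow> c \<in> G \<Longrightarrow> leq a b \<Longrightarrow> leq (pl a c) (pl b c)"
  using valuation unfolding valuation_def ordered_abelian_group_def by meson+

lemma vle_trans:
  assumes "vle x y" "vle y w" "x \<in> carrier K" "y \<in> carrier K" "w \<in> carrier K"
  shows "vle x w"
  using assms v_closed leq_trans[of "v x" "v y" "v w"] unfolding vle_def by metis

lemma vle_total:
  assumes "x \<in> carrier K" "y \<in> carrier K"
  shows "vle x y \<or> vle y x"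
  using assms v_closed leq_total[of "v x" "v y"] unfolding vle_def by metis

lemma v_eq:
  assumes "vle x y" "vle y x" "x \<in> carrier K" "y \<in> carrier K" "x \<noteq> \<zero>"
  shows "v x = v y"
  using assms v_closed leq_antisym[of "v x" "v y"] unfolding vle_def by metis

lemma vle_mult:
  assumes "vle x y" and K: "x \<in> carrier K" "y \<in> carrier K" "w \<in> carrier K"
  shows "vle (x \<otimes> w) (y \<otimes> w)"
proof (cases "y = \<zero> \<or> w = \<zero>")
  case True
  then show ?thesis using K by auto
next
  case False
  have "leq (v (x \<otimes> w)) (v (y \<otimes> w))"
    using False assms v_closed leq_mult[of "v x" "v y" "v w"] by (auto simp: v_mult vle_def)
  then show ?thesis
    using False assms by (auto simp: vle_def integral_iff)
qed

lemma vle_cancel: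
  assumes "vle (x \<otimes> w) (y \<otimes> w)" and K: "x \<in> carrier K" "y \<in> carrier K" "w \<in> carrier K" "w \<noteq> \<zero>"
  shows "vle x y"
proof -
  have w: "w \<in> Units K" using K field_Units by auto
  have "vle (x \<otimes> w \<otimes> inv w) (y \<otimes> w \<otimes> inv w)"
    using assms w by (intro vle_mult[of "x \<otimes> w" "y \<otimes> w"]) auto
  then show ?thesis using K w by (simp add: m_assoc)
qed

lemma vle_add:
  assumes "vle a x" "vle a y" and K: "a \<in> carrier K" "x \<in> carrier K" "y \<in> carrier K"
  shows "vle a (x \<oplus> y)"
proof (cases "x = \<zero> \<or> y = \<zero> \<or> x \<oplus> y = \<zero>")
  case True
  then show ?thesis using assms by auto
next
  case False
  then have "vle x (x \<oplus> y) \<or> vle y (x \<oplus> y)"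
    using valuation K by (auto simp: vle_def valuation_def)
  then show ?thesis
    using vle_trans[of a x "x \<oplus> y"] vle_trans[of a y "x \<oplus> y"] assms by auto
qed

text \<open>The values of 1 and -1 are comparable by totality, and multiplying the unfavourable
  comparison by -1 reverses it.\<close>

lemma vle_minus_self:
  assumes "x \<in> carrier K"
  shows "vle x (\<ominus> x)"
proof -
  have "vle \<one> (\<ominus> \<one>)"
    using vle_total[of \<one> "\<ominus> \<one>"] vle_mult[of "\<ominus> \<one>" \<one> "\<ominus> \<one>"]
    by (auto simp: l_minus r_minus)
  from vle_mult[OF this, of x] show ?thesis
    using assms by (simp add: l_minus)
qed

lemma vle_minus:
  assumes "vle a x" "a \<in> carrier K" "x \<in> carrier K"
  shows "vle a (\<ominus> x)"
  using assms vle_trans[of a x "\<ominus> x"] vle_minus_self[of x] by auto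

lemma vle_diff:
  assumes "vle a x" "vle a y" "a \<in> carrier K" "x \<in> carrier K" "y \<in> carrier K"
  shows "vle a (x \<ominus> y)"
  unfolding minus_eq using assms by (intro vle_add vle_minus) auto

lemma V_iff: "x \<in> V \<longleftrightarrow> x \<in> carrier K \<and> vle \<one> x"
  by (auto simp: val_ring_def vle_def v_one)

lemma M_iff: "x \<in> M \<longleftrightarrow> x \<in> carrier K \<and> vle \<one> x \<and> \<not> vle x \<one>"
proof -
  have "leq z z" using vle_refl[of \<one>] by (simp add: vle_def v_one)
  then show ?thesis
    using v_eq[of \<one> x] by (auto simp: val_ideal_def vle_def v_one)
qed

lemma subring_V: "subring V K"
proof (rule subringI)
  show "V \<subseteq> carrier K" by (auto simp: V_iff)
  show "\<one> \<in> V" by (simp add: V_iff)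
  show "\<ominus> x \<in> V" if "x \<in> V" for x using that by (auto simp: V_iff intro: vle_minus)
  show "x \<otimes> y \<in> V" if "x \<in> V" "y \<in> V" for x y
    using that vle_mult[of \<one> x y] vle_trans[of \<one> y "x \<otimes> y"] by (auto simp: V_iff)
  show "x \<oplus> y \<in> V" if "x \<in> V" "y \<in> V" for x y
    using that by (auto simp: V_iff intro: vle_add)
qed

lemma ring_VR: "ring VR"
  by (rule subring_is_ring[OF subring_V])

lemma M_mult: "x \<in> V \<Longrightarrow> y \<in> M \<Longrightarrow> x \<otimes> y \<in> M"
  using vle_mult[of \<one> x y] vle_trans[of \<one> y "x \<otimes> y"] vle_trans[of y "x \<otimes> y" \<one>]
  by (auto simp: V_iff M_iff)

lemma M_add: 
  assumes "x \<in> M" "y \<in> M"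
  shows "x \<oplus> y \<in> M"
proof -
  have xy: "x \<in> carrier K" "y \<in> carrier K" using assms by (auto simp: M_iff)
  have "vle \<one> (x \<oplus> y)" using assms by (auto simp: M_iff intro: vle_add)
  moreover have "vle x (x \<oplus> y) \<or> vle y (x \<oplus> y)"
    using vle_total[OF xy] xy vle_add[of x x y] vle_add[of y x y] by auto
  ultimately show ?thesis
    using assms xy vle_trans[of x "x \<oplus> y" \<one>] vle_trans[of y "x \<oplus> y" \<one>]
    by (auto simp: M_iff)
qed

lemma M_minus: "x \<in> M \<Longrightarrow> \<ominus> x \<in> M"
  using M_mult[of "\<ominus> \<one>" x] vle_minus_self[of \<one>] by (auto simp: V_iff M_iff l_minus)

lemma M_subset: "M \<subseteq> V"
  by (auto simp: V_iff M_iff)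

lemma zero_in_M: "\<zero> \<in> M"
  by (simp add: M_iff)

lemma ideal_M: "ideal M VR"
proof (rule idealI[OF ring_VR])
  have "subgroup M (add_monoid K)"
  proof (rule add.subgroupI)
    show "M \<subseteq> carrier K" by (auto simp: M_iff)
    show "M \<noteq> {}" using zero_in_M by blast
  qed (use M_add M_minus in \<open>auto simp: a_inv_def[symmetric]\<close>)
  moreover have "subgroup V (add_monoid K)"
    using subring.axioms(1)[OF subring_V] .
  ultimately have "subgroup M (add_monoid K\<lparr>carrier := V\<rparr>)"
    using M_subset add.subgroup_incl by blast
  then show "subgroup M (add_monoid VR)" by simp
  show "x \<otimes>\<^bsub>VR\<^esub> a \<in> M" "a \<otimes>\<^bsub>VR\<^esub> x \<in> M" if "a \<in> M" "x \<in> carrier VR" for a x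
    using that M_mult[of x a] by (auto simp: V_iff M_iff m_comm)
qed

lemma residue_eq_iff:
  assumes "x \<in> V" "y \<in> V"
  shows "M +>\<^bsub>VR\<^esub> x = M +>\<^bsub>VR\<^esub> y \<longleftrightarrow> x \<ominus> y \<in> M"
proof -
  interpret I: ideal M VR by (rule ideal_M)
  have K: "x \<in> carrier K" "y \<in> carrier K" using assms by (auto simp: V_iff)
  have "x \<in> M +>\<^bsub>VR\<^esub> y \<longleftrightarrow> (\<exists>h\<in>M. x = h \<oplus> y)"
    by (auto simp: a_r_coset_def')
  also have "\<dots> \<longleftrightarrow> x \<ominus> y \<in> M"
  proof
    assume "\<exists>h\<in>M. x = h \<oplus> y"
    then obtain h where h: "h \<in> M" "x = h \<oplus> y" by blast
    then have "x \<ominus> y = h" using K by (auto simp: M_iff minus_eq a_assoc r_neg)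
    then show "x \<ominus> y \<in> M" using h by simp
  next
    assume "x \<ominus> y \<in> M"
    moreover have "x = (x \<ominus> y) \<oplus> y" using K by (simp add: minus_eq a_assoc l_neg)
    ultimately show "\<exists>h\<in>M. x = h \<oplus> y" by blast
  qed
  finally have "x \<in> M +>\<^bsub>VR\<^esub> y \<longleftrightarrow> x \<ominus> y \<in> M" .
  moreover have "M +>\<^bsub>VR\<^esub> x = M +>\<^bsub>VR\<^esub> y \<longleftrightarrow> x \<in> M +>\<^bsub>VR\<^esub> y"
    using I.a_rcos_self[of x] I.a_repr_independence'[of x y] assms by auto
  ultimately show ?thesis by blast
qed

end

subsection \<open>Pulling back a \<open>p\<close>-valuation\<close>

lemma ZFact_frobenius:
  assumes p: "Factorial_Ring.prime p" and y: "y \<in> carrier (ZFact (int p))"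
  shows "y [^]\<^bsub>ZFact (int p)\<^esub> p = y"
proof -
  have h: "ring_hom_ring \<Z> (ZFact (int p)) ((+>\<^bsub>\<Z>\<^esub>) (Idl\<^bsub>\<Z>\<^esub> {int p}))"
    unfolding ZFact_def by (intro ideal.rcos_ring_hom_ring int.genideal_ideal) simp
  obtain k where "y = ZMod (int p) k"
    using y by (auto simp: ZFact_defs A_RCOSETS_def' ZMod_def)
  moreover define j where "j = nat (k mod int p)"
  moreover have "int j = k mod int p"
    using prime_gt_0_nat[OF p] by (simp add: j_def)
  ultimately have y: "y = ZMod (int p) (int j)"
    by (simp add: ZMod_mod[of "int p" k])
  have "int j [^]\<^bsub>\<Z>\<^esub> n = int j ^ n" for n
    by (induction n) auto
  then have "y [^]\<^bsub>ZFact (int p)\<^esub> p = ZMod (int p) (int j ^ p)"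
    unfolding y ZMod_def using ring_hom_ring.hom_nat_pow[OF h, of "int j" p] by simp
  also have "\<dots> = y"
    unfolding y using prime_dvd_power_minus_self[OF p, of j]
    by (intro zmod_imp_ZMod) (simp add: mod_eq_dvd_iff)
  finally show ?thesis .
qed

context valued_field
begin

text \<open>Frobenius is the identity on Z / p, and the isomorphism carries this over to the residue
  field. In this form the hypothesis on the residue field enters the verification of axiom
  (7).\<close>

lemma residue_frobenius:
  assumes p: "Factorial_Ring.prime p" and iso: "residue_field K z leq v \<simeq> ZFact (int p)" and x: "x \<in> V"
  shows "x [^] p \<ominus> x \<in> M"
proof -
  interpret I: ideal M VR by (rule ideal_M)
  obtain h where h: "h \<in> ring_hom (VR Quot M) (ZFact (int p))"
    "bij_betw h (carrier (VR Quot M)) (carrier (ZFact (int p)))"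
    using iso unfolding is_ring_iso_def ring_iso_def residue_field_def by blast
  interpret g: ring_hom_ring VR "ZFact (int p)" "h \<circ> (+>\<^bsub>VR\<^esub>) M"
    using ring_hom_trans[OF I.rcos_ring_hom h(1)] ring_VR ZFact_is_cring
    by (intro ring_hom_ringI2) (auto simp: cring_def)
  have pow: "x [^]\<^bsub>VR\<^esub> p = x [^] p"
    by (rule nat_pow_consistent[symmetric])
  have xp: "x [^] p \<in> V"
    using monoid.nat_pow_closed[OF ring.is_monoid[OF ring_VR], of x p] x by (simp add: pow)
  have "h (M +>\<^bsub>VR\<^esub> (x [^] p)) = h (M +>\<^bsub>VR\<^esub> x)"
    using g.hom_nat_pow[of x p] ZFact_frobenius[OF p] g.hom_closed[of x] x by (simp add: pow)
  moreover have "M +>\<^bsub>VR\<^esub> y \<in> carrier (VR Quot M)" if "y \<in> V" for y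
    using that ring_hom_closed[OF I.rcos_ring_hom] by simp
  ultimately have "M +>\<^bsub>VR\<^esub> (x [^] p) = M +>\<^bsub>VR\<^esub> x"
    using h(2) x xp unfolding bij_betw_def inj_on_def by blast
  then show ?thesis using residue_eq_iff[OF xp x] by blast
qed

end

lemma (in field) ring_hom_into_facts:
  assumes "ring_hom_into R \<delta>"
  shows "\<delta> a \<in> carrier R" "\<delta> (a + b) = \<delta> a \<oplus> \<delta> b" "\<delta> (a * b) = \<delta> a \<otimes> \<delta> b" "\<delta> 1 = \<one>"
    "\<delta> 0 = \<zero>" "\<delta> (- a) = \<ominus> \<delta> a" "\<delta> (a - b) = \<delta> a \<ominus> \<delta> b" "\<delta> (a ^ n) = \<delta> a [^] n"
    "\<delta> (of_nat n) = [n] \<cdot> \<one>"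
proof -
  have closed: "\<delta> a \<in> carrier R" and add: "\<delta> (a + b) = \<delta> a \<oplus> \<delta> b"
    and mult: "\<delta> (a * b) = \<delta> a \<otimes> \<delta> b" and one: "\<delta> 1 = \<one>" for a b
    using assms by (auto simp: ring_hom_into_def)
  have zero: "\<delta> 0 = \<zero>"
    using add[of 0 0] closed[of 0] by (metis add.l_cancel_one add_0)
  have minus: "\<delta> (- a) = \<ominus> \<delta> a" for a
    using add[of "- a" a] closed by (intro minus_equality[symmetric]) (auto simp: zero)
  show "\<delta> a \<in> carrier R" "\<delta> (a + b) = \<delta> a \<oplus> \<delta> b" "\<delta> (a * b) = \<delta> a \<otimes> \<delta> b" "\<delta> 1 = \<one>"
    "\<delta> 0 = \<zero>" "\<delta> (- a) = \<ominus> \<delta> a" by (fact closed add mult one zero minus)+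
  show "\<delta> (a - b) = \<delta> a \<ominus> \<delta> b"
    using add[of a "- b"] by (simp add: minus minus_eq)
  show "\<delta> (a ^ n) = \<delta> a [^] n"
    using closed by (induction n) (auto simp: one mult m_comm)
  show "\<delta> (of_nat n) = [n] \<cdot> \<one>"
    by (induction n) (auto simp: zero one add a_comm)
qed

section \<open>Fields with a p-valuation\<close>

locale p_valued_field = valued_field +
  fixes p :: nat
  assumes p: "Factorial_Ring.prime p" and p_valuation: "p_valuation p K G pl z leq v"
    and char_zero: "char_zero_ring K"
begin

text \<open>\<open>v\<close> says nothing about zero, so characteristic 0 is what gives the
  conditions on v(p) their content.\<close>

lemma p_nonzero: "[p] \<cdot> \<one> \<noteq> \<zero>"
  using char_zero prime_gt_0_nat[OF p] by (simp add: char_zero_ring_def)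

lemma p_positive: "\<not> vle ([p] \<cdot> \<one>) \<one>"
  using p_valuation v_eq[of "[p] \<cdot> \<one>" \<one>] p_nonzero
  by (auto simp: p_valuation_def Let_def vle_def v_one)

lemma M_imp_vle_p:
  assumes "x \<in> M"
  shows "vle ([p] \<cdot> \<one>) x"
  using assms p_valuation v_closed[of x] p_nonzero
  by (auto simp: p_valuation_def Let_def vle_def val_ideal_def)

lemma vle_p_mult:
  assumes "\<not> vle y x" and K: "x \<in> carrier K" "y \<in> carrier K"
  shows "vle ([p] \<cdot> \<one> \<otimes> x) y"
proof -
  have x: "x \<noteq> \<zero>" using assms(1) by auto
  then have xU: "x \<in> Units K" using K field_Units by auto
  define w where "w = y \<otimes> inv x"
  have w: "w \<in> carrier K" "y = w \<otimes> x"
    using K xU by (auto simp: w_def m_assoc)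
  have "\<not> vle w \<one>"
    using assms vle_mult[of w \<one> x] w by auto
  then have "w \<in> M" using vle_total[of w \<one>] w by (auto simp: M_iff)
  then show ?thesis
    using vle_mult[OF M_imp_vle_p[of w], of x] w K by auto
qed

lemma frobenius:
  assumes ba: "vle b a" and K: "a \<in> carrier K" "b \<in> carrier K"
  shows "vle ([p] \<cdot> \<one> \<otimes> b [^] (p + 1)) (a [^] p \<otimes> b \<ominus> b [^] p \<otimes> a)"
proof (cases "b = \<zero>")
  case True
  then have "a = \<zero>" using ba by simp
  then show ?thesis using True by (simp add: minus_eq)
next
  case False
  then have bU: "b \<in> Units K" using K field_Units by auto
  define x where "x = a \<otimes> inv b"
  have x: "x \<in> carrier K" and a: "a = x \<otimes> b"
    using K bU by (auto simp: x_def m_assoc)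
  have "x \<in> V"
    using ba vle_cancel[of \<one> b x] x K False by (auto simp: V_iff a)
  then have "x [^] p \<ominus> x \<in> M"
    using residue_frobenius p p_valuation by (auto simp: p_valuation_def Let_def)
  then have "vle ([p] \<cdot> \<one> \<otimes> b [^] (p + 1)) ((x [^] p \<ominus> x) \<otimes> b [^] (p + 1))"
    using x K by (intro vle_mult M_imp_vle_p) auto
  also have "(x [^] p \<ominus> x) \<otimes> b [^] (p + 1) = a [^] p \<otimes> b \<ominus> b [^] p \<otimes> a"
  proof -
    have "a [^] p = x [^] p \<otimes> b [^] p" using x K by (simp add: a nat_pow_distrib)
    moreover have "b [^] (p + 1) = b [^] p \<otimes> b" using K by simp
    moreover have "x [^] p \<in> carrier K" "b [^] p \<in> carrier K" using x K by auto
    ultimately show ?thesis using x K unfolding a minus_eq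
      by (simp add: l_distr r_distr l_minus r_minus m_ac)
  qed
  finally show ?thesis .
qed

lemma pullback_SpecDp:
  assumes "ring_hom_into K \<delta>"
  shows "(\<lambda>a b. vle (\<delta> a) (\<delta> b)) \<in> SpecDp p"
proof -
  note hom = ring_hom_into_facts[OF assms]
  let ?dv = "\<lambda>a b. vle (\<delta> a) (\<delta> b)"
  interpret total_divisibility ?dv
  proof
    show "divisibility ?dv"
      unfolding divisibility_def
      using hom(1) by (auto simp: hom(3-5,7) intro: vle_diff vle_mult vle_trans)
    show "?dv a b" if "\<not> ?dv 0 c" "?dv (a * c) (b * c)" for a b c
      using that hom(1) by (auto simp: hom(3,5) intro: vle_cancel)
    show "?dv a b \<or> ?dv b a" for a b
      by (rule vle_total) (rule hom)+
  qed
  show ?thesis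
  proof (rule SpecDpI[OF p])
    show "\<not> vle (\<delta> (of_nat p)) (\<delta> 1)" using p_positive by (simp add: hom)
    show "vle (\<delta> (of_nat p * b ^ (p + 1))) (\<delta> (a ^ p * b - b ^ p * a))"
      if "\<not> vle (\<delta> (of_nat p * a)) (\<delta> b)" for a b
    proof -
      \<comment> \<open>Since v(p) is the least positive value, v(b) < v(p) + v(a) already forces
        v(b) \<le> v(a).\<close>
      have "vle (\<delta> b) (\<delta> a)"
        using that vle_p_mult[of "\<delta> b" "\<delta> a"] hom(1) by (auto simp: hom(3,9))
      then show ?thesis
        unfolding hom(3,7,8,9) by (rule frobenius) (rule hom)+
    qed
  qed
qed

end

subsection \<open>The value group of a field preorder\<close>

locale preordered_field = field K for K :: "('b, 'm) ring_scheme" (structure) +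
  fixes le :: "'b \<Rightarrow> 'b \<Rightarrow> bool"
  assumes le_trans: "x \<in> carrier K \<Longrightarrow> y \<in> carrier K \<Longrightarrow> w \<in> carrier K \<Longrightarrow> le x y \<Longrightarrow> le y w \<Longrightarrow> le x w"
    and le_total: "x \<in> carrier K \<Longrightarrow> y \<in> carrier K \<Longrightarrow> le x y \<or> le y x"
    and le_mult: "x \<in> carrier K \<Longrightarrow> y \<in> carrier K \<Longrightarrow> w \<in> carrier K \<Longrightarrow> le x y \<Longrightarrow> le (x \<otimes> w) (y \<otimes> w)"
    and le_add: "w \<in> carrier K \<Longrightarrow> x \<in> carrier K \<Longrightarrow> y \<in> carrier K \<Longrightarrow> le w x \<Longrightarrow> le w y \<Longrightarrow> le w (x \<oplus> y)"
    and not_le_zero: "x \<in> carrier K \<Longrightarrow> le \<zero> x \<Longrightarrow> x = \<zero>"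
begin

lemma le_refl [simp]: "x \<in> carrier K \<Longrightarrow> le x x"
  using le_total by blast

lemma le_zero [simp]: "x \<in> carrier K \<Longrightarrow> le x \<zero>"
  using le_total[of x \<zero>] not_le_zero[of x] le_refl by auto

definition nonzeros where "nonzeros = carrier K - {\<zero>}"

text \<open>A value is coded as the set of all nonzero elements having it, a coset of the units of
  the valuation ring. The value group thus consists of sets of field elements, which fits the type
  demanded by the theorem.\<close>

definition vclass :: "'b \<Rightarrow> 'b set" where
  "vclass x = {y \<in> nonzeros. le x y \<and> le y x}"

definition vgroup :: "'b set set" where "vgroup = vclass ` nonzeros"

definition vmult :: "'b set \<Rightarrow> 'b set \<Rightarrow> 'b set" where
  "vmult g h = {w \<in> nonzeros. \<exists>x\<in>g. \<exists>y\<in>h. le (x \<otimes> y) w \<and> le w (x \<otimes> y)}"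

definition vleq :: "'b set \<Rightarrow> 'b set \<Rightarrow> bool" where
  "vleq g h \<longleftrightarrow> (\<exists>x\<in>g. \<exists>y\<in>h. le x y)"

lemma nonzeros_mult: "x \<in> nonzeros \<Longrightarrow> y \<in> nonzeros \<Longrightarrow> x \<otimes> y \<in> nonzeros"
  by (auto simp: nonzeros_def integral_iff)

lemma nonzeros_one: "\<one> \<in> nonzeros"
  by (simp add: nonzeros_def)

lemma nonzeros_carrier: "x \<in> nonzeros \<Longrightarrow> x \<in> carrier K"
  by (simp add: nonzeros_def)

lemma vclass_self: "x \<in> nonzeros \<Longrightarrow> x \<in> vclass x"
  by (auto simp: vclass_def nonzeros_carrier)

lemma vclass_subset: "y \<in> vclass x \<Longrightarrow> y \<in> nonzeros"
  by (auto simp: vclass_def)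

lemma le_mult2:
  assumes "le x x'" "le y y'" "x \<in> nonzeros" "x' \<in> nonzeros" "y \<in> nonzeros" "y' \<in> nonzeros"
  shows "le (x \<otimes> y) (x' \<otimes> y')"
proof -
  have K: "x \<in> carrier K" "x' \<in> carrier K" "y \<in> carrier K" "y' \<in> carrier K"
    using assms nonzeros_carrier by blast+
  have "le (x \<otimes> y) (x' \<otimes> y)" "le (x' \<otimes> y) (x' \<otimes> y')"
    using le_mult[of x x' y] le_mult[of y y' x'] K assms by (simp_all add: m_comm)
  then show ?thesis using le_trans[of "x \<otimes> y" "x' \<otimes> y" "x' \<otimes> y'"] K by simp
qed

lemma vleq_vclass: 
  assumes "x \<in> nonzeros" "y \<in> nonzeros"
  shows "vleq (vclass x) (vclass y) \<longleftrightarrow> le x y"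
proof
  assume "vleq (vclass x) (vclass y)"
  then obtain x' y' where "x' \<in> vclass x" "y' \<in> vclass y" "le x' y'"
    unfolding vleq_def by blast
  then have "le x x'" "le x' y'" "le y' y" "x' \<in> carrier K" "y' \<in> carrier K"
    by (auto simp: vclass_def nonzeros_carrier)
  then show "le x y"
    using le_trans[of x x' y'] le_trans[of x y' y] assms[THEN nonzeros_carrier] by blast
next
  assume "le x y"
  then show "vleq (vclass x) (vclass y)"
    unfolding vleq_def using vclass_self assms by blast
qed

lemma vclass_eq_iff:
  assumes "x \<in> nonzeros" "y \<in> nonzeros"
  shows "vclass x = vclass y \<longleftrightarrow> le x y \<and> le y x"
proof
  assume "vclass x = vclass y"
  then have "y \<in> vclass x" using vclass_self assms by blast
  then show "le x y \<and> le y x" by (simp add: vclass_def)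
next
  assume le: "le x y \<and> le y x"
  have "le x w \<and> le w x \<longleftrightarrow> le y w \<and> le w y" if "w \<in> nonzeros" for w
    using le le_trans[of x y w] le_trans[of w y x] le_trans[of y x w] le_trans[of w x y]
      assms[THEN nonzeros_carrier] that[THEN nonzeros_carrier] by blast
  then show "vclass x = vclass y" by (auto simp: vclass_def)
qed

lemma vmult_vclass:
  assumes "x \<in> nonzeros" "y \<in> nonzeros"
  shows "vmult (vclass x) (vclass y) = vclass (x \<otimes> y)"
proof (rule Set.set_eqI)
  fix w
  have "w \<in> nonzeros \<and> (\<exists>x'\<in>vclass x. \<exists>y'\<in>vclass y. le (x' \<otimes> y') w \<and> le w (x' \<otimes> y')) \<longleftrightarrow>
      w \<in> nonzeros \<and> le (x \<otimes> y) w \<and> le w (x \<otimes> y)"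
  proof (intro conj_cong HOL.refl iffI)
    assume w: "w \<in> nonzeros"
      and "\<exists>x'\<in>vclass x. \<exists>y'\<in>vclass y. le (x' \<otimes> y') w \<and> le w (x' \<otimes> y')"
    then obtain x' y' where xy: "x' \<in> vclass x" "y' \<in> vclass y" "le (x' \<otimes> y') w" "le w (x' \<otimes> y')"
      by blast
    have K: "x' \<in> nonzeros" "y' \<in> nonzeros" using xy vclass_subset by blast+
    have "le (x \<otimes> y) (x' \<otimes> y')" "le (x' \<otimes> y') (x \<otimes> y)"
      using xy(1,2) assms K by (auto intro!: le_mult2 simp: vclass_def)
    moreover have "x \<otimes> y \<in> carrier K" "x' \<otimes> y' \<in> carrier K" "w \<in> carrier K"
      using K assms nonzeros_mult nonzeros_carrier w by blast+
    ultimately show "le (x \<otimes> y) w \<and> le w (x \<otimes> y)"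
      using xy(3,4) le_trans[of "x \<otimes> y" "x' \<otimes> y'" w] le_trans[of w "x' \<otimes> y'" "x \<otimes> y"]
      by blast
  qed (use vclass_self assms in blast)
  then show "w \<in> vmult (vclass x) (vclass y) \<longleftrightarrow> w \<in> vclass (x \<otimes> y)"
    by (simp add: vmult_def vclass_def)
qed

lemma vgroup_comm_group: "comm_group \<lparr>carrier = vgroup, monoid.mult = vmult, one = vclass \<one>\<rparr>"
proof (rule comm_groupI)
  fix g assume "g \<in> carrier \<lparr>carrier = vgroup, monoid.mult = vmult, one = vclass \<one>\<rparr>"
  then obtain x where x: "x \<in> nonzeros" "g = vclass x" by (auto simp: vgroup_def)
  then have "x \<in> Units K" using field_Units by (simp add: nonzeros_def)
  then have "inv x \<in> nonzeros" "inv x \<otimes> x = \<one>"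
    using field_Units Units_inv_Units[of x] by (auto simp: nonzeros_def)
  then show "\<exists>h\<in>carrier \<lparr>carrier = vgroup, monoid.mult = vmult, one = vclass \<one>\<rparr>.
      h \<otimes>\<^bsub>\<lparr>carrier = vgroup, monoid.mult = vmult, one = vclass \<one>\<rparr>\<^esub> g =
      \<one>\<^bsub>\<lparr>carrier = vgroup, monoid.mult = vmult, one = vclass \<one>\<rparr>\<^esub>"
    using x by (auto simp: vgroup_def vmult_vclass intro!: bexI[of _ "inv x"])
qed (auto simp: vgroup_def vmult_vclass nonzeros_mult nonzeros_one nonzeros_carrier m_ac)

lemma valuation_vclass: "valuation K vgroup vmult (vclass \<one>) vleq vclass"
proof -
  have mult: "le (x \<otimes> w) (y \<otimes> w)" if "le x y" "x \<in> nonzeros" "y \<in> nonzeros" "w \<in> nonzeros" for x y w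
    using that by (intro le_mult2) (auto simp: nonzeros_carrier)
  have ordered: "ordered_abelian_group vgroup vmult (vclass \<one>) vleq"
    unfolding ordered_abelian_group_def
  proof (intro conjI ballI impI vgroup_comm_group)
    fix g h assume "g \<in> vgroup" "h \<in> vgroup"
    then obtain x y where xy: "x \<in> nonzeros" "g = vclass x" "y \<in> nonzeros" "h = vclass y"
      by (auto simp: vgroup_def)
    then have K: "x \<in> carrier K" "y \<in> carrier K" using nonzeros_carrier by blast+
    show "vleq g g" using xy(1) K by (simp add: xy vleq_vclass)
    show "vleq g h \<or> vleq h g" using xy(1,3) le_total[OF K] by (simp add: xy vleq_vclass)
    show "g = h" if "vleq g h" "vleq h g"
      using that xy(1,3) by (simp add: xy(2,4) vleq_vclass vclass_eq_iff)
    fix k assume "k \<in> vgroup"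
    then obtain w where w: "w \<in> nonzeros" "k = vclass w" by (auto simp: vgroup_def)
    show "vleq g k" if "vleq g h" "vleq h k"
      using that xy(1,3) w(1) le_trans[OF K, of w] nonzeros_carrier[of w]
      by (simp add: xy(2,4) w(2) vleq_vclass)
    show "vleq (vmult g k) (vmult h k)" if "vleq g h"
      using that xy(1,3) w(1) mult[of x y w]
      by (simp add: xy(2,4) w(2) vleq_vclass vmult_vclass nonzeros_mult)
  qed
  have "le x (x \<oplus> y) \<or> le y (x \<oplus> y)" if "x \<in> nonzeros" "y \<in> nonzeros" for x y
    using that le_total[of x y] le_add[of x x y] le_add[of y x y] nonzeros_carrier by auto
  then show ?thesis
    unfolding valuation_def nonzeros_def[symmetric]
    using ordered by (auto simp: vgroup_def vmult_vclass vleq_vclass nonzeros_def)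
qed

sublocale valued_field K vgroup vmult "vclass \<one>" vleq vclass
  by unfold_locales (rule valuation_vclass)

lemma vle_iff: "x \<in> carrier K \<Longrightarrow> y \<in> carrier K \<Longrightarrow> vle x y \<longleftrightarrow> le x y"
  using not_le_zero[of y] vleq_vclass[of x y]
  by (cases "x = \<zero>"; cases "y = \<zero>") (auto simp: vle_def nonzeros_def)

text \<open>By \<open>residue\<close> the integers map onto the residue field. The kernel is pZ: it
  contains p, and by Bezout an integer prime to p lying in the maximal ideal would put 1 there
  too.\<close>

lemma p_valuation_vclass:
  fixes \<iota> :: "int \<Rightarrow> 'b"
  assumes p: "Factorial_Ring.prime p" and \<iota>: "ring_hom_into K \<iota>" and p_nonzero: "\<iota> (int p) \<noteq> \<zero>"
    and p_positive: "\<not> le (\<iota> (int p)) \<one>"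
    and p_minimal: "\<And>x. x \<in> carrier K \<Longrightarrow> \<not> le x \<one> \<Longrightarrow> le (\<iota> (int p)) x"
    and residue: "\<And>x. x \<in> carrier K \<Longrightarrow> le \<one> x \<Longrightarrow> \<exists>k. le (\<iota> (int p)) (x \<ominus> \<iota> k)"
  shows "p_valuation p K vgroup vmult (vclass \<one>) vleq vclass"
proof -
  note hom = ring_hom_into_facts[OF \<iota>]
  have \<iota>p: "\<iota> (int p) = [p] \<cdot> \<one>" using hom(9)[of p] by simp
  have p': "\<iota> (int p) \<in> nonzeros" using hom(1) p_nonzero by (simp add: nonzeros_def)
  have \<iota>_nat: "\<iota> (int n) \<in> V" for n
    using hom(1) subringE(3,7)[OF subring_V] by (induction n) (auto simp: hom zero_in_M M_subset[THEN subsetD])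
  have \<iota>_V: "\<iota> k \<in> V" for k
    using \<iota>_nat subringE(5)[OF subring_V] by (cases k) (simp_all add: hom(6) del: of_nat_Suc)
  have p_M: "\<iota> (int p) \<in> M"
    using p_positive hom(1) le_total[of \<one> "\<iota> (int p)"] by (simp add: M_iff vle_iff)
  have M_p: "x \<in> M" if "le (\<iota> (int p)) x" "x \<in> carrier K" for x
    using that p_M hom(1) le_trans[of \<one> "\<iota> (int p)" x] le_trans[of "\<iota> (int p)" x \<one>]
    by (auto simp: M_iff vle_iff)
  have \<iota>_M: "\<iota> k \<in> M \<longleftrightarrow> int p dvd k" for k
  proof
    assume k: "\<iota> k \<in> M"
    show "int p dvd k"
    proof (rule ccontr)
      assume "\<not> int p dvd k"
      then have "coprime (int p) k" using p by (simp add: prime_imp_coprime)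
      then obtain u w where "u * int p + w * k = 1"
        using bezout_int[of "int p" k] by auto
      then have "\<one> = \<iota> u \<otimes> \<iota> (int p) \<oplus> \<iota> w \<otimes> \<iota> k"
        by (simp flip: hom(2,3,4))
      then have "\<one> \<in> M" using M_add M_mult \<iota>_V k p_M by metis
      then show False by (simp add: M_iff)
    qed
  next
    assume "int p dvd k"
    then obtain r where "k = r * int p" by (metis dvdE mult.commute)
    then show "\<iota> k \<in> M" using M_mult[OF \<iota>_V p_M] by (simp add: hom)
  qed
  have min: "vleq (vclass (\<iota> (int p))) g" if g: "g \<in> vgroup" "vleq (vclass \<one>) g" "g \<noteq> vclass \<one>" for g
  proof -
    obtain x where x: "x \<in> nonzeros" "g = vclass x" using g(1) by (auto simp: vgroup_def)
    then have "\<not> le x \<one>" using g nonzeros_one by (auto simp: vleq_vclass vclass_eq_iff)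
    then show ?thesis using p_minimal x p' nonzeros_carrier by (auto simp: vleq_vclass)
  qed
  have pos: "vleq (vclass \<one>) (vclass (\<iota> (int p)))" "vclass (\<iota> (int p)) \<noteq> vclass \<one>"
    using p' nonzeros_one p_positive p_M hom(1)
    by (auto simp: vleq_vclass vclass_eq_iff M_iff vle_iff)
  have discrete: "discretely_ordered vgroup (vclass \<one>) vleq"
    unfolding discretely_ordered_def
    using min pos p' by (intro bexI[of _ "vclass (\<iota> (int p))"]) (auto simp: vgroup_def)
  interpret I: ideal M VR by (rule ideal_M)
  let ?h = "\<lambda>k. M +>\<^bsub>VR\<^esub> \<iota> k"
  have "\<iota> \<in> ring_hom \<Z> VR"
    by (rule ring_hom_memI) (auto simp: hom \<iota>_V)
  from ring_hom_trans[OF this I.rcos_ring_hom] have hom_h: "?h \<in> ring_hom \<Z> (VR Quot M)"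
    by (simp add: comp_def)
  then have h: "ring_hom_ring \<Z> (VR Quot M) ?h"
    by (intro ring_hom_ringI2 int.ring_axioms I.quotient_is_ring)
  have surj: "?h ` carrier \<Z> = carrier (VR Quot M)"
  proof
    show "?h ` carrier \<Z> \<subseteq> carrier (VR Quot M)"
      using ring_hom_closed[OF hom_h] by blast
    show "carrier (VR Quot M) \<subseteq> ?h ` carrier \<Z>"
    proof
      fix B assume "B \<in> carrier (VR Quot M)"
      then obtain x where x: "x \<in> V" "B = M +>\<^bsub>VR\<^esub> x"
        by (auto simp: FactRing_def A_RCOSETS_def')
      then have xK: "x \<in> carrier K" "le \<one> x" by (auto simp: V_iff vle_iff)
      obtain k where "le (\<iota> (int p)) (x \<ominus> \<iota> k)" using residue[OF xK] by blast
      then have "x \<ominus> \<iota> k \<in> M" using xK hom(1) by (intro M_p) auto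
      then have "B = ?h k" using residue_eq_iff[OF x(1) \<iota>_V] x(2) by blast
      then show "B \<in> ?h ` carrier \<Z>" by simp
    qed
  qed
  have "?h k = M \<longleftrightarrow> int p dvd k" for k
  proof -
    have "M +>\<^bsub>VR\<^esub> \<zero> = M" using I.a_rcos_const zero_in_M by blast
    then have "?h k = M \<longleftrightarrow> \<iota> k \<ominus> \<zero> \<in> M"
      using residue_eq_iff[OF \<iota>_V[of k], of \<zero>] zero_in_M M_subset by auto
    also have "\<iota> k \<ominus> \<zero> = \<iota> k" using hom(1) by (simp add: minus_eq)
    finally show ?thesis by (simp add: \<iota>_M)
  qed
  then have "a_kernel \<Z> (VR Quot M) ?h = Idl\<^bsub>\<Z>\<^esub> {int p}"
    by (auto simp: a_kernel_def' int_Idl FactRing_def dvd_def mult.commute)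
  then have "ZFact (int p) \<simeq> residue_field K (vclass \<one>) vleq vclass"
    using ring_hom_ring.FactRing_iso[OF h surj] by (simp add: ZFact_def residue_field_def)
  then have "residue_field K (vclass \<one>) vleq vclass \<simeq> ZFact (int p)"
    using ring_iso_sym ZFact_is_cring cring.axioms(1) by blast
  then show ?thesis
    unfolding p_valuation_def Let_def
    using valuation_vclass discrete pos min by (auto simp: \<iota>p)
qed

end

subsection \<open>The field of fractions modulo the support\<close>

context cancel_divisibility
begin

text \<open>Numerators and denominators are wrapped in singletons only because the theorem prescribes
  the type of the field.\<close>

definition fraction :: "'a \<Rightarrow> 'a \<Rightarrow> ('a set \<times> 'a set) set" where
  "fraction a b = {({c}, {d}) | c d. \<not> 0 \<preceq> d \<and> 0 \<preceq> a * d - c * b}"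

definition numer :: "('a set \<times> 'a set) set \<Rightarrow> 'a" where
  "numer x = fst (SOME (a, b). \<not> 0 \<preceq> b \<and> x = fraction a b)"

definition denom :: "('a set \<times> 'a set) set \<Rightarrow> 'a" where
  "denom x = snd (SOME (a, b). \<not> 0 \<preceq> b \<and> x = fraction a b)"

definition fraction_field :: "('a set \<times> 'a set) set ring" where
  "fraction_field = \<lparr>carrier = {fraction a b | a b. \<not> 0 \<preceq> b},
     monoid.mult = (\<lambda>x y. fraction (numer x * numer y) (denom x * denom y)),
     one = fraction 1 1, ring.zero = fraction 0 1,
     ring.add = (\<lambda>x y. fraction (numer x * denom y + numer y * denom x) (denom x * denom y))\<rparr>"

definition frac_le :: "('a set \<times> 'a set) set \<Rightarrow> ('a set \<times> 'a set) set \<Rightarrow> bool" where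
  "frac_le x y \<longleftrightarrow> numer x * denom y \<preceq> numer y * denom x"

lemma null_diff_trans:
  assumes "0 \<preceq> a * d - c * b" "0 \<preceq> c * f - e * d" "\<not> 0 \<preceq> d"
  shows "0 \<preceq> a * f - e * b"
proof -
  have "(a * f - e * b) * d = (a * d - c * b) * f + (c * f - e * d) * b"
    by (simp add: algebra_simps)
  moreover have "0 \<preceq> \<dots>" using assms by (intro add null_mult)
  ultimately show ?thesis using assms(3) by (metis null_mult_iff)
qed

lemma frac_eq_iff:
  assumes "\<not> 0 \<preceq> b" "\<not> 0 \<preceq> d"
  shows "fraction a b = fraction c d \<longleftrightarrow> 0 \<preceq> a * d - c * b"
proof
  assume "fraction a b = fraction c d"
  moreover have "({c}, {d}) \<in> fraction c d" using assms by (auto simp: fraction_def)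
  ultimately have "({c}, {d}) \<in> fraction a b" by simp
  then show "0 \<preceq> a * d - c * b" by (auto simp: fraction_def)
next
  assume eq: "0 \<preceq> a * d - c * b"
  then have eq': "0 \<preceq> c * b - a * d" using minus[of 0 "a * d - c * b"] by simp
  have "0 \<preceq> a * f - e * b \<longleftrightarrow> 0 \<preceq> c * f - e * d" if "\<not> 0 \<preceq> f" for e f
    using null_diff_trans[OF eq _ assms(2), of f e] null_diff_trans[OF eq' _ assms(1), of f e] by blast
  then show "fraction a b = fraction c d" by (auto simp: fraction_def)
qed

text \<open>The chosen representative of a / b agrees with it only up to cross multiplication modulo
  the support; the rules for sums, products and \<open>frac_le\<close> are derived from
  this.\<close>

lemma numer_denom:
  assumes "\<not> 0 \<preceq> b"
  shows "\<not> 0 \<preceq> denom (fraction a b)" "0 \<preceq> numer (fraction a b) * b - a * denom (fraction a b)"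
proof -
  let ?x = "fraction a b"
  have "case (numer ?x, denom ?x) of (c, d) \<Rightarrow> \<not> 0 \<preceq> d \<and> ?x = fraction c d"
    unfolding numer_def denom_def prod.collapse
    by (rule someI[of _ "(a, b)"]) (use assms in auto)
  then have *: "\<not> 0 \<preceq> denom ?x" "fraction (numer ?x) (denom ?x) = fraction a b" by auto
  then show "\<not> 0 \<preceq> denom ?x" by blast
  show "0 \<preceq> numer ?x * b - a * denom ?x" using * frac_eq_iff[OF *(1) assms] by blast
qed

abbreviation FF where "FF \<equiv> fraction_field"

lemma carrier_FF: "carrier FF = {fraction a b | a b. \<not> 0 \<preceq> b}"
  by (simp add: fraction_field_def)

lemma frac_closed [simp]: "\<not> 0 \<preceq> b \<Longrightarrow> fraction a b \<in> carrier FF"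
  by (auto simp: carrier_FF)

lemma one_FF: "\<one>\<^bsub>FF\<^esub> = fraction 1 1" and zero_FF: "\<zero>\<^bsub>FF\<^esub> = fraction 0 1"
  by (simp_all add: fraction_field_def)

lemma mult_frac:
  assumes "\<not> 0 \<preceq> b" "\<not> 0 \<preceq> d"
  shows "fraction a b \<otimes>\<^bsub>FF\<^esub> fraction c d = fraction (a * c) (b * d)"
proof -
  let ?x = "fraction a b" and ?y = "fraction c d"
  note x = numer_denom[OF assms(1), of a] and y = numer_denom[OF assms(2), of c]
  have "numer ?x * numer ?y * (b * d) - a * c * (denom ?x * denom ?y) =
      (numer ?x * b - a * denom ?x) * (numer ?y * d) + (numer ?y * d - c * denom ?y) * (a * denom ?x)"
    by (simp add: algebra_simps)
  also have "0 \<preceq> \<dots>" using x y by (intro add null_mult)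
  finally have "fraction (numer ?x * numer ?y) (denom ?x * denom ?y) = fraction (a * c) (b * d)"
    using x(1) y(1) assms by (subst frac_eq_iff) simp_all
  then show ?thesis by (simp add: fraction_field_def)
qed

lemma add_frac:
  assumes "\<not> 0 \<preceq> b" "\<not> 0 \<preceq> d"
  shows "fraction a b \<oplus>\<^bsub>FF\<^esub> fraction c d = fraction (a * d + c * b) (b * d)"
proof -
  let ?x = "fraction a b" and ?y = "fraction c d"
  note x = numer_denom[OF assms(1), of a] and y = numer_denom[OF assms(2), of c]
  have "(numer ?x * denom ?y + numer ?y * denom ?x) * (b * d) - (a * d + c * b) * (denom ?x * denom ?y) =
      (numer ?x * b - a * denom ?x) * (d * denom ?y) + (numer ?y * d - c * denom ?y) * (b * denom ?x)"
    by (simp add: algebra_simps)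
  also have "0 \<preceq> \<dots>" using x y by (intro add null_mult)
  finally have "fraction (numer ?x * denom ?y + numer ?y * denom ?x) (denom ?x * denom ?y) =
      fraction (a * d + c * b) (b * d)"
    using x(1) y(1) assms by (subst frac_eq_iff) simp_all
  then show ?thesis by (simp add: fraction_field_def)
qed

lemma cancel_iff: "\<not> 0 \<preceq> c \<Longrightarrow> a * c \<preceq> b * c \<longleftrightarrow> a \<preceq> b"
  using cancel mult_right by blast

lemma frac_le_frac:
  assumes "\<not> 0 \<preceq> b" "\<not> 0 \<preceq> d"
  shows "frac_le (fraction a b) (fraction c d) \<longleftrightarrow> a * d \<preceq> c * b"
proof -
  let ?x = "fraction a b" and ?y = "fraction c d"
  note x = numer_denom[OF assms(1), of a] and y = numer_denom[OF assms(2), of c]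
  have "numer ?x * denom ?y * (b * d) - a * d * (denom ?x * denom ?y) =
      (numer ?x * b - a * denom ?x) * (denom ?y * d)" by (simp add: algebra_simps)
  then have 1: "0 \<preceq> numer ?x * denom ?y * (b * d) - a * d * (denom ?x * denom ?y)"
    using null_mult[OF x(2)] by metis
  have "numer ?y * denom ?x * (b * d) - c * b * (denom ?x * denom ?y) =
      (numer ?y * d - c * denom ?y) * (denom ?x * b)" by (simp add: algebra_simps)
  then have 2: "0 \<preceq> numer ?y * denom ?x * (b * d) - c * b * (denom ?x * denom ?y)"
    using null_mult[OF y(2)] by metis
  have "frac_le ?x ?y \<longleftrightarrow> numer ?x * denom ?y * (b * d) \<preceq> numer ?y * denom ?x * (b * d)"
    unfolding frac_le_def using assms by (subst cancel_iff) auto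
  also have "\<dots> \<longleftrightarrow> a * d * (denom ?x * denom ?y) \<preceq> c * b * (denom ?x * denom ?y)"
    using null_diff_left[OF 1] null_diff[OF 2] by blast
  also have "\<dots> \<longleftrightarrow> a * d \<preceq> c * b"
    using x(1) y(1) by (intro cancel_iff) auto
  finally show ?thesis .
qed

lemma field_FF: "field FF"
proof -
  have elim: thesis if "x \<in> carrier FF" "\<And>a b. \<not> 0 \<preceq> b \<Longrightarrow> x = fraction a b \<Longrightarrow> thesis" for x thesis
    using that by (auto simp: carrier_FF)
  have "abelian_group FF"
  proof (rule abelian_groupI)
    fix x y assume "x \<in> carrier FF" "y \<in> carrier FF"
    then obtain a b c d where xy: "\<not> 0 \<preceq> b" "x = fraction a b" "\<not> 0 \<preceq> d" "y = fraction c d"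
      using elim by metis
    show "x \<oplus>\<^bsub>FF\<^esub> y \<in> carrier FF" "x \<oplus>\<^bsub>FF\<^esub> y = y \<oplus>\<^bsub>FF\<^esub> x"
      using xy by (simp_all add: add_frac ac_simps)
    fix w assume "w \<in> carrier FF"
    then obtain e f where w: "\<not> 0 \<preceq> f" "w = fraction e f" by (rule elim)
    show "(x \<oplus>\<^bsub>FF\<^esub> y) \<oplus>\<^bsub>FF\<^esub> w = x \<oplus>\<^bsub>FF\<^esub> (y \<oplus>\<^bsub>FF\<^esub> w)"
      using xy w by (simp add: add_frac algebra_simps)
  next
    show "\<zero>\<^bsub>FF\<^esub> \<in> carrier FF" by (simp add: zero_FF)
    fix x assume "x \<in> carrier FF"
    then obtain a b where x: "\<not> 0 \<preceq> b" "x = fraction a b" by (rule elim)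
    then show "\<zero>\<^bsub>FF\<^esub> \<oplus>\<^bsub>FF\<^esub> x = x"
      by (simp add: zero_FF add_frac)
    have "fraction (- a) b \<oplus>\<^bsub>FF\<^esub> x = \<zero>\<^bsub>FF\<^esub>"
      using x by (simp add: zero_FF add_frac frac_eq_iff)
    then show "\<exists>y\<in>carrier FF. y \<oplus>\<^bsub>FF\<^esub> x = \<zero>\<^bsub>FF\<^esub>"
      using x frac_closed by blast
  qed
  moreover have "comm_monoid FF"
  proof (rule comm_monoidI)
    fix x y assume "x \<in> carrier FF" "y \<in> carrier FF"
    then obtain a b c d where xy: "\<not> 0 \<preceq> b" "x = fraction a b" "\<not> 0 \<preceq> d" "y = fraction c d"
      using elim by metis
    show "x \<otimes>\<^bsub>FF\<^esub> y \<in> carrier FF" "x \<otimes>\<^bsub>FF\<^esub> y = y \<otimes>\<^bsub>FF\<^esub> x"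
      using xy by (simp_all add: mult_frac ac_simps)
    fix w assume "w \<in> carrier FF"
    then obtain e f where w: "\<not> 0 \<preceq> f" "w = fraction e f" by (rule elim)
    show "(x \<otimes>\<^bsub>FF\<^esub> y) \<otimes>\<^bsub>FF\<^esub> w = x \<otimes>\<^bsub>FF\<^esub> (y \<otimes>\<^bsub>FF\<^esub> w)"
      using xy w by (simp add: mult_frac algebra_simps)
  qed (auto elim!: elim simp: mult_frac one_FF)
  moreover have "(x \<oplus>\<^bsub>FF\<^esub> y) \<otimes>\<^bsub>FF\<^esub> w = x \<otimes>\<^bsub>FF\<^esub> w \<oplus>\<^bsub>FF\<^esub> y \<otimes>\<^bsub>FF\<^esub> w"
    if xyw: "x \<in> carrier FF" "y \<in> carrier FF" "w \<in> carrier FF" for x y w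
  proof -
    obtain a b where x: "\<not> 0 \<preceq> b" "x = fraction a b" by (rule elim[OF xyw(1)])
    obtain c d where y: "\<not> 0 \<preceq> d" "y = fraction c d" by (rule elim[OF xyw(2)])
    obtain e f where w: "\<not> 0 \<preceq> f" "w = fraction e f" by (rule elim[OF xyw(3)])
    show ?thesis
      using x(1) y(1) w(1) by (simp add: x(2) y(2) w(2) add_frac mult_frac frac_eq_iff algebra_simps)
  qed
  ultimately have "cring FF" by (intro cringI) auto
  then show ?thesis
  proof (rule cring.cring_fieldI2)
    show "\<zero>\<^bsub>FF\<^esub> \<noteq> \<one>\<^bsub>FF\<^esub>" by (simp add: zero_FF one_FF frac_eq_iff)
    fix x assume "x \<in> carrier FF" "x \<noteq> \<zero>\<^bsub>FF\<^esub>"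
    obtain a b where x: "\<not> 0 \<preceq> b" "x = fraction a b" by (rule elim[OF \<open>x \<in> carrier FF\<close>])
    then have "\<not> 0 \<preceq> a" using \<open>x \<noteq> \<zero>\<^bsub>FF\<^esub>\<close> by (auto simp: zero_FF frac_eq_iff)
    then have "x \<otimes>\<^bsub>FF\<^esub> fraction b a = \<one>\<^bsub>FF\<^esub>"
      using x by (simp add: one_FF mult_frac frac_eq_iff ac_simps)
    then show "\<exists>y\<in>carrier FF. x \<otimes>\<^bsub>FF\<^esub> y = \<one>\<^bsub>FF\<^esub>"
      using frac_closed \<open>\<not> 0 \<preceq> a\<close> by blast
  qed
qed

lemma embedding_FF: "ring_hom_into FF (\<lambda>a. fraction a 1)"
  by (auto simp: ring_hom_into_def add_frac mult_frac one_FF)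

lemma embedding_int_FF: "ring_hom_into FF (\<lambda>k. fraction (of_int k) 1)"
  by (auto simp: ring_hom_into_def add_frac mult_frac one_FF)

end

section \<open>The p-valuation on the field of fractions\<close>

context p_divisibility_spectrum
begin

lemma preordered_FF: "preordered_field FF frac_le"
proof -
  interpret F: field FF by (rule field_FF)
  have elim: thesis if "x \<in> carrier FF" "\<And>a b. \<not> 0 \<preceq> b \<Longrightarrow> x = fraction a b \<Longrightarrow> thesis" for x thesis
    using that by (auto simp: carrier_FF)
  show ?thesis
  proof (rule preordered_field.intro[OF field_FF], unfold_locales)
    fix x y w assume xyw: "x \<in> carrier FF" "y \<in> carrier FF" "w \<in> carrier FF"
    obtain a b where x: "\<not> 0 \<preceq> b" "x = fraction a b" by (rule elim[OF xyw(1)])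
    obtain c d where y: "\<not> 0 \<preceq> d" "y = fraction c d" by (rule elim[OF xyw(2)])
    obtain e f where w: "\<not> 0 \<preceq> f" "w = fraction e f" by (rule elim[OF xyw(3)])
    show "frac_le x w" if "frac_le x y" "frac_le y w"
    proof -
      have 1: "a * d \<preceq> c * b" "c * f \<preceq> e * d"
        using that x(1) y(1) w(1) by (simp_all add: x(2) y(2) w(2) frac_le_frac)
      have "a * f * d \<preceq> c * b * f" using mult_right[OF 1(1), of f] by (simp add: ac_simps)
      also have "\<dots> \<preceq> e * b * d" using mult_right[OF 1(2), of b] by (simp add: ac_simps)
      finally have "a * f \<preceq> e * b" using cancel y(1) by blast
      then show ?thesis using x(1) w(1) by (simp add: x(2) w(2) frac_le_frac)
    qed
    show "frac_le (x \<otimes>\<^bsub>FF\<^esub> w) (y \<otimes>\<^bsub>FF\<^esub> w)" if "frac_le x y"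
    proof -
      have "a * d \<preceq> c * b" using that x(1) y(1) by (simp add: x(2) y(2) frac_le_frac)
      then have "a * d * (e * f) \<preceq> c * b * (e * f)" by (rule mult_right)
      then show ?thesis
        using x(1) y(1) w(1) by (simp add: x(2) y(2) w(2) mult_frac frac_le_frac ac_simps)
    qed
  next
    fix w x y assume xyw: "x \<in> carrier FF" "y \<in> carrier FF" "w \<in> carrier FF"
      and le: "frac_le w x" "frac_le w y"
    obtain a b where x: "\<not> 0 \<preceq> b" "x = fraction a b" by (rule elim[OF xyw(1)])
    obtain c d where y: "\<not> 0 \<preceq> d" "y = fraction c d" by (rule elim[OF xyw(2)])
    obtain e f where w: "\<not> 0 \<preceq> f" "w = fraction e f" by (rule elim[OF xyw(3)])
    have 1: "e * b \<preceq> a * f" "e * d \<preceq> c * f"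
      using le x(1) y(1) w(1) by (simp_all add: x(2) y(2) w(2) frac_le_frac)
    have "e * (b * d) \<preceq> a * f * d + c * f * b"
      using mult_right[OF 1(1), of d] mult_right[OF 1(2), of b] by (intro add) (simp_all add: ac_simps)
    then show "frac_le w (x \<oplus>\<^bsub>FF\<^esub> y)"
      using x(1) y(1) w(1) by (simp add: x(2) y(2) w(2) add_frac frac_le_frac algebra_simps)
  next
    fix x y assume xy: "x \<in> carrier FF" "y \<in> carrier FF"
    obtain a b where x: "\<not> 0 \<preceq> b" "x = fraction a b" by (rule elim[OF xy(1)])
    obtain c d where y: "\<not> 0 \<preceq> d" "y = fraction c d" by (rule elim[OF xy(2)])
    show "frac_le x y \<or> frac_le y x"
      using total[of "a * d" "c * b"] x(1) y(1) by (simp add: x(2) y(2) frac_le_frac ac_simps)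
    show "x = \<zero>\<^bsub>FF\<^esub>" if "frac_le \<zero>\<^bsub>FF\<^esub> x"
      using that x(1) by (simp add: x(2) zero_FF frac_le_frac frac_eq_iff)
  qed
qed

lemma p_valuation_FF:
  assumes "\<And>n. n > 0 \<Longrightarrow> (of_nat n :: 'a) dvd 1"
  obtains G pl z leq and v :: "('a set \<times> 'a set) set \<Rightarrow> ('a set \<times> 'a set) set set"
  where "field FF" "char_zero_ring FF" "ring_hom_into FF (\<lambda>a. fraction a 1)" "p_valuation p FF G pl z leq v"
proof -
  interpret F: preordered_field FF frac_le by (rule preordered_FF)
  note hom = F.ring_hom_into_facts[OF embedding_FF]
    and hom_int = F.ring_hom_into_facts[OF embedding_int_FF]
  \<comment> \<open>A null unit would make 1 null. Positive integers therefore stay nonzero modulo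
    the support, and the field has characteristic 0.\<close>
  have nonnull: "\<not> 0 \<preceq> of_nat n" if n: "n > 0" for n
  proof
    assume "0 \<preceq> of_nat n"
    obtain u :: 'a where "1 = of_nat n * u" using assms[OF n] unfolding dvd_def by blast
    then show False using null_mult[OF \<open>0 \<preceq> of_nat n\<close>, of u] by simp
  qed
  have "p_valuation p FF F.vgroup F.vmult (F.vclass \<one>\<^bsub>FF\<^esub>) F.vleq F.vclass"
  proof (rule F.p_valuation_vclass[OF p embedding_int_FF])
    show "fraction (of_int (int p)) 1 \<noteq> \<zero>\<^bsub>FF\<^esub>"
      using nonnull prime_gt_0_nat[OF p] by (simp add: zero_FF frac_eq_iff)
    show "\<not> frac_le (fraction (of_int (int p)) 1) \<one>\<^bsub>FF\<^esub>"
      using p_nonunit by (simp add: one_FF frac_le_frac)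
    fix x assume "x \<in> carrier FF"
    then obtain a b where x: "\<not> 0 \<preceq> b" "x = fraction a b" by (auto simp: carrier_FF)
    show "frac_le (fraction (of_int (int p)) 1) x" if "\<not> frac_le x \<one>\<^bsub>FF\<^esub>"
    proof -
      have "\<not> a \<preceq> b" using that x(1) by (simp add: x(2) one_FF frac_le_frac)
      then have "of_nat p * b \<preceq> a" using p_minimal total by blast
      then show ?thesis using x(1) by (simp add: x(2) frac_le_frac)
    qed
    show "\<exists>k. frac_le (fraction (of_int (int p)) 1) (x \<ominus>\<^bsub>FF\<^esub> fraction (of_int k) 1)"
      if "frac_le \<one>\<^bsub>FF\<^esub> x"
    proof -
      have "b \<preceq> a" using that x(1) by (simp add: x(2) one_FF frac_le_frac)
      then obtain k where k: "of_nat p * b \<preceq> a - of_nat k * b" using residue_exists by blast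
      have "x \<ominus>\<^bsub>FF\<^esub> fraction (of_int (int k)) 1 = x \<oplus>\<^bsub>FF\<^esub> fraction (of_int (- int k)) 1"
        unfolding F.minus_eq hom_int(6) ..
      also have "\<dots> = fraction (a - of_nat k * b) b"
        using x(1) by (simp add: x(2) add_frac)
      finally show ?thesis using k x(1) by (intro exI[of _ "int k"]) (simp add: frac_le_frac)
    qed
  qed
  moreover have "char_zero_ring FF"
    unfolding char_zero_ring_def
    using nonnull by (auto simp: zero_FF frac_eq_iff simp flip: hom(9))
  ultimately show thesis using that field_FF embedding_FF by blast
qed

end

subsection \<open>The \<open>p\<close>-adic absolute value on the rationals\<close>

locale padic_numbers =
  fixes p :: nat
  assumes p: "Factorial_Ring.prime p"
begin

abbreviation N :: "rat \<Rightarrow> rat" where "N \<equiv> padic_abs p"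
abbreviation val :: "int \<Rightarrow> int" where "val a \<equiv> int (multiplicity (int p) a)"

lemma p_gt_1: "(1::rat) < of_nat p"
  using prime_gt_1_nat[OF p] by simp

lemma prime_elem_p: "prime_elem (int p)"
  using p by simp

lemma val_mult: "a \<noteq> 0 \<Longrightarrow> b \<noteq> 0 \<Longrightarrow> val (a * b) = val a + val b"
  using prime_elem_multiplicity_mult_distrib[OF prime_elem_p] by simp

text \<open>\<open>padic_abs\<close> is defined by the reduced fraction; since multiplicities add
  under products, every representation gives the same value.\<close>

lemma N_divide:
  assumes "a \<noteq> 0" "b \<noteq> 0"
  shows "N (of_int a / of_int b) = of_nat p powi (val b - val a)"
proof -
  obtain c d where cd: "quotient_of (of_int a / of_int b) = (c, d)" by force
  have d: "d \<noteq> 0" using quotient_of_denom_pos[OF cd] by simp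
  have "(of_int a / of_int b :: rat) = of_int c / of_int d" by (rule quotient_of_div[OF cd])
  then have "(of_int (a * d) :: rat) = of_int (c * b)"
    using assms d by (simp add: field_simps)
  then have eq: "a * d = c * b" by (simp only: of_int_eq_iff)
  then have "c \<noteq> 0" using assms d by auto
  then have "val a + val d = val c + val b"
    using eq assms d val_mult by metis
  then have "padic_val_rat p (of_int a / of_int b) = val a - val b"
    by (simp add: padic_val_rat_def cd)
  then show ?thesis using assms by (simp add: padic_abs_def)
qed

lemma rat_cases:
  obtains a b where "(q::rat) = of_int a / of_int b" "b > 0" "coprime a b"
  using quotient_of_div quotient_of_denom_pos quotient_of_coprime by (metis surj_pair)

lemma N_zero [simp]: "N 0 = 0"
  by (simp add: padic_abs_def)

lemma N_eq_0_iff [simp]: "N q = 0 \<longleftrightarrow> q = 0"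
  using p_gt_1 by (auto simp: padic_abs_def)

lemma N_nonneg [simp]: "N q \<ge> 0"
  by (simp add: padic_abs_def)

lemma N_pos: "q \<noteq> 0 \<Longrightarrow> N q > 0"
  using N_nonneg[of q] N_eq_0_iff[of q] by linarith

lemma N_powi: "q \<noteq> 0 \<Longrightarrow> \<exists>k. N q = of_nat p powi k"
  by (auto simp: padic_abs_def)

lemma N_mult: "N (q * r) = N q * N r"
proof (cases "q = 0 \<or> r = 0")
  case False
  obtain a b where q: "q = of_int a / of_int b" "b > 0" by (rule rat_cases)
  obtain c d where r: "r = of_int c / of_int d" "d > 0" by (rule rat_cases)
  have nz: "a \<noteq> 0" "c \<noteq> 0" "b \<noteq> 0" "d \<noteq> 0" using False q r by auto
  have qr: "q * r = of_int (a * c) / of_int (b * d)" by (simp add: q r)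
  have "N (q * r) = of_nat p powi (val (b * d) - val (a * c))"
    unfolding qr using nz by (intro N_divide) auto
  also have "val (b * d) - val (a * c) = (val b - val a) + (val d - val c)"
    using val_mult[of b d] val_mult[of a c] nz by linarith
  finally show ?thesis
    using nz p_gt_1 by (simp add: q r N_divide power_int_add)
qed auto

lemma N_one [simp]: "N 1 = 1"
  using N_divide[of 1 1] by simp

lemma N_minus [simp]: "N (- q) = N q"
proof -
  have "N (-1) * N (-1) = 1" using N_mult[of "-1" "-1"] by simp
  then have "N (-1) = 1 \<or> N (-1) = -1" by (simp only: square_eq_1_iff)
  then have "N (-1) = 1" using N_nonneg[of "-1"] by auto
  then show ?thesis using N_mult[of "-1" q] by simp
qed

lemma N_power: "N (q ^ n) = N q ^ n"
  by (induction n) (auto simp: N_mult)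

lemma N_inverse: "N (inverse q) = inverse (N q)"
  using N_mult[of q "inverse q"] by (cases "q = 0") (auto simp: field_simps)

lemma N_div: "N (q / r) = N q / N r"
  by (simp add: divide_inverse N_mult N_inverse)

lemma N_p: "N (of_nat p) = inverse (of_nat p)"
  using N_divide[of "int p" 1] prime_gt_0_nat[OF p] multiplicity_self[of "int p"] p
  by (simp add: power_int_minus prime_elem_p)

lemma N_int_le_1: "N (of_int a) \<le> 1"
proof (cases "a = 0")
  case False
  then have "N (of_int a) = inverse (of_nat p powi (val a))"
    using N_divide[of a 1] by (simp add: power_int_minus)
  also have "\<dots> \<le> 1"
    using p_gt_1 by (intro inverse_le_1_iff[THEN iffD2]) (simp add: one_le_power)
  finally show ?thesis .
qed simp

lemma N_add: "N (q + r) \<le> max (N q) (N r)"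
proof -
  have *: "N (q + r) \<le> N q" if "N r \<le> N q" "q \<noteq> 0" "r \<noteq> 0" "q + r \<noteq> 0" for q r
  proof -
    obtain a b where q: "q = of_int a / of_int b" "b > 0" by (rule rat_cases)
    obtain c d where r: "r = of_int c / of_int d" "d > 0" by (rule rat_cases)
    \<comment> \<open>Over a common denominator the claim becomes that a power of p dividing both
      numerators divides their sum.\<close>
    define m where "m = b * d"
    have m: "m \<noteq> 0" using q r by (simp add: m_def)
    have q': "q = of_int (a * d) / of_int m" and r': "r = of_int (c * b) / of_int m"
      using q r by (simp_all add: m_def)
    have sum: "q + r = of_int (a * d + c * b) / of_int m"
      by (simp add: q' r' add_divide_distrib)
    have nz: "a * d \<noteq> 0" "c * b \<noteq> 0" "a * d + c * b \<noteq> 0"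
      using that sum q' r' by (auto simp del: of_int_add of_int_mult)
    have "of_nat p powi (val m - val (c * b)) \<le> (of_nat p :: rat) powi (val m - val (a * d))"
      using that(1) N_divide[OF nz(1) m] N_divide[OF nz(2) m] by (simp only: q' r')
    then have "val (a * d) \<le> val (c * b)"
      using power_int_strict_increasing[of "val m - val (a * d)" "val m - val (c * b)", OF _ p_gt_1]
      by linarith
    then have "int p ^ multiplicity (int p) (a * d) dvd c * b"
      by (intro multiplicity_dvd') simp
    then have "int p ^ multiplicity (int p) (a * d) dvd a * d + c * b"
      by (intro dvd_add multiplicity_dvd)
    then have "val (a * d) \<le> val (a * d + c * b)"
      using nz(3) prime_elem_p by (auto intro!: multiplicity_geI simp: prime_elem_def)
    then show ?thesis
      unfolding sum unfolding q' N_divide[OF nz(1) m] N_divide[OF nz(3) m]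
      using p_gt_1 by (intro power_int_increasing) auto
  qed
  show ?thesis
  proof (cases "q = 0 \<or> r = 0 \<or> q + r = 0")
    case False
    then show ?thesis
      using *[of r q] *[of q r] by (cases "N r \<le> N q") (auto simp: add.commute max_def)
  qed (auto simp: max_def)
qed

lemma N_diff: "N (q - r) \<le> max (N q) (N r)"
  using N_add[of q "- r"] by simp

text \<open>The ultrametric inequality is used both ways: \<open>q\<close> is \<open>r\<close> plus
  the difference, and \<open>r\<close> is \<open>q\<close> minus it.\<close>

lemma N_eq_of_close:
  assumes "N (q - r) < N r"
  shows "N q = N r"
  using N_add[of "q - r" r] N_diff[of q "q - r"] assms by (auto simp: max_def split: if_splits)

lemma N_discrete:
  assumes "N q < N r"
  shows "of_nat p * N q \<le> N r"
proof (cases "q = 0")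
  case False
  have "r \<noteq> 0" using assms N_nonneg[of q] by (metis N_zero not_less)
  then obtain k l where kl: "N q = of_nat p powi k" "N r = of_nat p powi l"
    using N_powi False by blast
  then have "k < l" using assms p_gt_1 power_int_increasing[of l k "rat_of_nat p"] by linarith
  then have "of_nat p powi (k + 1) \<le> N r"
    unfolding kl using p_gt_1 by (intro power_int_increasing) auto
  then show ?thesis using p_gt_1 by (simp add: kl power_int_add mult.commute)
qed simp

lemma N_unit_denominator:
  assumes "N q \<le> 1"
  obtains a b where "q = of_int a / of_int b" "\<not> int p dvd b"
proof -
  obtain a b where q: "q = of_int a / of_int b" "b > 0" "coprime a b" by (rule rat_cases)
  show thesis
  proof (cases "int p dvd b")
    case True
    then have "\<not> int p dvd a" 
      using q(3) prime_elem_p coprime_common_divisor[of a b "int p"] by (auto simp: prime_elem_def)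
    then have a: "a \<noteq> 0" "val a = 0" by (auto simp: not_dvd_imp_multiplicity_0)
    have "val b > 0" using True q(2) prime_elem_p
      by (simp add: prime_multiplicity_gt_zero_iff)
    then have "of_nat p powi 0 < (of_nat p powi (val b) :: rat)"
      using p_gt_1 by (intro power_int_strict_increasing) auto
    then show thesis using assms N_divide[of a b] a q by simp
  qed (use q that in blast)
qed

text \<open>This is Fermat's congruence for x = a / b. Write x = i / j with j prime to p; over the
  denominator j^(p + 1) the numerator of x^p - x is j i^p - i j^p = j (i^p - i) - i (j^p - j), so
  that two instances of the congruence for integers suffice.\<close>

lemma N_fermat:
  assumes "N a \<le> N b"
  shows "N (a ^ p * b - b ^ p * a) \<le> inverse (of_nat p) * N b ^ (p + 1)"
proof (cases "b = 0")
  case True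
  then have "a = 0" using assms N_nonneg[of a] N_eq_0_iff[of a] by simp
  then show ?thesis using True prime_gt_0_nat[OF p] by simp
next
  case False
  define x where "x = a / b"
  have "N x \<le> 1" using assms False N_pos[of b] by (simp add: x_def N_div)
  then obtain i j where x: "x = of_int i / of_int j" "\<not> int p dvd j"
    by (rule N_unit_denominator)
  then have j: "j \<noteq> 0" by auto
  have fermat: "int p dvd k ^ p - k" for k :: int
  proof -
    have "int p dvd (k mod int p) ^ p - k mod int p"
      using prime_dvd_power_minus_self[OF p, of "nat (k mod int p)"] prime_gt_0_nat[OF p] by simp
    moreover have "[(k mod int p) ^ p - k mod int p = k ^ p - k] (mod int p)"
      by (intro cong_diff cong_pow) (simp_all add: cong_def)
    ultimately show ?thesis by (simp add: cong_dvd_iff)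
  qed
  have "int p dvd j * (i ^ p - i) - i * (j ^ p - j)"
    using dvd_diff[OF dvd_mult[OF fermat[of i], of j] dvd_mult[OF fermat[of j], of i]] .
  also have "j * (i ^ p - i) - i * (j ^ p - j) = j * i ^ p - i * j ^ p"
    by (simp add: algebra_simps)
  finally obtain k where k: "j * i ^ p - i * j ^ p = int p * k" by (elim dvdE)
  have Nj: "N (of_int j) = 1"
    using N_divide[of j 1] x(2) j by (simp add: not_dvd_imp_multiplicity_0)
  have "(x ^ p - x) * of_int j ^ (p + 1) = of_int (j * i ^ p - i * j ^ p)"
    using j by (simp add: x field_simps)
  then have "N (x ^ p - x) = inverse (of_nat p) * N (of_int k)"
    using Nj by (metis N_mult N_power N_p k mult.right_neutral of_int_mult of_int_of_nat_eq power_one)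
  then have "N (x ^ p - x) \<le> inverse (of_nat p)"
    using N_int_le_1[of k] p_gt_1 by (simp add: field_simps)
  moreover have "a ^ p * b - b ^ p * a = (x ^ p - x) * b ^ (p + 1)"
    using False by (simp add: x_def field_simps)
  ultimately show ?thesis by (simp only: N_mult N_power) (simp add: mult_right_mono)
qed

end

subsection \<open>Limits of \<open>p\<close>-adic absolute values\<close>

context padic_numbers
begin

abbreviation cauchy where "cauchy \<equiv> padic_cauchy p"
abbreviation null where "null \<equiv> padic_null p"

lemma null_iff: "null xs \<longleftrightarrow> (\<forall>e>0. \<forall>\<^sub>F n in sequentially. N (xs n) < e)"
  by (simp add: padic_null_def eventually_sequentially)

lemma null_add: 
  assumes "null xs" "null ys"
  shows "null (\<lambda>n. xs n + ys n)"
  unfolding null_iff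
proof (intro allI impI)
  fix e :: rat assume "e > 0"
  then have "\<forall>\<^sub>F n in sequentially. N (xs n) < e" "\<forall>\<^sub>F n in sequentially. N (ys n) < e"
    using assms unfolding null_iff by blast+
  then show "\<forall>\<^sub>F n in sequentially. N (xs n + ys n) < e"
  proof eventually_elim
    case (elim n)
    then show ?case using N_add[of "xs n" "ys n"] by simp
  qed
qed

lemma null_minus: "null xs \<Longrightarrow> null (\<lambda>n. - xs n)"
  by (simp add: null_iff)

lemma null_zero: "null (\<lambda>n. 0)"
  by (simp add: null_iff)

lemma null_diff: "null xs \<Longrightarrow> null ys \<Longrightarrow> null (\<lambda>n. xs n - ys n)"
  using null_add[of xs "\<lambda>n. - ys n"] null_minus[of ys] by simp

lemma null_diff_commute: "null (\<lambda>n. xs n - ys n) \<Longrightarrow> null (\<lambda>n. ys n - xs n)"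
  using null_minus[of "\<lambda>n. xs n - ys n"] by simp

lemma null_diff_trans:
  "null (\<lambda>n. xs n - ys n) \<Longrightarrow> null (\<lambda>n. ys n - zs n) \<Longrightarrow> null (\<lambda>n. xs n - zs n)"
  using null_add[of "\<lambda>n. xs n - ys n" "\<lambda>n. ys n - zs n"] by simp

lemma cauchy_const: "cauchy (\<lambda>n. q)"
  by (simp add: padic_cauchy_def)

lemma cauchy_add:
  assumes "cauchy xs" "cauchy ys"
  shows "cauchy (\<lambda>n. xs n + ys n)"
  unfolding padic_cauchy_def
proof (intro allI impI)
  fix e :: rat assume e: "e > 0"
  obtain K where K: "\<And>m n. m \<ge> K \<Longrightarrow> n \<ge> K \<Longrightarrow> N (xs m - xs n) < e"
    using assms(1) e unfolding padic_cauchy_def by blast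
  obtain L where L: "\<And>m n. m \<ge> L \<Longrightarrow> n \<ge> L \<Longrightarrow> N (ys m - ys n) < e"
    using assms(2) e unfolding padic_cauchy_def by blast
  have "N (xs m + ys m - (xs n + ys n)) < e" if "m \<ge> max K L" "n \<ge> max K L" for m n
  proof -
    have eq: "xs m + ys m - (xs n + ys n) = (xs m - xs n) + (ys m - ys n)" by simp
    show ?thesis
      unfolding eq using N_add[of "xs m - xs n" "ys m - ys n"] K[of m n] L[of m n] that by simp
  qed
  then show "\<exists>K. \<forall>m\<ge>K. \<forall>n\<ge>K. N (xs m + ys m - (xs n + ys n)) < e" by blast
qed

lemma cauchy_minus:
  assumes "cauchy xs"
  shows "cauchy (\<lambda>n. - xs n)"
proof -
  have "N (- xs m - - xs n) = N (xs m - xs n)" for m n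
    using N_minus[of "xs m - xs n"] by simp
  then show ?thesis using assms by (simp only: padic_cauchy_def)
qed

lemma cauchy_diff: "cauchy xs \<Longrightarrow> cauchy ys \<Longrightarrow> cauchy (\<lambda>n. xs n - ys n)"
  using cauchy_add[of xs "\<lambda>n. - ys n"] cauchy_minus[of ys] by simp

text \<open>This is the absolute value of the p-adic limit. Unless it is zero it is attained by all
  late terms, so it is rational and can be described without real limits.\<close>

definition limit_abs :: "(nat \<Rightarrow> rat) \<Rightarrow> rat \<Rightarrow> bool" where
  "limit_abs xs l \<longleftrightarrow> l = 0 \<and> null xs \<or> l > 0 \<and> (\<forall>\<^sub>F n in sequentially. N (xs n) = l)"

lemma limit_abs_nonneg: "limit_abs xs l \<Longrightarrow> l \<ge> 0"
  by (auto simp: limit_abs_def)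

lemma limit_abs_exists:
  assumes "cauchy xs"
  shows "\<exists>l. limit_abs xs l"
proof (cases "null xs")
  case False
  then obtain e where e: "e > 0" "\<And>K. \<exists>n\<ge>K. \<not> N (xs n) < e"
    unfolding padic_null_def by blast
  obtain K where K: "\<And>m n. m \<ge> K \<Longrightarrow> n \<ge> K \<Longrightarrow> N (xs m - xs n) < e"
    using assms e(1) unfolding padic_cauchy_def by blast
  obtain n where n: "n \<ge> K" "N (xs n) \<ge> e" using e(2)[of K] by force
  \<comment> \<open>The term at \<open>n\<close> has size at least \<open>e\<close>, while all
    differences from \<open>K\<close> on are smaller than \<open>e\<close>; the size is therefore
    constant from \<open>K\<close> on.\<close>
  have "N (xs m) = N (xs n)" if "m \<ge> K" for m
    using N_eq_of_close[of "xs m" "xs n"] K[OF that n(1)] n(2) by simp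
  then have "limit_abs xs (N (xs n))"
    unfolding limit_abs_def using e(1) n(2) by (auto simp: eventually_sequentially)
  then show ?thesis ..
qed (auto simp: limit_abs_def)

lemma limit_abs_upper:
  assumes "limit_abs xs l" "\<forall>\<^sub>F n in sequentially. N (xs n) \<le> B" "B \<ge> 0"
  shows "l \<le> B"
proof (cases "l > 0")
  case True
  then have "\<forall>\<^sub>F n in sequentially. N (xs n) = l" using assms(1) by (auto simp: limit_abs_def)
  then have "\<forall>\<^sub>F n in sequentially. l \<le> B" using assms(2) by eventually_elim simp
  then show ?thesis by simp
qed (use assms in simp)

lemma limit_abs_bound:
  assumes "limit_abs xs l" "e > 0" "l \<le> e"
  shows "\<forall>\<^sub>F n in sequentially. N (xs n) \<le> e"
proof (cases "l > 0")
  case True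
  then have "\<forall>\<^sub>F n in sequentially. N (xs n) = l" using assms(1) by (auto simp: limit_abs_def)
  then show ?thesis by eventually_elim (use assms in simp)
next
  case False
  then have "\<forall>\<^sub>F n in sequentially. N (xs n) < e" using assms by (auto simp: limit_abs_def null_iff)
  then show ?thesis by eventually_elim simp
qed

lemma limit_abs_unique:
  assumes "limit_abs xs l" "limit_abs xs k"
  shows "l = k"
proof -
  have le: "l \<le> k" if "limit_abs xs l" "limit_abs xs k" for l k
  proof (rule ccontr)
    assume "\<not> l \<le> k"
    \<comment> \<open>The value \<open>k\<close> may be 0, where \<open>limit_abs_bound\<close> does
      not apply; the midpoint is positive and still below \<open>l\<close>.\<close>
    then have less: "k < (l + k) / 2" "(l + k) / 2 < l" by simp_all
    then have pos: "(l + k) / 2 > 0" using limit_abs_nonneg[OF that(2)] by linarith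
    then have "l \<le> (l + k) / 2"
      using limit_abs_upper[OF that(1) limit_abs_bound[OF that(2) pos]] less by simp
    then show False using less by simp
  qed
  then show ?thesis using assms by (meson antisym)
qed

lemma limit_abs_bounded:
  assumes "limit_abs xs l"
  shows "\<forall>\<^sub>F n in sequentially. N (xs n) \<le> l + 1"
  using limit_abs_bound[OF assms, of "l + 1"] limit_abs_nonneg[OF assms] by simp

lemma null_mult_bounded:
  assumes "null xs" "\<forall>\<^sub>F n in sequentially. N (ys n) \<le> B"
  shows "null (\<lambda>n. xs n * ys n)"
  unfolding null_iff
proof (intro allI impI)
  fix e :: rat assume "e > 0"
  define C where "C = \<bar>B\<bar> + 1"
  have C: "C > 0" "B \<le> C" by (auto simp: C_def)
  have "\<forall>\<^sub>F n in sequentially. N (xs n) < e / C"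
    using assms(1) \<open>e > 0\<close> C unfolding null_iff by (metis divide_pos_pos)
  then show "\<forall>\<^sub>F n in sequentially. N (xs n * ys n) < e"
    using assms(2)
  proof eventually_elim
    case (elim n)
    have "N (xs n * ys n) \<le> N (xs n) * C"
      unfolding N_mult using elim C by (intro mult_left_mono) auto
    also have "\<dots> < e" using elim(1) C by (simp add: field_simps)
    finally show ?case .
  qed
qed

lemma cauchy_mult:
  assumes "cauchy xs" "cauchy ys"
  shows "cauchy (\<lambda>n. xs n * ys n)"
  unfolding padic_cauchy_def
proof (intro allI impI)
  fix e :: rat assume e: "e > 0"
  obtain l k where lk: "limit_abs xs l" "limit_abs ys k" using limit_abs_exists assms by blast
  define C where "C = l + k + 1"
  have C: "C > 0" "l + 1 \<le> C" "k + 1 \<le> C"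
    using limit_abs_nonneg[OF lk(1)] limit_abs_nonneg[OF lk(2)] by (auto simp: C_def)
  obtain K1 where K1: "\<And>n. n \<ge> K1 \<Longrightarrow> N (xs n) \<le> C"
    using limit_abs_bounded[OF lk(1)] C unfolding eventually_sequentially by (meson order_trans)
  obtain K2 where K2: "\<And>n. n \<ge> K2 \<Longrightarrow> N (ys n) \<le> C"
    using limit_abs_bounded[OF lk(2)] C unfolding eventually_sequentially by (meson order_trans)
  have eC: "e / C > 0" using e C by simp
  obtain K3 where K3: "\<And>m n. m \<ge> K3 \<Longrightarrow> n \<ge> K3 \<Longrightarrow> N (xs m - xs n) < e / C"
    using assms(1) eC unfolding padic_cauchy_def by blast
  obtain K4 where K4: "\<And>m n. m \<ge> K4 \<Longrightarrow> n \<ge> K4 \<Longrightarrow> N (ys m - ys n) < e / C"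
    using assms(2) eC unfolding padic_cauchy_def by blast
  define K where "K = Max {K1, K2, K3, K4}"
  have small: "N (q * r) < e" if "N q \<le> C" "N r < e / C" for q r
  proof -
    have "N (q * r) \<le> C * N r" unfolding N_mult using that by (intro mult_right_mono) auto
    also have "\<dots> < e" using that(2) C by (simp add: field_simps)
    finally show ?thesis .
  qed
  have "N (xs m * ys m - xs n * ys n) < e" if "m \<ge> K" "n \<ge> K" for m n
  proof -
    have mn: "m \<ge> K1" "n \<ge> K2" "m \<ge> K3" "n \<ge> K3" "m \<ge> K4" "n \<ge> K4"
      using that by (auto simp: K_def)
    have eq: "xs m * ys m - xs n * ys n = xs m * (ys m - ys n) + ys n * (xs m - xs n)"
      by (simp add: algebra_simps)
    show ?thesis
      unfolding eq using N_add[of "xs m * (ys m - ys n)" "ys n * (xs m - xs n)"]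
        small[OF K1[OF mn(1)] K4[OF mn(5,6)]] small[OF K2[OF mn(2)] K3[OF mn(3,4)]] by simp
  qed
  then show "\<exists>K. \<forall>m\<ge>K. \<forall>n\<ge>K. N (xs m * ys m - xs n * ys n) < e" by blast
qed

lemma limit_abs_mult:
  assumes "limit_abs xs l" "limit_abs ys k"
  shows "limit_abs (\<lambda>n. xs n * ys n) (l * k)"
proof (cases "l > 0 \<and> k > 0")
  case True
  then have "\<forall>\<^sub>F n in sequentially. N (xs n) = l" "\<forall>\<^sub>F n in sequentially. N (ys n) = k"
    using assms by (auto simp: limit_abs_def)
  then have "\<forall>\<^sub>F n in sequentially. N (xs n * ys n) = l * k"
    by eventually_elim (simp add: N_mult)
  then show ?thesis using True by (simp add: limit_abs_def)
next
  case False
  then have "null xs \<and> l = 0 \<or> null ys \<and> k = 0" using assms by (auto simp: limit_abs_def)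
  then have "null (\<lambda>n. xs n * ys n)" "l * k = 0"
    using null_mult_bounded[OF _ limit_abs_bounded[OF assms(2)], of xs]
      null_mult_bounded[OF _ limit_abs_bounded[OF assms(1)], of ys] by (auto simp: mult.commute)
  then show ?thesis by (simp add: limit_abs_def)
qed

lemma limit_abs_add:
  assumes "limit_abs xs l" "limit_abs ys k" "limit_abs (\<lambda>n. xs n + ys n) m"
  shows "m \<le> max l k"
proof (rule ccontr)
  assume "\<not> m \<le> max l k"
  \<comment> \<open>Both values may be 0; the midpoint again provides a positive bound below
    \<open>m\<close>.\<close>
  then have less: "max l k < (m + max l k) / 2" "(m + max l k) / 2 < m" by (simp_all del: max_less_iff_conj)
  define e where "e = (m + max l k) / 2"
  have e: "e > 0" "l \<le> e" "k \<le> e" "e < m"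
    using less limit_abs_nonneg[OF assms(1)] unfolding e_def by linarith+
  have "\<forall>\<^sub>F n in sequentially. N (xs n) \<le> e" "\<forall>\<^sub>F n in sequentially. N (ys n) \<le> e"
    using limit_abs_bound assms e by blast+
  then have "\<forall>\<^sub>F n in sequentially. N (xs n + ys n) \<le> e"
  proof eventually_elim
    case (elim n)
    then show ?case using N_add[of "xs n" "ys n"] by simp
  qed
  then have "m \<le> e" using limit_abs_upper[OF assms(3)] e by simp
  then show False using e by simp
qed

lemma limit_abs_const: "limit_abs (\<lambda>n. q) (N q)"
  using null_zero N_pos[of q] by (cases "q = 0") (auto simp: limit_abs_def)

text \<open>Together with \<open>limit_abs_unique\<close> this makes the absolute value a function
  of the class of a Cauchy sequence, hence of the p-adic number.\<close>

lemma limit_abs_cong: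
  assumes null: "null (\<lambda>n. xs n - ys n)" and xs: "limit_abs xs l"
  shows "limit_abs ys l"
proof (cases "l > 0")
  case True
  then have "\<forall>\<^sub>F n in sequentially. N (xs n) = l" using xs by (auto simp: limit_abs_def)
  moreover have "\<forall>\<^sub>F n in sequentially. N (xs n - ys n) < l" using null True by (simp add: null_iff)
  ultimately have "\<forall>\<^sub>F n in sequentially. N (ys n) = l"
  proof eventually_elim
    case (elim n)
    then show ?case
      using N_eq_of_close[of "ys n" "xs n"] N_minus[of "xs n - ys n"] by simp
  qed
  then show ?thesis using True by (simp add: limit_abs_def)
next
  case False
  then have "l = 0" "null xs" using xs by (auto simp: limit_abs_def)
  then show ?thesis using null_diff[OF \<open>null xs\<close> null] by (simp add: limit_abs_def)
qed

section \<open>Arithmetic of classes of Cauchy sequences\<close>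

abbreviation cls where "cls \<equiv> padic_class p"

lemma cls_eq_iff:
  assumes "cauchy xs" "cauchy ys"
  shows "cls xs = cls ys \<longleftrightarrow> null (\<lambda>n. xs n - ys n)"
proof
  assume "cls xs = cls ys"
  moreover have "ys \<in> cls ys" using assms null_zero by (simp add: padic_class_def)
  ultimately have "ys \<in> cls xs" by simp
  then show "null (\<lambda>n. xs n - ys n)" by (simp add: padic_class_def)
next
  assume "null (\<lambda>n. xs n - ys n)"
  then have "null (\<lambda>n. xs n - zs n) \<longleftrightarrow> null (\<lambda>n. ys n - zs n)" for zs
    using null_diff_trans null_diff_commute by blast
  then show "cls xs = cls ys" by (simp add: padic_class_def)
qed

lemma rep_cls:
  assumes "cauchy xs"
  shows "cauchy (padic_rep (cls xs))" "null (\<lambda>n. xs n - padic_rep (cls xs) n)"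
proof -
  have "xs \<in> cls xs" using assms null_zero by (simp add: padic_class_def)
  then have "padic_rep (cls xs) \<in> cls xs" 
    unfolding padic_rep_def by (rule someI[of "\<lambda>x. x \<in> cls xs"])
  then show "cauchy (padic_rep (cls xs))" "null (\<lambda>n. xs n - padic_rep (cls xs) n)"
    by (auto simp: padic_class_def)
qed

text \<open>Cauchy sequences are bounded, so altering a factor by a null sequence alters the product
  by a null sequence. This makes the product in \<open>Qp p\<close>, defined through chosen
  representatives, independent of the choice.\<close>

lemma cauchy_cong_null_mult:
  assumes "null (\<lambda>n. xs n - xs' n)" "cauchy ys"
  shows "null (\<lambda>n. xs n * ys n - xs' n * ys n)"
proof -
  obtain k where "limit_abs ys k" using limit_abs_exists assms(2) by blast
  from null_mult_bounded[OF assms(1) limit_abs_bounded[OF this]] show ?thesis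
    by (simp add: left_diff_distrib)
qed

lemma carrier_Qp: "carrier (Qp p) = {cls xs | xs. cauchy xs}"
  by (simp add: Qp_def)

lemma one_Qp: "\<one>\<^bsub>Qp p\<^esub> = cls (\<lambda>n. 1)"
  by (simp add: Qp_def)

lemma add_Qp:
  assumes "cauchy xs" "cauchy ys"
  shows "cls xs \<oplus>\<^bsub>Qp p\<^esub> cls ys = cls (\<lambda>n. xs n + ys n)"
proof -
  note x = rep_cls[OF assms(1)] and y = rep_cls[OF assms(2)]
  have "null (\<lambda>n. padic_rep (cls xs) n + padic_rep (cls ys) n - (xs n + ys n))"
    using null_add[OF null_diff_commute[OF x(2)] null_diff_commute[OF y(2)]] by (simp add: algebra_simps)
  then show ?thesis
    using x(1) y(1) assms by (simp add: Qp_def cls_eq_iff cauchy_add)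
qed

lemma mult_Qp:
  assumes "cauchy xs" "cauchy ys"
  shows "cls xs \<otimes>\<^bsub>Qp p\<^esub> cls ys = cls (\<lambda>n. xs n * ys n)"
proof -
  note x = rep_cls[OF assms(1)] and y = rep_cls[OF assms(2)]
  let ?x = "padic_rep (cls xs)" and ?y = "padic_rep (cls ys)"
  have "null (\<lambda>n. ?x n * ?y n - xs n * ?y n)"
    by (rule cauchy_cong_null_mult[OF null_diff_commute[OF x(2)] y(1)])
  moreover have "null (\<lambda>n. xs n * ?y n - xs n * ys n)"
    using cauchy_cong_null_mult[OF null_diff_commute[OF y(2)] assms(1)] by (simp add: mult.commute)
  ultimately have "null (\<lambda>n. ?x n * ?y n - xs n * ys n)"
    by (rule null_diff_trans)
  then show ?thesis
    using x(1) y(1) assms by (simp add: Qp_def cls_eq_iff cauchy_mult)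
qed

end

subsection \<open>Divisibility from a homomorphism to the \<open>p\<close>-adic numbers\<close>

text \<open>Uniqueness of inverses justifies the definite description in \<open>int_pow_p\<close>.
  For k = 0 the exponent is not negative and the other branch of the definition applies.\<close>

lemma int_pow_p_minus:
  assumes "(of_nat p :: 'a::comm_ring_1) dvd 1"
  shows "(int_pow_p p (- int k) :: 'a) * of_nat p ^ k = 1"
proof (cases "k = 0")
  case False
  obtain u :: 'a where "1 = of_nat p * u" using assms unfolding dvd_def by blast
  then have u: "u ^ k * of_nat p ^ k = 1" by (simp add: mult.commute flip: power_mult_distrib)
  have "w = u ^ k" if "w * of_nat p ^ k = 1" for w :: 'a
  proof -
    have "w = w * of_nat p ^ k * u ^ k" using u by (simp add: ac_simps)
    then show ?thesis using that by simp
  qed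
  then have "\<exists>!w :: 'a. w * of_nat p ^ k = 1" using u by blast
  from theI'[OF this] show ?thesis using False by (simp add: int_pow_p_def)
qed (simp add: int_pow_p_def)

locale padic_hom = padic_numbers +
  fixes \<delta> :: "'a::comm_ring_1 \<Rightarrow> (nat \<Rightarrow> rat) set"
  assumes hom: "ring_hom_into (Qp p) \<delta>"
begin

text \<open>Calculations with values of \<open>\<delta>\<close> are moved to sequences by way of the
  termwise descriptions of sums, products and 1 on classes.\<close>

definition represents :: "'a \<Rightarrow> (nat \<Rightarrow> rat) \<Rightarrow> bool" where
  "represents a xs \<longleftrightarrow> cauchy xs \<and> \<delta> a = cls xs"

lemma
  shows \<delta>_closed: "\<delta> a \<in> carrier (Qp p)" and \<delta>_add: "\<delta> (a + b) = \<delta> a \<oplus>\<^bsub>Qp p\<^esub> \<delta> b"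
    and \<delta>_mult: "\<delta> (a * b) = \<delta> a \<otimes>\<^bsub>Qp p\<^esub> \<delta> b" and \<delta>_one: "\<delta> 1 = \<one>\<^bsub>Qp p\<^esub>"
  using hom unfolding ring_hom_into_def by blast+

lemma represents_exists: "\<exists>xs. represents a xs"
  using \<delta>_closed[of a] by (auto simp: carrier_Qp represents_def)

lemma represents_unique: "represents a xs \<Longrightarrow> represents a ys \<Longrightarrow> null (\<lambda>n. xs n - ys n)"
  using cls_eq_iff by (auto simp: represents_def)

lemma represents_cong: "represents a xs \<Longrightarrow> null (\<lambda>n. xs n - ys n) \<Longrightarrow> cauchy ys \<Longrightarrow> represents a ys"
  using cls_eq_iff by (auto simp: represents_def)

lemma represents_add: "represents a xs \<Longrightarrow> represents b ys \<Longrightarrow> represents (a + b) (\<lambda>n. xs n + ys n)"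
  by (simp add: \<delta>_add represents_def add_Qp cauchy_add)

lemma represents_mult: "represents a xs \<Longrightarrow> represents b ys \<Longrightarrow> represents (a * b) (\<lambda>n. xs n * ys n)"
  by (simp add: \<delta>_mult represents_def mult_Qp cauchy_mult)

lemma represents_one: "represents 1 (\<lambda>n. 1)"
  by (simp add: \<delta>_one represents_def one_Qp cauchy_const)

lemma represents_diff:
  assumes "represents a xs" "represents b ys"
  shows "represents (a - b) (\<lambda>n. xs n - ys n)"
proof -
  obtain zs where zs: "represents (a - b) zs" using represents_exists by blast
  \<comment> \<open>The difference is reached through additivity: (a - b) + b = a, and comparison
    with \<open>xs\<close> determines \<open>zs\<close> up to a null sequence.\<close>
  have "represents a (\<lambda>n. zs n + ys n)" using represents_add[OF zs assms(2)] by simp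
  then have "null (\<lambda>n. zs n - (xs n - ys n))"
    using represents_unique[OF _ assms(1)] by (simp add: algebra_simps)
  then show ?thesis
    using represents_cong[OF zs] assms cauchy_diff by (auto simp: represents_def)
qed

lemma represents_zero: "represents 0 (\<lambda>n. 0)"
  using represents_diff[OF represents_one represents_one] by simp

lemma represents_power: "represents a xs \<Longrightarrow> represents (a ^ n) (\<lambda>k. xs k ^ n)"
  by (induction n) (auto simp: represents_one intro: represents_mult)

lemma represents_of_nat: "represents (of_nat n) (\<lambda>k. of_nat n)"
  by (induction n) (auto simp: represents_zero intro: represents_add represents_one)

text \<open>This is the p-adic absolute value of \<open>\<delta> a\<close>; independence of the
  chosen sequence is \<open>pull_abs_eq\<close>.\<close>

definition pull_abs :: "'a \<Rightarrow> rat" where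
  "pull_abs a = (SOME l. \<exists>xs. represents a xs \<and> limit_abs xs l)"

lemma pull_abs_eq:
  assumes "represents a xs" "limit_abs xs l"
  shows "pull_abs a = l"
proof -
  have "\<exists>ys. represents a ys \<and> limit_abs ys (pull_abs a)"
    unfolding pull_abs_def by (rule someI[of "\<lambda>l. \<exists>xs. represents a xs \<and> limit_abs xs l"]) (use assms in blast)
  then obtain ys where "represents a ys" "limit_abs ys (pull_abs a)" by blast
  then have "limit_abs xs (pull_abs a)"
    using limit_abs_cong represents_unique assms(1) by blast
  then show ?thesis using limit_abs_unique assms(2) by blast
qed

lemma represents_pull_abs:
  assumes "represents a xs"
  shows "limit_abs xs (pull_abs a)"
proof -
  obtain l where "limit_abs xs l" using assms limit_abs_exists by (auto simp: represents_def)
  then show ?thesis using pull_abs_eq assms by blast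
qed

lemma pull_abs_nonneg: "pull_abs a \<ge> 0"
  using represents_exists[of a] represents_pull_abs limit_abs_nonneg by blast

lemma pull_abs_mult: "pull_abs (a * b) = pull_abs a * pull_abs b"
proof -
  obtain xs ys where xy: "represents a xs" "represents b ys" using represents_exists by blast
  show ?thesis
    by (rule pull_abs_eq[OF represents_mult[OF xy] limit_abs_mult[OF xy[THEN represents_pull_abs]]])
qed

lemma pull_abs_diff: "pull_abs (a - b) \<le> max (pull_abs a) (pull_abs b)"
proof -
  obtain xs ys where xy: "represents a xs" "represents b ys" using represents_exists by blast
  have "represents (- b) (\<lambda>n. - ys n)" using represents_diff[OF represents_zero xy(2)] by simp
  moreover have "limit_abs (\<lambda>n. - ys n) (pull_abs b)"
    using limit_abs_mult[OF limit_abs_const[of "-1"] represents_pull_abs[OF xy(2)]] by simp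
  moreover have "limit_abs (\<lambda>n. xs n + - ys n) (pull_abs (a - b))"
    using represents_pull_abs[OF represents_diff[OF xy]] by simp
  ultimately show ?thesis
    using limit_abs_add represents_pull_abs[OF xy(1)] by blast
qed

lemma pull_abs_of_nat: "pull_abs (of_nat n) = N (of_nat n)"
  using pull_abs_eq represents_of_nat limit_abs_const by blast

lemma pull_abs_zero: "pull_abs 0 = 0" and pull_abs_one: "pull_abs 1 = 1"
  using pull_abs_of_nat[of 0] pull_abs_of_nat[of 1] by simp_all

lemma pull_abs_power: "pull_abs (a ^ n) = pull_abs a ^ n"
  by (induction n) (auto simp: pull_abs_one pull_abs_mult)

lemma pull_abs_discrete:
  assumes "pull_abs b < pull_abs a"
  shows "of_nat p * pull_abs b \<le> pull_abs a"
proof (cases "pull_abs b = 0")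
  case False
  obtain xs ys where xy: "represents a xs" "represents b ys" using represents_exists by blast
  have "pull_abs b > 0" "pull_abs a > 0" using False assms pull_abs_nonneg[of b] by auto
  then have "\<forall>\<^sub>F n in sequentially. N (xs n) = pull_abs a" "\<forall>\<^sub>F n in sequentially. N (ys n) = pull_abs b"
    using represents_pull_abs[OF xy(1)] represents_pull_abs[OF xy(2)] by (auto simp: limit_abs_def)
  then have "\<forall>\<^sub>F n in sequentially. of_nat p * pull_abs b \<le> pull_abs a"
  proof eventually_elim
    case (elim n)
    then show ?case using N_discrete[of "ys n" "xs n"] assms by simp
  qed
  then show ?thesis by simp
qed (simp add: pull_abs_nonneg)

text \<open>\<open>N_fermat\<close> gives the inequality for late terms, and it passes to the limit.
  The case of value 0 is separate because the terms of \<open>ys\<close> then need not have a fixed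
  size.\<close>

lemma pull_abs_fermat:
  assumes "pull_abs a \<le> pull_abs b"
  shows "pull_abs (a ^ p * b - b ^ p * a) \<le> pull_abs (of_nat p * b ^ (p + 1))"
proof (cases "pull_abs b = 0")
  case True
  then have "pull_abs a = 0" using assms pull_abs_nonneg[of a] by simp
  then have "pull_abs (a ^ p * b - b ^ p * a) \<le> 0"
    using pull_abs_diff[of "a ^ p * b" "b ^ p * a"] True by (simp add: pull_abs_mult)
  then show ?thesis using pull_abs_nonneg order_trans by blast
next
  case False
  obtain xs ys where xy: "represents a xs" "represents b ys" using represents_exists by blast
  have pos: "pull_abs b > 0" using False pull_abs_nonneg[of b] by simp
  have "\<forall>\<^sub>F n in sequentially. N (ys n) = pull_abs b"
    using represents_pull_abs[OF xy(2)] pos by (auto simp: limit_abs_def)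
  moreover have "\<forall>\<^sub>F n in sequentially. N (xs n) \<le> pull_abs b"
    by (rule limit_abs_bound[OF represents_pull_abs[OF xy(1)] pos assms])
  ultimately have "\<forall>\<^sub>F n in sequentially. N (xs n ^ p * ys n - ys n ^ p * xs n) \<le>
      inverse (of_nat p) * pull_abs b ^ (p + 1)"
  proof eventually_elim
    case (elim n)
    then show ?case using N_fermat[of "xs n" "ys n"] by simp
  qed
  moreover have "limit_abs (\<lambda>n. xs n ^ p * ys n - ys n ^ p * xs n) (pull_abs (a ^ p * b - b ^ p * a))"
    using xy by (intro represents_pull_abs represents_diff represents_mult represents_power)
  ultimately have "pull_abs (a ^ p * b - b ^ p * a) \<le> inverse (of_nat p) * pull_abs b ^ (p + 1)"
    using limit_abs_upper pos by simp
  then show ?thesis by (simp only: pull_abs_mult pull_abs_of_nat N_p pull_abs_power)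
qed

lemma SpecDp_archimedean:
  assumes unit: "(of_nat p :: 'a) dvd 1"
  shows "(\<lambda>a b. pull_abs b \<le> pull_abs a) \<in> SpecDp p" "p_archimedean p (\<lambda>a b. pull_abs b \<le> pull_abs a)"
proof -
  let ?dv = "\<lambda>a b. pull_abs b \<le> pull_abs a"
  interpret total_divisibility ?dv
  proof
    show "divisibility ?dv"
      unfolding divisibility_def
    proof (intro conjI allI impI)
      show "pull_abs (b - c) \<le> pull_abs a" if "pull_abs b \<le> pull_abs a" "pull_abs c \<le> pull_abs a" for a b c
        using pull_abs_diff[of b c] that by simp
      show "pull_abs (b * c) \<le> pull_abs (a * c)" if "pull_abs b \<le> pull_abs a" for a b c
        using that pull_abs_nonneg[of c] by (simp add: pull_abs_mult mult_right_mono)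
    qed (auto simp: pull_abs_zero pull_abs_one)
    show "?dv a b" if "\<not> ?dv 0 c" "?dv (a * c) (b * c)" for a b c
      using that by (simp add: pull_abs_mult pull_abs_zero)
  qed auto
  have wp: "pull_abs (of_nat p) = inverse (of_nat p)" by (simp add: pull_abs_of_nat N_p)
  show "?dv \<in> SpecDp p"
  proof (rule SpecDpI[OF p])
    show "\<not> pull_abs 1 \<le> pull_abs (of_nat p)"
      using p_gt_1 by (simp add: wp pull_abs_one field_simps)
    show "pull_abs (a ^ p * b - b ^ p * a) \<le> pull_abs (of_nat p * b ^ (p + 1))"
      if "\<not> pull_abs b \<le> pull_abs (of_nat p * a)" for a b
    proof (rule pull_abs_fermat, rule ccontr)
      assume "\<not> pull_abs a \<le> pull_abs b"
      then have "of_nat p * pull_abs b \<le> pull_abs a" by (intro pull_abs_discrete) simp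
      then have "pull_abs b \<le> pull_abs (of_nat p * a)"
        using p_gt_1 by (simp add: pull_abs_mult wp field_simps)
      with that show False by blast
    qed
  qed
  show "p_archimedean p ?dv"
    unfolding p_archimedean_def
  proof
    fix a
    \<comment> \<open>The power p^(-k) has absolute value p^k > k, so any k above the absolute value
      of \<open>\<delta> a\<close> will do.\<close>
    obtain k where "pull_abs a < of_nat k" using reals_Archimedean2 by blast
    also have "(of_nat k :: rat) \<le> of_nat (p ^ k)"
      using power_gt_expt[of p k] prime_gt_1_nat[OF p] by (intro of_nat_mono) simp
    finally have k: "pull_abs a \<le> of_nat p ^ k" by simp
    have "pull_abs (int_pow_p p (- int k)) * pull_abs (of_nat p) ^ k = 1"
      using int_pow_p_minus[OF unit, of k] by (metis pull_abs_mult pull_abs_power pull_abs_one)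
    then have "pull_abs (int_pow_p p (- int k)) = of_nat p ^ k"
      using p_gt_1 by (simp add: wp field_simps)
    then show "\<exists>m. pull_abs a \<le> pull_abs (int_pow_p p m)" using k by metis
  qed
qed

end

subsection \<open>Archimedean divisibilities and rational approximation\<close>

locale archimedean_spectrum = p_divisibility_spectrum +
  assumes archimedean: "p_archimedean p (\<preceq>)"
    and units: "k \<noteq> 0 \<Longrightarrow> (of_int k :: 'a) dvd 1"
begin

sublocale Q: padic_numbers p
  by unfold_locales (rule p)

text \<open>This is the structure map from the rationals. The target is only a ring, so the image of
  c / d is described as the solution e of e d = c, unique because nonzero integers are
  units.\<close>

definition rat_embed :: "rat \<Rightarrow> 'a" where
  "rat_embed q = (THE e. e * of_int (snd (quotient_of q)) = of_int (fst (quotient_of q)))"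

lemma unit_cancel:
  assumes "k \<noteq> 0" "a * of_int k = b * of_int k"
  shows "(a :: 'a) = b"
proof -
  obtain u :: 'a where u: "1 = of_int k * u" using units[OF assms(1)] unfolding dvd_def by blast
  have "a = a * of_int k * u" "b = b * of_int k * u" using u by (simp_all add: mult.assoc)
  then show ?thesis using assms(2) by metis
qed

lemma rat_embed_eqI:
  assumes "q = of_int i / of_int j" "j \<noteq> 0" "e * of_int j = of_int i"
  shows "rat_embed q = e"
  unfolding rat_embed_def
proof (rule the_equality)
  obtain c d where cd: "quotient_of q = (c, d)" by force
  have d: "d \<noteq> 0" using quotient_of_denom_pos[OF cd] by simp
  have "(of_int (i * d) :: rat) = of_int (c * j)"
    using assms(1,2) d quotient_of_div[OF cd] by (simp add: field_simps)
  then have eq: "i * d = c * j" by (simp only: of_int_eq_iff)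
  have "e * of_int d * of_int j = (e * of_int j) * of_int d" by (simp add: ac_simps)
  also have "\<dots> = of_int i * of_int d" using assms(3) by simp
  also have "\<dots> = of_int c * of_int j" using eq by (metis of_int_mult)
  finally show *: "e * of_int (snd (quotient_of q)) = of_int (fst (quotient_of q))"
    using unit_cancel[OF assms(2)] by (simp add: cd)
  show "e' = e" if "e' * of_int (snd (quotient_of q)) = of_int (fst (quotient_of q))" for e'
    using that * unit_cancel[OF d] by (simp add: cd)
qed

lemma rat_embed_cases:
  obtains i j where "q = of_int i / of_int j" "j \<noteq> 0" "rat_embed q * of_int j = of_int i"
proof -
  obtain i j where q: "q = of_int i / of_int j" "j > 0" by (rule Q.rat_cases)
  obtain u :: 'a where u: "1 = of_int j * u" using units[of j] q(2) unfolding dvd_def by auto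
  have "of_int i * u * of_int j = of_int i * (of_int j * u)" by (simp add: ac_simps)
  then have e: "of_int i * u * of_int j = (of_int i :: 'a)" by (simp flip: u)
  then have "rat_embed q = of_int i * u" using rat_embed_eqI[of q i j] q by simp
  then show thesis using that[of i j] q e by simp
qed

lemma rat_embed_of_int [simp]: "rat_embed (of_int k) = of_int k"
  by (rule rat_embed_eqI[of _ k 1]) simp_all

lemma rat_embed_one [simp]: "rat_embed 1 = 1"
  using rat_embed_of_int[of 1] by simp

lemma rat_embed_mult: "rat_embed (q * r) = rat_embed q * rat_embed r"
proof -
  obtain a b where q: "q = of_int a / of_int b" "b \<noteq> 0" "rat_embed q * of_int b = of_int a"
    by (rule rat_embed_cases)
  obtain c d where r: "r = of_int c / of_int d" "d \<noteq> 0" "rat_embed r * of_int d = of_int c"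
    by (rule rat_embed_cases)
  have "rat_embed q * rat_embed r * of_int (b * d) = (rat_embed q * of_int b) * (rat_embed r * of_int d)"
    by (simp add: ac_simps)
  also have "\<dots> = of_int (a * c)" unfolding q(3) r(3) by simp
  finally show ?thesis
    by (rule rat_embed_eqI[rotated 2]) (use q(1,2) r(1,2) in simp_all)
qed

lemma rat_embed_add: "rat_embed (q + r) = rat_embed q + rat_embed r"
proof -
  obtain a b where q: "q = of_int a / of_int b" "b \<noteq> 0" "rat_embed q * of_int b = of_int a"
    by (rule rat_embed_cases)
  obtain c d where r: "r = of_int c / of_int d" "d \<noteq> 0" "rat_embed r * of_int d = of_int c"
    by (rule rat_embed_cases)
  have "(rat_embed q + rat_embed r) * of_int (b * d) =
      (rat_embed q * of_int b) * of_int d + (rat_embed r * of_int d) * of_int b"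
    by (simp add: algebra_simps)
  also have "\<dots> = of_int (a * d + c * b)" unfolding q(3) r(3) by simp
  finally show ?thesis
    by (rule rat_embed_eqI[rotated 2]) (use q(1,2) r(1,2) in \<open>simp_all add: add_frac_eq\<close>)
qed

lemma rat_embed_diff: "rat_embed (q - r) = rat_embed q - rat_embed r"
  using rat_embed_add[of "q - r" r] by simp

lemma rat_embed_power: "rat_embed (q ^ n) = rat_embed q ^ n"
  by (induction n) (simp_all add: rat_embed_mult)

lemma rat_embed_of_nat [simp]: "rat_embed (of_nat n) = of_nat n"
  using rat_embed_of_int[of "int n"] by simp

lemma not_null_p_power: "\<not> 0 \<preceq> of_nat p ^ n"
proof -
  obtain u :: 'a where "1 = of_int (int p) * u"
    using units[of "int p"] prime_gt_0_nat[OF p] unfolding dvd_def by auto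
  then have "\<not> 0 \<preceq> of_nat p" using null_mult[of "of_nat p" u] by auto
  then show ?thesis by simp
qed

lemma p_power_antimono:
  assumes "m \<le> n"
  shows "of_nat p ^ m \<preceq> of_nat p ^ n"
proof -
  have "(of_nat p ^ n :: 'a) = of_nat p ^ m * of_nat p ^ (n - m)"
    using assms by (simp flip: power_add)
  moreover have "1 \<preceq> of_nat p ^ (n - m)"
    using power[OF of_nat[of p], of "n - m"] by simp
  ultimately show ?thesis using integral_mult refl by metis
qed

text \<open>The denominator \<open>b\<close> is prime to p and hence a unit for the divisibility:
  otherwise p would divide \<open>b\<close> by \<open>p_minimal\<close>, and by Bezout also
  1.\<close>

lemma rat_embed_integral:
  assumes "Q.N q \<le> 1"
  shows "1 \<preceq> rat_embed q"
proof -
  obtain a b where q: "q = of_int a / of_int b" "\<not> int p dvd b"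
    using assms by (rule Q.N_unit_denominator)
  then have "coprime (int p) b" using p by (simp add: prime_imp_coprime)
  then obtain u w where uw: "u * int p + w * b = 1" using bezout_int[of "int p" b] by auto
  have "of_int b \<preceq> 1"
  proof (rule ccontr)
    assume "\<not> of_int b \<preceq> 1"
    then have "of_nat p \<preceq> of_int b" using p_minimal[of 1 "of_int b"] by simp
    then have "of_nat p \<preceq> of_int u * of_nat p + of_int w * of_int b"
      by (intro add integral_mult') simp_all
    also have "of_int u * of_nat p + of_int w * of_int b = (of_int (u * int p + w * b) :: 'a)"
      by simp
    finally show False using uw p_nonunit by simp
  qed
  then have le: "rat_embed q * of_int b \<preceq> rat_embed q * 1" by (rule mult_left)
  have "b \<noteq> 0" using q(2) by auto
  then have "rat_embed (q * of_int b) = of_int a" using q(1) by simp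
  then have "rat_embed q * of_int b = of_int a" by (simp only: rat_embed_mult rat_embed_of_int)
  then show ?thesis using le trans[of 1 "of_int a" "rat_embed q"] by simp
qed

lemma rat_embed_dv:
  assumes "Q.N q \<le> inverse (of_nat p) ^ n"
  shows "of_nat p ^ n \<preceq> rat_embed q"
proof -
  define r where "r = q / of_nat p ^ n"
  have "Q.N r \<le> 1"
    using assms Q.p_gt_1 by (simp add: r_def Q.N_div Q.N_power Q.N_p field_simps)
  then have "of_nat p ^ n * 1 \<preceq> of_nat p ^ n * rat_embed r"
    by (intro mult_left rat_embed_integral)
  also have "of_nat p ^ n * rat_embed r = rat_embed (of_nat p ^ n * r)"
    by (simp add: rat_embed_mult rat_embed_power)
  also have "of_nat p ^ n * r = q" using Q.p_gt_1 by (auto simp: r_def)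
  finally show ?thesis by simp
qed

text \<open>If q is too large, p divides p^n / q while p^n divides q. Hence p q | q and q is null,
  which is impossible for a unit. With \<open>rat_embed_dv\<close> this identifies divisibility by
  powers of p on the rationals with p-adic smallness.\<close>

lemma dv_rat_embed:
  assumes "of_nat p ^ n \<preceq> rat_embed q"
  shows "Q.N q \<le> inverse (of_nat p) ^ n"
proof (rule ccontr)
  assume neg: "\<not> ?thesis"
  then have q: "q \<noteq> 0" using Q.p_gt_1 by auto
  define r where "r = of_nat p ^ n / q"
  have "Q.N (of_nat p ^ n) < Q.N q" using neg by (simp add: Q.N_power Q.N_p)
  then have "of_nat p * Q.N (of_nat p ^ n) \<le> Q.N q" by (rule Q.N_discrete)
  then have "Q.N r \<le> inverse (of_nat p) ^ 1"
    using Q.p_gt_1 Q.N_pos[OF q] by (simp add: r_def Q.N_div field_simps)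
  then have "of_nat p ^ 1 \<preceq> rat_embed r" by (rule rat_embed_dv)
  then have "of_nat p * rat_embed q \<preceq> rat_embed r * rat_embed q" by (simp add: mult_right)
  also have "rat_embed r * rat_embed q = of_nat p ^ n"
    using q by (simp add: r_def rat_embed_power flip: rat_embed_mult)
  also have "\<dots> \<preceq> 1 * rat_embed q" using assms by simp
  finally have "0 \<preceq> rat_embed q" using cancel p_nonunit by blast
  then have "0 \<preceq> rat_embed q * rat_embed (inverse q)" by (rule null_mult)
  also have "rat_embed q * rat_embed (inverse q) = 1" using q by (simp flip: rat_embed_mult)
  finally show False by simp
qed

text \<open>This is the form in which the archimedean property is used: denominators can be cleared
  by powers of p.\<close>

lemma integral_multiple: "\<exists>k. 1 \<preceq> of_nat p ^ k * a"
proof -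
  obtain m where m: "int_pow_p p m \<preceq> a" using archimedean unfolding p_archimedean_def by blast
  show ?thesis
  proof (cases "m \<ge> 0")
    case True
    then have "of_nat p ^ nat m \<preceq> a" using m by (simp add: int_pow_p_def)
    moreover have "1 \<preceq> of_nat p ^ nat m" using p_power_antimono[of 0 "nat m"] by simp
    ultimately have "1 \<preceq> of_nat p ^ 0 * a" by (auto intro: trans)
    then show ?thesis by blast
  next
    case False
    have "(of_nat p :: 'a) dvd 1" using units[of "int p"] prime_gt_0_nat[OF p] by simp
    then have "int_pow_p p m * of_nat p ^ nat (- m) = (1 :: 'a)"
      using int_pow_p_minus[of p "nat (- m)"] False by simp
    then show ?thesis using mult_right[OF m, of "of_nat p ^ nat (- m)"] by (metis mult.commute)
  qed
qed

text \<open>The digits of a p-adic expansion are found one at a time: the error at level n is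
  divisible by p^n, and \<open>residue_exists\<close> with b = p^n supplies the next digit.\<close>

lemma int_approximation:
  assumes "1 \<preceq> a"
  shows "\<exists>i. of_nat p ^ n \<preceq> a - of_int i"
proof (induction n)
  case 0
  then show ?case using assms by (intro exI[of _ 0]) simp
next
  case (Suc n)
  then obtain i where "of_nat p ^ n \<preceq> a - of_int i" by blast
  then obtain k where "of_nat p * of_nat p ^ n \<preceq> a - of_int i - of_nat k * of_nat p ^ n"
    using residue_exists by blast
  also have "a - of_int i - of_nat k * of_nat p ^ n = a - of_int (i + int k * int p ^ n)"
    by simp
  finally show ?case unfolding power_Suc by blast
qed

lemma rat_approximation: "\<exists>q. of_nat p ^ n \<preceq> a - rat_embed q"
proof -
  obtain k where "1 \<preceq> of_nat p ^ k * a" using integral_multiple by blast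
  \<comment> \<open>The additional precision k makes up for the later division by p^k.\<close>
  then obtain i where i: "of_nat p ^ (n + k) \<preceq> of_nat p ^ k * a - of_int i"
    using int_approximation by blast
  define q :: rat where "q = of_int i / of_nat p ^ k"
  have "rat_embed q * of_nat p ^ k = rat_embed (q * of_nat p ^ k)"
    by (simp add: rat_embed_mult rat_embed_power)
  also have "q * of_nat p ^ k = of_int i" using Q.p_gt_1 by (auto simp: q_def)
  also have "rat_embed (of_int i) = of_int i" by simp
  finally have "of_nat p ^ n * of_nat p ^ k \<preceq> (a - rat_embed q) * of_nat p ^ k"
    using i by (simp add: power_add algebra_simps)
  then show ?thesis using cancel not_null_p_power by blast
qed

section \<open>Approximating sequences and their p-adic limits\<close>

definition approx :: "'a \<Rightarrow> (nat \<Rightarrow> rat) \<Rightarrow> bool" where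
  "approx a xs \<longleftrightarrow> (\<forall>n. \<forall>\<^sub>F k in sequentially. of_nat p ^ n \<preceq> a - rat_embed (xs k))"

lemma approx_exists: "\<exists>xs. approx a xs"
proof -
  have "\<forall>k. \<exists>q. of_nat p ^ k \<preceq> a - rat_embed q" using rat_approximation by blast
  from choice[OF this] obtain xs where xs: "\<And>k. of_nat p ^ k \<preceq> a - rat_embed (xs k)"
    by blast
  have "\<forall>\<^sub>F k in sequentially. of_nat p ^ n \<preceq> a - rat_embed (xs k)" for n
    unfolding eventually_sequentially using trans[OF p_power_antimono xs] by blast
  then show ?thesis unfolding approx_def by blast
qed

lemma p_power_less:
  assumes "(e::rat) > 0"
  obtains n where "inverse (of_nat p) ^ n < e"
proof -
  obtain n where "inverse e < of_nat n" using reals_Archimedean2 by blast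
  also have "(of_nat n :: rat) \<le> of_nat (p ^ n)"
    using power_gt_expt[of p n] prime_gt_1_nat[OF p] by (intro of_nat_mono) simp
  finally have "inverse e < of_nat p ^ n" by simp
  then have "inverse (of_nat p) ^ n < e"
    using assms Q.p_gt_1 by (simp add: field_simps)
  then show thesis by (rule that)
qed

text \<open>Two late terms differ by a rational divisible by p^n, and \<open>dv_rat_embed\<close>
  turns this into p-adic closeness.\<close>

lemma approx_cauchy:
  assumes "approx a xs"
  shows "Q.cauchy xs"
  unfolding padic_cauchy_def
proof (intro allI impI)
  fix e :: rat assume "e > 0"
  then obtain n where n: "inverse (of_nat p) ^ n < e" by (rule p_power_less)
  obtain K where K: "\<And>k. k \<ge> K \<Longrightarrow> of_nat p ^ n \<preceq> a - rat_embed (xs k)"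
    using assms unfolding approx_def eventually_sequentially by blast
  have "padic_abs p (xs k - xs l) < e" if "k \<ge> K" "l \<ge> K" for k l
  proof -
    have "of_nat p ^ n \<preceq> (a - rat_embed (xs l)) - (a - rat_embed (xs k))"
      using diff[OF K[OF that(2)] K[OF that(1)]] .
    then have "Q.N (xs k - xs l) \<le> inverse (of_nat p) ^ n"
      by (intro dv_rat_embed) (simp add: rat_embed_diff)
    then show ?thesis using n by simp
  qed
  then show "\<exists>K. \<forall>k\<ge>K. \<forall>l\<ge>K. padic_abs p (xs k - xs l) < e" by blast
qed

lemma approx_unique:
  assumes "approx a xs" "approx a ys"
  shows "Q.null (\<lambda>n. xs n - ys n)"
  unfolding Q.null_iff
proof (intro allI impI)
  fix e :: rat assume "e > 0"
  then obtain n where n: "inverse (of_nat p) ^ n < e" by (rule p_power_less)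
  have "\<forall>\<^sub>F k in sequentially. of_nat p ^ n \<preceq> a - rat_embed (xs k)"
    "\<forall>\<^sub>F k in sequentially. of_nat p ^ n \<preceq> a - rat_embed (ys k)"
    using assms unfolding approx_def by blast+
  then show "\<forall>\<^sub>F k in sequentially. Q.N (xs k - ys k) < e"
  proof eventually_elim
    case (elim k)
    have "of_nat p ^ n \<preceq> (a - rat_embed (ys k)) - (a - rat_embed (xs k))"
      using diff[OF elim(2) elim(1)] .
    then have "Q.N (xs k - ys k) \<le> inverse (of_nat p) ^ n"
      by (intro dv_rat_embed) (simp add: rat_embed_diff)
    then show ?case using n by simp
  qed
qed

lemma approx_add:
  assumes "approx a xs" "approx b ys"
  shows "approx (a + b) (\<lambda>n. xs n + ys n)"
  unfolding approx_def
proof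
  fix n
  have "\<forall>\<^sub>F k in sequentially. of_nat p ^ n \<preceq> a - rat_embed (xs k)"
    "\<forall>\<^sub>F k in sequentially. of_nat p ^ n \<preceq> b - rat_embed (ys k)"
    using assms unfolding approx_def by blast+
  then show "\<forall>\<^sub>F k in sequentially. of_nat p ^ n \<preceq> a + b - rat_embed (xs k + ys k)"
  proof eventually_elim
    case (elim k)
    then have "of_nat p ^ n \<preceq> (a - rat_embed (xs k)) + (b - rat_embed (ys k))" by (rule add)
    then show ?case by (simp add: rat_embed_add algebra_simps)
  qed
qed

lemma approx_mult:
  assumes "approx a xs" "approx b ys"
  shows "approx (a * b) (\<lambda>n. xs n * ys n)"
  unfolding approx_def
proof
  fix n
  obtain k l where kl: "1 \<preceq> of_nat p ^ k * a" "1 \<preceq> of_nat p ^ l * b"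
    using integral_multiple by blast
  have scale: "of_nat p ^ n \<preceq> x * y" if "of_nat p ^ (n + m) \<preceq> x" "1 \<preceq> of_nat p ^ m * y" for x y m
  proof -
    have "of_nat p ^ (n + m) \<preceq> x * (of_nat p ^ m * y)" using that by (rule integral_mult)
    then have "of_nat p ^ n * of_nat p ^ m \<preceq> x * y * of_nat p ^ m"
      by (simp add: power_add ac_simps)
    then show ?thesis using cancel not_null_p_power by blast
  qed
  \<comment> \<open>With x and y approximating a and b, the error of the product is (a - x) b + (b -
    y) x. Multiplication by p^l makes b integral, and p^k does so for x, as p^k x = p^k a - p^k (a -
    x). The precision n + k + l absorbs both.\<close>
  have "\<forall>\<^sub>F i in sequentially. of_nat p ^ (n + k + l) \<preceq> a - rat_embed (xs i)"
    "\<forall>\<^sub>F i in sequentially. of_nat p ^ (n + k + l) \<preceq> b - rat_embed (ys i)"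
    using assms unfolding approx_def by blast+
  then show "\<forall>\<^sub>F i in sequentially. of_nat p ^ n \<preceq> a * b - rat_embed (xs i * ys i)"
  proof eventually_elim
    case (elim i)
    have "of_nat p ^ (n + l) \<preceq> a - rat_embed (xs i)" "of_nat p ^ (n + k) \<preceq> b - rat_embed (ys i)"
      "1 \<preceq> a - rat_embed (xs i)"
      using trans[OF p_power_antimono elim(1), of "n + l"] trans[OF p_power_antimono elim(2), of "n + k"]
        trans[OF p_power_antimono elim(1), of 0] by simp_all
    note small = this
    have "1 \<preceq> of_nat p ^ k * a - of_nat p ^ k * (a - rat_embed (xs i))"
      using kl(1) integral_mult[OF _ small(3), of 1 "of_nat p ^ k"] p_power_antimono[of 0 k]
      using diff by simp
    then have "1 \<preceq> of_nat p ^ k * rat_embed (xs i)" by (simp add: algebra_simps)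
    then have "of_nat p ^ n \<preceq> (a - rat_embed (xs i)) * b + (b - rat_embed (ys i)) * rat_embed (xs i)"
      using add[OF scale[OF small(1) kl(2)] scale[OF small(2)]] by blast
    then show ?case by (simp add: rat_embed_mult algebra_simps)
  qed
qed

lemma approx_one: "approx 1 (\<lambda>n. 1)"
  by (simp add: approx_def)

text \<open>By \<open>approx_unique\<close> the class of an approximating sequence does not depend
  on its choice, so termwise sums and products of the chosen sequences lie in the right
  classes.\<close>

lemma exists_padic_hom: "\<exists>\<delta>. ring_hom_into (Qp p) (\<delta> :: 'a \<Rightarrow> (nat \<Rightarrow> rat) set)"
proof -
  have "\<forall>a. \<exists>xs. approx a xs" using approx_exists by blast
  from choice[OF this] obtain xs where xs: "\<And>a. approx a (xs a)" by blast
  have c: "Q.cauchy (xs a)" for a using approx_cauchy xs by blast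
  have eq: "Q.cls (xs a) = Q.cls ys" if "approx a ys" for a ys
    using Q.cls_eq_iff[OF c approx_cauchy[OF that]] approx_unique[OF xs that] by blast
  have "ring_hom_into (Qp p) (\<lambda>a. Q.cls (xs a))"
    unfolding ring_hom_into_def
  proof (intro conjI allI)
    show "Q.cls (xs a) \<in> carrier (Qp p)" for a using c by (auto simp: Q.carrier_Qp)
    show "Q.cls (xs (a + b)) = Q.cls (xs a) \<oplus>\<^bsub>Qp p\<^esub> Q.cls (xs b)" for a b
      using eq[OF approx_add[OF xs xs]] c by (simp add: Q.add_Qp)
    show "Q.cls (xs (a * b)) = Q.cls (xs a) \<otimes>\<^bsub>Qp p\<^esub> Q.cls (xs b)" for a b
      using eq[OF approx_mult[OF xs xs]] c by (simp add: Q.mult_Qp)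
    show "Q.cls (xs 1) = \<one>\<^bsub>Qp p\<^esub>"
      using eq[OF approx_one] by (simp add: Q.one_Qp)
  qed
  then show ?thesis by blast
qed

end

text \<open>Condition (c) quantifies over fields, and such a quantifier needs a type. The half that
  produces a field names a type built from \<open>'a\<close>; the half that starts from a field
  allows arbitrary types \<open>'k\<close> and \<open>'g\<close>.\<close>

theorem theorem3p6:
  fixes p :: nat
  assumes "Factorial_Ring.prime p"
    and "(0::'a::comm_ring_1) \<noteq> 1"
    and "\<forall>n::int. n \<noteq> 0 \<longrightarrow> (of_int n :: 'a) dvd 1"
  shows
    "(SpecDp p \<noteq> ({} :: ('a \<Rightarrow> 'a \<Rightarrow> bool) set)
        \<longleftrightarrow> (\<exists>dv :: 'a \<Rightarrow> 'a \<Rightarrow> bool. p_divisibility p dv))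
     \<and> ((\<exists>dv :: 'a \<Rightarrow> 'a \<Rightarrow> bool. p_divisibility p dv) \<longrightarrow>
          (\<exists>(K :: ('a set \<times> 'a set) set ring) (\<delta> :: 'a \<Rightarrow> ('a set \<times> 'a set) set)
             (G :: ('a set \<times> 'a set) set set set) pl z leq v.
             field K \<and> char_zero_ring K \<and> ring_hom_into K \<delta> \<and>
             p_valuation p K G pl z leq v))
     \<and> ((\<exists>(K :: 'k ring) (\<delta> :: 'a \<Rightarrow> 'k) (G :: 'g set) pl z leq v.
             field K \<and> char_zero_ring K \<and> ring_hom_into K \<delta> \<and>
             p_valuation p K G pl z leq v)
          \<longrightarrow> SpecDp p \<noteq> ({} :: ('a \<Rightarrow> 'a \<Rightarrow> bool) set))
     \<and> ((\<exists>dv \<in> (SpecDp p :: ('a \<Rightarrow> 'a \<Rightarrow> bool) set). p_archimedean p dv)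
          \<longleftrightarrow> (\<exists>\<delta> :: 'a \<Rightarrow> (nat \<Rightarrow> rat) set. ring_hom_into (Qp p) \<delta>))"
proof (intro conjI impI)
  have nat_unit: "(of_nat n :: 'a) dvd 1" if "n > 0" for n
    using assms(3)[rule_format, of "int n"] that by simp
  show nonempty: "SpecDp p \<noteq> ({} :: ('a \<Rightarrow> 'a \<Rightarrow> bool) set) \<longleftrightarrow>
      (\<exists>dv :: 'a \<Rightarrow> 'a \<Rightarrow> bool. p_divisibility p dv)"
    using p_divisibility_imp_SpecDp_nonempty by (auto simp: SpecDp_def)
  show "\<exists>(K :: ('a set \<times> 'a set) set ring) (\<delta> :: 'a \<Rightarrow> ('a set \<times> 'a set) set)
      (G :: ('a set \<times> 'a set) set set set) pl z leq v.
      field K \<and> char_zero_ring K \<and> ring_hom_into K \<delta> \<and> p_valuation p K G pl z leq v"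
    if ex: "\<exists>dv :: 'a \<Rightarrow> 'a \<Rightarrow> bool. p_divisibility p dv"
  proof -
    obtain dv :: "'a \<Rightarrow> 'a \<Rightarrow> bool" where "dv \<in> SpecDp p" using ex nonempty by blast
    then interpret p_divisibility_spectrum dv p
      by (rule SpecDp_imp_spectrum[OF assms(1)])
    show ?thesis using p_valuation_FF[OF nat_unit] by metis
  qed
  show "SpecDp p \<noteq> ({} :: ('a \<Rightarrow> 'a \<Rightarrow> bool) set)"
    if ex: "\<exists>(K :: 'k ring) (\<delta> :: 'a \<Rightarrow> 'k) (G :: 'g set) pl z leq v.
      field K \<and> char_zero_ring K \<and> ring_hom_into K \<delta> \<and> p_valuation p K G pl z leq v"
  proof -
    obtain K :: "'k ring" and \<delta> :: "'a \<Rightarrow> 'k" and G :: "'g set" and pl z leq v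
      where K: "field K" "char_zero_ring K" "ring_hom_into K \<delta>" "p_valuation p K G pl z leq v"
      using ex by blast
    interpret field K by (rule K)
    interpret p_valued_field K G pl z leq v p
      by unfold_locales (use K assms(1) in \<open>auto simp: p_valuation_def\<close>)
    show ?thesis using pullback_SpecDp[OF K(3)] by blast
  qed
  show "(\<exists>dv \<in> (SpecDp p :: ('a \<Rightarrow> 'a \<Rightarrow> bool) set). p_archimedean p dv) \<longleftrightarrow>
      (\<exists>\<delta> :: 'a \<Rightarrow> (nat \<Rightarrow> rat) set. ring_hom_into (Qp p) \<delta>)"
  proof
    assume "\<exists>dv \<in> (SpecDp p :: ('a \<Rightarrow> 'a \<Rightarrow> bool) set). p_archimedean p dv"
    then obtain dv :: "'a \<Rightarrow> 'a \<Rightarrow> bool" where dv: "dv \<in> SpecDp p" "p_archimedean p dv" by blast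
    interpret p_divisibility_spectrum dv p
      by (rule SpecDp_imp_spectrum[OF assms(1) dv(1)])
    interpret archimedean_spectrum dv p
      by unfold_locales (use dv assms(3) in auto)
    show "\<exists>\<delta> :: 'a \<Rightarrow> (nat \<Rightarrow> rat) set. ring_hom_into (Qp p) \<delta>"
      by (rule exists_padic_hom)
  next
    assume "\<exists>\<delta> :: 'a \<Rightarrow> (nat \<Rightarrow> rat) set. ring_hom_into (Qp p) \<delta>"
    then obtain \<delta> :: "'a \<Rightarrow> (nat \<Rightarrow> rat) set" where \<delta>: "ring_hom_into (Qp p) \<delta>" by blast
    interpret padic_hom p \<delta> by unfold_locales (use assms(1) \<delta> in auto)
    show "\<exists>dv \<in> (SpecDp p :: ('a \<Rightarrow> 'a \<Rightarrow> bool) set). p_archimedean p dv"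
      using SpecDp_archimedean[OF nat_unit] prime_gt_0_nat[OF assms(1)] by blast
  qed
qed

end
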